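(* For every $n\ge1$ and every finite set $A$, with $X=\mathsf{Conf}_n(A)$, $\mathbb P=\mathscr G_n(A)$ and the function $\psi\colon X\to\mathbb P$, both maps $X\xleftarrow{\mu}|X_{\mathbb P}|\xrightarrow{\pi}|\mathbb P|$ are weak homotopy equivalences. In particular $\mathsf{Conf}_n(A)$ is weakly homotopy equivalent to $|\mathscr G_n(A)|$, compatibly with the symmetric group actions.
   Context: $\mathsf{Conf}_n(A)$ is the space of injective maps $x\colon A\to(0,1)^n$. $\mathscr G_n(A)$ is the poset of acyclic complete directed graphs on $A$ with edge weights in $\{1,\dots,n\}$ (each two-element subset carries exactly one directed weighted edge, and the directions form a linear order on $A$), ordered by $g\le h$ iff whenever $a\xrightarrow{v}b$ in $g$, either $a\xrightarrow{w}b$ in $h$ with $v\le w$ or $b\xrightarrow{w}a$ in $h$ with $v<w$. $\psi(x)$ is the graph whose edge between $a\neq b$ has weight the smallest $i$ with $x(a)_i\neq x(b)_i$, directed $a\to b$ iff $x(a)_i<x(b)_i$. For a function $\varphi\colon X\to\mathbb P$ from a space to a poset, $X_{\mathbb P}$ is the topological poset of pairs $(x,p)$ with $\varphi(x)\le p$, ordered by $(x,p)\le(y,q)$ iff $x=y$ and $p\le q$; $|X_{\mathbb P}|$ is the realisation of its nerve, and $\mu,\pi$ are induced by the two projections. $|\cdot|$ denotes classifying spaces. *)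

theory Defs
  imports "HOL-Analysis.Analysis" "HOL-Homology.Homology"
begin

definition quotient_topology :: "'a topology \<Rightarrow> ('a \<times> 'a) set \<Rightarrow> 'a set topology" where
  "quotient_topology X R = topology (\<lambda>U. U \<subseteq> topspace X // R \<and> openin X (\<Union>U))"

definition sph_base :: "nat \<Rightarrow> real" where
  "sph_base = (\<lambda>i. if i = 0 then 1 else 0)"

text \<open>Weak homotopy equivalence: continuous, bijective on path components, and
bijective on all homotopy groups pi_k(X,x) -> pi_k(Y,f x) (k \<ge> 1) at every basepoint,
where pi_k(X,x) is the set of based maps (S^k, *) -> (X,x) modulo based homotopy.\<close>
definition weak_homotopy_equivalence :: "'a topology \<Rightarrow> 'b topology \<Rightarrow> ('a \<Rightarrow> 'b) \<Rightarrow> bool" where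
  "weak_homotopy_equivalence X Y f \<longleftrightarrow>
     continuous_map X Y f \<and>
     (\<forall>y\<in>topspace Y. \<exists>x\<in>topspace X. path_component_of Y (f x) y) \<and>
     (\<forall>x\<in>topspace X. \<forall>k::nat.
        (\<forall>g. continuous_map (nsphere k) Y g \<and> g sph_base = f x \<longrightarrow>
           (\<exists>h. continuous_map (nsphere k) X h \<and> h sph_base = x \<and>
                homotopic_with (\<lambda>u. u sph_base = f x) (nsphere k) Y (f \<circ> h) g)) \<and>
        (\<forall>h1 h2. continuous_map (nsphere k) X h1 \<and> h1 sph_base = x \<and>
                 continuous_map (nsphere k) X h2 \<and> h2 sph_base = x \<and>
                 homotopic_with (\<lambda>u. u sph_base = f x) (nsphere k) Y (f \<circ> h1) (f \<circ> h2)
                 \<longrightarrow> homotopic_with (\<lambda>u. u sph_base = x) (nsphere k) X h1 h2))"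

text \<open>A topological poset is given by a space T of objects and an order lq which
is assumed to relate points of T. The space of m-simplices of the nerve is the
subspace of T^{0..m} of chains c 0 \<le> c 1 \<le> ... \<le> c m.\<close>
definition nerve :: "'c topology \<Rightarrow> ('c \<Rightarrow> 'c \<Rightarrow> bool) \<Rightarrow> nat \<Rightarrow> (nat \<Rightarrow> 'c) topology" where
  "nerve T lq m = subtopology (product_topology (\<lambda>_. T) {..m}) {c. \<forall>i<m. lq (c i) (c (Suc i))}"

definition simplex_top :: "nat \<Rightarrow> (nat \<Rightarrow> real) topology" where
  "simplex_top m = subtopology (powertop_real UNIV) (standard_simplex m)"

definition simplex_sum :: "'c topology \<Rightarrow> ('c \<Rightarrow> 'c \<Rightarrow> bool) \<Rightarrow>
     (nat \<times> ((nat \<Rightarrow> real) \<times> (nat \<Rightarrow> 'c))) topology" where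
  "simplex_sum T lq = sum_topology (\<lambda>m. prod_topology (simplex_top m) (nerve T lq m)) UNIV"

definition simp_op :: "nat \<Rightarrow> nat \<Rightarrow> (nat \<Rightarrow> nat) \<Rightarrow> bool" where
  "simp_op k m \<theta> \<longleftrightarrow> \<theta> \<in> {..k} \<rightarrow> {..m} \<and> (\<forall>i j. i \<le> j \<and> j \<le> k \<longrightarrow> \<theta> i \<le> \<theta> j)"

definition simp_push :: "nat \<Rightarrow> (nat \<Rightarrow> nat) \<Rightarrow> (nat \<Rightarrow> real) \<Rightarrow> (nat \<Rightarrow> real)" where
  "simp_push k \<theta> t = (\<lambda>j. \<Sum>i\<in>{i. i \<le> k \<and> \<theta> i = j}. t i)"

definition real_gen :: "'c topology \<Rightarrow> ('c \<Rightarrow> 'c \<Rightarrow> bool) \<Rightarrow>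
     ((nat \<times> ((nat \<Rightarrow> real) \<times> (nat \<Rightarrow> 'c))) \<times> (nat \<times> ((nat \<Rightarrow> real) \<times> (nat \<Rightarrow> 'c)))) set" where
  "real_gen T lq = {((k, (t, restrict (c \<circ> \<theta>) {..k})), (m, (simp_push k \<theta> t, c))) | k m \<theta> t c.
      simp_op k m \<theta> \<and> t \<in> standard_simplex k \<and> c \<in> topspace (nerve T lq m)}"

definition real_rel :: "'c topology \<Rightarrow> ('c \<Rightarrow> 'c \<Rightarrow> bool) \<Rightarrow>
     ((nat \<times> ((nat \<Rightarrow> real) \<times> (nat \<Rightarrow> 'c))) \<times> (nat \<times> ((nat \<Rightarrow> real) \<times> (nat \<Rightarrow> 'c)))) set" where
  "real_rel T lq = Id_on (topspace (simplex_sum T lq)) \<union> (real_gen T lq \<union> (real_gen T lq)\<inverse>)\<^sup>+"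

definition realization :: "'c topology \<Rightarrow> ('c \<Rightarrow> 'c \<Rightarrow> bool) \<Rightarrow>
     (nat \<times> ((nat \<Rightarrow> real) \<times> (nat \<Rightarrow> 'c))) set topology" where
  "realization T lq = quotient_topology (simplex_sum T lq) (real_rel T lq)"

definition real_class where
  "real_class T lq e = real_rel T lq `` {e}"

definition realization_map :: "('c \<Rightarrow> 'd) \<Rightarrow> 'd topology \<Rightarrow> ('d \<Rightarrow> 'd \<Rightarrow> bool) \<Rightarrow>
    (nat \<times> ((nat \<Rightarrow> real) \<times> (nat \<Rightarrow> 'c))) set \<Rightarrow> (nat \<times> ((nat \<Rightarrow> real) \<times> (nat \<Rightarrow> 'd))) set" where
  "realization_map F T' lq' U =
     (case SOME e. e \<in> U of (m, (t, c)) \<Rightarrow> real_class T' lq' (m, (t, restrict (F \<circ> c) {..m})))"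

definition XP_top :: "'x topology \<Rightarrow> 'p set \<Rightarrow> ('p \<Rightarrow> 'p \<Rightarrow> bool) \<Rightarrow> ('x \<Rightarrow> 'p) \<Rightarrow> ('x \<times> 'p) topology" where
  "XP_top X P lq \<phi> = subtopology (prod_topology X (discrete_topology P)) {(x, p). p \<in> P \<and> lq (\<phi> x) p}"

definition XP_le :: "('p \<Rightarrow> 'p \<Rightarrow> bool) \<Rightarrow> 'x \<times> 'p \<Rightarrow> 'x \<times> 'p \<Rightarrow> bool" where
  "XP_le lq = (\<lambda>(x, p) (y, q). x = y \<and> lq p q)"

definition poset_realization :: "'p set \<Rightarrow> ('p \<Rightarrow> 'p \<Rightarrow> bool) \<Rightarrow> _" where
  "poset_realization P lq = realization (discrete_topology P) lq"

definition XP_mu :: "(nat \<times> ((nat \<Rightarrow> real) \<times> (nat \<Rightarrow> 'x \<times> 'p))) set \<Rightarrow> 'x" where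
  "XP_mu U = (case SOME e. e \<in> U of (m, (t, c)) \<Rightarrow> fst (c 0))"

definition XP_pi :: "'p set \<Rightarrow> ('p \<Rightarrow> 'p \<Rightarrow> bool) \<Rightarrow> (nat \<times> ((nat \<Rightarrow> real) \<times> (nat \<Rightarrow> 'x \<times> 'p))) set
     \<Rightarrow> (nat \<times> ((nat \<Rightarrow> real) \<times> (nat \<Rightarrow> 'p))) set" where
  "XP_pi P lq = realization_map snd (discrete_topology P) lq"

text \<open>Conf_n(A): injective maps A -> (0,1)^n; points of (0,1)^n are functions on
the coordinate indices 0..n-1 (coordinate i-1 is the paper's coordinate i).\<close>
definition Conf :: "nat \<Rightarrow> 'a set \<Rightarrow> ('a \<Rightarrow> nat \<Rightarrow> real) topology" where
  "Conf n A = subtopology (product_topology (\<lambda>_. product_topology (\<lambda>_. euclideanreal) {..<n}) A)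
     {x. inj_on x A \<and> (\<forall>a\<in>A. \<forall>i<n. 0 < x a i \<and> x a i < 1)}"

text \<open>A weighted directed graph on A is the set of its edges (a, b, v), meaning a -v-> b.\<close>
type_synonym 'a wgraph = "('a \<times> 'a \<times> nat) set"

definition Gn :: "nat \<Rightarrow> 'a set \<Rightarrow> 'a wgraph set" where
  "Gn n A = {g. g \<subseteq> {(a, b, v). a \<in> A \<and> b \<in> A \<and> a \<noteq> b \<and> v \<in> {1..n}} \<and>
     (\<forall>a\<in>A. \<forall>b\<in>A. a \<noteq> b \<longrightarrow> (\<exists>!e. e \<in> g \<and> (\<exists>v. e = (a, b, v) \<or> e = (b, a, v)))) \<and>
     strict_linear_order_on A {(a, b). \<exists>v. (a, b, v) \<in> g}}"

definition Gn_le :: "'a wgraph \<Rightarrow> 'a wgraph \<Rightarrow> bool" where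
  "Gn_le g h \<longleftrightarrow> (\<forall>(a, b, v) \<in> g. (\<exists>w. (a, b, w) \<in> h \<and> v \<le> w) \<or> (\<exists>w. (b, a, w) \<in> h \<and> v < w))"

definition psi :: "'a set \<Rightarrow> ('a \<Rightarrow> nat \<Rightarrow> real) \<Rightarrow> 'a wgraph" where
  "psi A x = {(a, b, Suc i) | a b i. a \<in> A \<and> b \<in> A \<and> a \<noteq> b \<and>
      x a i \<noteq> x b i \<and> (\<forall>j<i. x a j = x b j) \<and> x a i < x b i}"

definition conf_act :: "'a set \<Rightarrow> ('a \<Rightarrow> 'a) \<Rightarrow> ('a \<Rightarrow> nat \<Rightarrow> real) \<Rightarrow> ('a \<Rightarrow> nat \<Rightarrow> real)" where
  "conf_act A \<sigma> x = (\<lambda>a\<in>A. x (inv_into A \<sigma> a))"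

definition graph_act :: "('a \<Rightarrow> 'a) \<Rightarrow> 'a wgraph \<Rightarrow> 'a wgraph" where
  "graph_act \<sigma> g = {(\<sigma> a, \<sigma> b, v) | a b v. (a, b, v) \<in> g}"

end

theory Submission
  imports Defs
begin

text \<open>
  A point of \<open>|X\<^sub>P|\<close> is determined by its image \<open>x\<close> in \<open>X\<close> and by the weights \<open>w\<close> of its image in
  \<open>|P|\<close>. A map \<open>(x, w)\<close> from a metric space is continuous iff \<open>x\<close> and \<open>w\<close> are and every \<open>x k\<close> lies in the
  region of each \<open>p\<close> for which \<open>k\<close> is in the closure of \<open>{w p > 0}\<close>. Along both \<open>\<mu>\<close> and \<open>\<pi>\<close>, maps from
  compact metric spaces lift up to homotopy, relative to a given partial lift; this yields the
  bijections on homotopy groups.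

  For \<open>\<mu>\<close>, a lift over a compact space is a partition of unity on small balls, the bump around \<open>b\<close>
  being the weight of the vertex \<open>\<psi> b\<close>. For \<open>\<pi>\<close>, the regions \<open>{x. \<psi> x \<le> p}\<close> are open and contractible;
  given weights on a chain, the contractions of the regions of its elements are run one after the
  other, in increasing order, by amounts which depend on the weights.
\<close>

section \<open>Relative lifting and weak homotopy equivalences\<close>

text \<open>Along \<open>\<mu>\<close> the new vertices lie below those of the given partial lift,
  so old and new weights can be mixed by a convex combination, and the lift is strict. Along
  \<open>\<pi>\<close> there is an obstacle: contracting the region of \<open>q\<close> keeps a
  point in the regions of \<open>q\<close> and of all larger elements, but nothing is known about
  smaller ones. So once the contraction for \<open>q\<close> has begun, the elements below
  \<open>q\<close> must carry no weight. The lift therefore realises only a truncation of the given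
  weights, whose lowest part has been removed, and restoring that part is the homotopy back to the
  given map. The removed mass grows with the cut-off up to 1/2, which leaves weight to spare as the
  total mass is 1. At 1/2 one of the contractions is complete; this forgets the starting point, so
  from there on the partial lift can be continued by an arbitrary point.\<close>

text \<open>The cut-off \<open>\<zeta>\<close> takes the place of a subspace \<open>L\<close>, namely \<open>{\<zeta> = 0}\<close>. As the partial lift is given on the
  neighbourhood \<open>{\<zeta> < 1}\<close>, no homotopy extension property is needed. The spaces \<open>S\<close> that occur are
  subspaces of cylinders over spheres.\<close>

definition relative_lifting :: "'a topology \<Rightarrow> 'b topology \<Rightarrow> ('a \<Rightarrow> 'b) \<Rightarrow> bool" where
  "relative_lifting E B f \<longleftrightarrow> (\<forall>(S :: ((nat \<Rightarrow> real) \<times> real) set) v \<zeta> u.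
     compact S \<and> continuous_map (top_of_set S) B v \<and> continuous_on S \<zeta> \<and> \<zeta> ` S \<subseteq> {0..1::real} \<and>
     continuous_map (top_of_set {k\<in>S. \<zeta> k < 1}) E u \<and> (\<forall>k\<in>S. \<zeta> k < 1 \<longrightarrow> f (u k) = v k) \<longrightarrow>
     (\<exists>h H. continuous_map (top_of_set S) E h \<and> (\<forall>k\<in>S. \<zeta> k = 0 \<longrightarrow> h k = u k) \<and>
        continuous_map (top_of_set ({0..1::real} \<times> S)) B H \<and>
        (\<forall>k\<in>S. H (0, k) = f (h k) \<and> H (1, k) = v k) \<and>
        (\<forall>k\<in>S. \<forall>t\<in>{0..1}. \<zeta> k = 0 \<longrightarrow> H (t, k) = v k)))"

section \<open>Spheres and the collapse of a cap at the base point\<close>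

definition sph :: "nat \<Rightarrow> (nat \<Rightarrow> real) set" where
  "sph k = {x. (\<Sum>i\<le>k. (x i)\<^sup>2) = 1 \<and> (\<forall>i>k. x i = 0)}"

lemma nsphere_top_of_set: "nsphere k = top_of_set (sph k)"
  by (simp add: nsphere sph_def euclidean_product_topology)

lemma sph_base_in_sph: "sph_base \<in> sph k"
  by (simp add: sph_def sph_base_def power2_eq_square if_distrib [where f = "\<lambda>x. x * _"] cong: if_cong)

lemma sph_coord_le:
  assumes "x \<in> sph k" shows "\<bar>x i\<bar> \<le> 1"
proof (cases "i \<le> k")
  case True
  have "(x i)\<^sup>2 \<le> (\<Sum>i\<le>k. (x i)\<^sup>2)"
    using True by (intro member_le_sum) auto
  then show ?thesis using assms by (simp add: sph_def abs_square_le_1)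
qed (use assms in \<open>auto simp: sph_def\<close>)

lemma compact_sph: "compact (sph k)"
proof -
  have "compactin (product_topology (\<lambda>i. euclidean) UNIV) (PiE UNIV (\<lambda>i::nat. {-1..1::real}))"
    by (subst compactin_PiE) (auto simp: compactin_euclidean_iff)
  then have "compact (PiE UNIV (\<lambda>i::nat. {-1..1::real}))"
    by (simp add: euclidean_product_topology compactin_euclidean_iff)
  moreover have "closed (sph k)"
  proof -
    have "sph k = {x. (\<Sum>i\<le>k. (x i)\<^sup>2) = 1} \<inter> (\<Inter>i\<in>{k<..}. {x. x i = 0})"
      by (auto simp: sph_def)
    moreover have "closed {x::nat\<Rightarrow>real. (\<Sum>i\<le>k. (x i)\<^sup>2) = 1}" 
      by (intro closed_Collect_eq continuous_intros continuous_on_product_coordinates)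
    moreover have "closed {x::nat\<Rightarrow>real. x i = 0}" for i
      by (intro closed_Collect_eq continuous_intros continuous_on_product_coordinates)
    ultimately show ?thesis by (simp add: closed_INT closed_Int)
  qed
  ultimately have "compact (PiE UNIV (\<lambda>i::nat. {-1..1::real}) \<inter> sph k)"
    by (rule compact_Int_closed)
  moreover have "sph k \<subseteq> PiE UNIV (\<lambda>i::nat. {-1..1::real})"
    using sph_coord_le by (fastforce simp: PiE_def abs_le_iff)
  ultimately show ?thesis by (simp add: Int_absorb1)
qed

text \<open>\<open>cap_collapse k t\<close>, for \<open>t\<close> from 0 to 1, deforms the identity of the sphere, relative to the base point,
  to a map which is constant on the cap \<open>{x. x 0 \<ge> 1/2}\<close>.\<close>

definition cap_scale :: "real \<Rightarrow> (nat \<Rightarrow> real) \<Rightarrow> nat \<Rightarrow> real" where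
  "cap_scale t x i = (if i = 0 then x 0 else (1 - t * min 1 (max 0 (2 * x 0))) * x i)"

definition cap_collapse :: "nat \<Rightarrow> real \<Rightarrow> (nat \<Rightarrow> real) \<Rightarrow> nat \<Rightarrow> real" where
  "cap_collapse k t x i = cap_scale t x i / sqrt (\<Sum>j\<le>k. (cap_scale t x j)\<^sup>2)"

text \<open>Other coordinates are shrunk only where coordinate 0 is positive, and coordinate 0
  itself is kept; so normalising never divides by 0.\<close>

lemma cap_scale_norm_pos:
  assumes "x \<in> sph k" shows "0 < (\<Sum>j\<le>k. (cap_scale t x j)\<^sup>2)"
proof (rule ccontr)
  assume "\<not> ?thesis"
  then have "(\<Sum>j\<le>k. (cap_scale t x j)\<^sup>2) = 0"
    by (meson linorder_not_less order_antisym sum_nonneg zero_le_power2)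
  then have z: "\<And>j. j \<le> k \<Longrightarrow> cap_scale t x j = 0"
    by (subst (asm) sum_nonneg_eq_0_iff) auto
  from z[of 0] have "x 0 = 0" by (simp add: cap_scale_def)
  then have "cap_scale t x j = x j" for j by (simp add: cap_scale_def)
  with z assms show False by (simp add: sph_def)
qed

lemma cap_collapse_in_sph:
  assumes "x \<in> sph k" shows "cap_collapse k t x \<in> sph k"
proof -
  let ?N = "\<Sum>j\<le>k. (cap_scale t x j)\<^sup>2"
  have "(\<Sum>i\<le>k. (cap_collapse k t x i)\<^sup>2) = (\<Sum>i\<le>k. (cap_scale t x i)\<^sup>2 / ?N)"
    using cap_scale_norm_pos[OF assms, of t]
    by (simp add: cap_collapse_def power_divide)
  also have "\<dots> = 1"
    using cap_scale_norm_pos[OF assms, of t] by (simp add: sum_divide_distrib[symmetric])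
  finally show ?thesis
    using assms by (auto simp: sph_def cap_collapse_def cap_scale_def)
qed

lemma continuous_on_cap_collapse:
  "continuous_on ({0..1} \<times> sph k) (\<lambda>(t, x). cap_collapse k t x)"
proof -
  have coord: "continuous_on UNIV (\<lambda>z::real \<times> (nat \<Rightarrow> real). snd z i)" for i
    by (rule continuous_on_compose2[OF continuous_on_product_coordinates continuous_on_snd[OF continuous_on_id]]) auto
  have sc: "continuous_on S (\<lambda>z. cap_scale (fst z) (snd z) i)" for i S
    unfolding cap_scale_def
    using coord by (cases "i = 0")
      (simp_all add: continuous_on_subset[OF coord] continuous_on_mult continuous_on_diff
         continuous_on_min continuous_on_max continuous_on_fst)
  show ?thesis
    unfolding case_prod_unfold
  proof (rule continuous_on_coordinatewise_then_product)
    fix i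
    have "\<And>z. z \<in> {0..1} \<times> sph k \<Longrightarrow> sqrt (\<Sum>j\<le>k. (cap_scale (fst z) (snd z) j)\<^sup>2) \<noteq> 0"
      using cap_scale_norm_pos by (metis mem_Times_iff less_irrefl real_sqrt_eq_zero_cancel_iff)
    then show "continuous_on ({0..1} \<times> sph k) (\<lambda>z. cap_collapse k (fst z) (snd z) i)"
      unfolding cap_collapse_def
      by (intro continuous_on_divide continuous_on_real_sqrt continuous_on_sum continuous_on_power sc) auto
  qed
qed

lemma cap_collapse_0:
  assumes "x \<in> sph k" shows "cap_collapse k 0 x = x"
proof -
  have "cap_scale 0 x = x" by (auto simp: cap_scale_def)
  then show ?thesis using assms by (auto simp: cap_collapse_def sph_def)
qed

lemma cap_collapse_base: "cap_collapse k t sph_base = sph_base"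
proof -
  have "cap_scale t sph_base = sph_base" by (auto simp: cap_scale_def sph_base_def)
  then show ?thesis using sph_base_in_sph[of k] by (auto simp: cap_collapse_def sph_def)
qed

lemma cap_collapse_1:
  assumes "1/2 \<le> x 0" shows "cap_collapse k 1 x = sph_base"
proof -
  have *: "cap_scale 1 x = (\<lambda>i. if i = 0 then x 0 else 0)"
    using assms by (auto simp: cap_scale_def fun_eq_iff)
  have "(\<Sum>j\<le>k. (cap_scale 1 x j)\<^sup>2) = (x 0)\<^sup>2"
    by (simp add: * power2_eq_square if_distrib [where f = "\<lambda>x. x * _"] cong: if_cong)
  then show ?thesis using assms * by (auto simp: cap_collapse_def sph_base_def fun_eq_iff)
qed

text \<open>Allows a based map to be replaced by one that is constant near the base point, where a
  constant map then serves as the partial lift.\<close>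

lemma homotopic_cap_collapse:
  assumes "continuous_map (nsphere k) Y g" "g sph_base = y"
  shows "homotopic_with (\<lambda>u. u sph_base = y) (nsphere k) Y g (g \<circ> cap_collapse k 1)"
proof (subst homotopic_with, goal_cases)
  case (1 h h')
  have "h sph_base = h' sph_base"
    using 1 sph_base_in_sph by (simp add: nsphere_top_of_set)
  then show ?case by simp
next
  case 2
  have "continuous_map (prod_topology (top_of_set {0..1}) (nsphere k)) (nsphere k) (\<lambda>(t, x). cap_collapse k t x)"
    using continuous_on_cap_collapse[of k] cap_collapse_in_sph
    by (auto simp: nsphere_top_of_set euclidean_product_topology continuous_map_in_subtopology)
  then have "continuous_map (prod_topology (top_of_set {0..1}) (nsphere k)) Y (g \<circ> (\<lambda>(t, x). cap_collapse k t x))"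
    using assms(1) continuous_map_compose by blast
  then show ?case
    using assms(2) cap_collapse_0
    by (intro exI[of _ "g \<circ> (\<lambda>(t, x). cap_collapse k t x)"])
       (auto simp: cap_collapse_base nsphere_top_of_set)
qed

text \<open>Path components are hit by lifting over a single point, homotopy classes by lifting over
  a sphere. Injectivity comes from lifting over a cylinder, with the lift prescribed at both ends
  and along the base point; its case \<open>k = 0\<close> is injectivity on path components.\<close>

lemma weak_homotopy_equivalence_relative_lifting:
  assumes f: "continuous_map E B f" and lift: "relative_lifting E B f"
  shows "weak_homotopy_equivalence E B f"
  unfolding weak_homotopy_equivalence_def
proof (intro conjI ballI allI impI)
  show "continuous_map E B f" by (fact f)
next
  fix y assume y: "y \<in> topspace B"
  define S where "S = {(\<lambda>_. 0, 0) :: (nat \<Rightarrow> real) \<times> real}"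
  \<comment> \<open>With the cut-off constantly 1 the partial lift lives on the empty set, so that
    \<open>undefined\<close> may stand for it.\<close>
  have "compact S \<and> continuous_map (top_of_set S) B (\<lambda>_. y) \<and> continuous_on S (\<lambda>_. 1::real) \<and>
      (\<lambda>_. 1::real) ` S \<subseteq> {0..1} \<and> continuous_map (top_of_set {k\<in>S. (1::real) < 1}) E (\<lambda>_. undefined) \<and>
      (\<forall>k\<in>S. (1::real) < 1 \<longrightarrow> f undefined = y)"
    using y by (auto simp: S_def)
  then obtain h H where h: "continuous_map (top_of_set S) E h"
    and H: "continuous_map (top_of_set ({0..1::real} \<times> S)) B H" "\<forall>k\<in>S. H (0, k) = f (h k) \<and> H (1, k) = y"
    using lift[unfolded relative_lifting_def, rule_format, of S "\<lambda>_. y" "\<lambda>_. 1" "\<lambda>_. undefined"] by blast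
  let ?p = "(\<lambda>_. 0, 0) :: (nat \<Rightarrow> real) \<times> real"
  have p: "?p \<in> S" by (simp add: S_def)
  have "continuous_map (top_of_set {0..1}) (top_of_set ({0..1::real} \<times> S)) (\<lambda>t. (t, ?p))"
    using p by (auto intro!: continuous_intros)
  then have "pathin B (H \<circ> (\<lambda>t. (t, ?p)))"
    using H(1) continuous_map_compose unfolding pathin_def by blast
  moreover have "h ?p \<in> topspace E" using h p by (auto simp: continuous_map_def)
  ultimately show "\<exists>x\<in>topspace E. path_component_of B (f x) y"
    unfolding path_component_of_def using H(2) p by (intro bexI[of _ "h ?p"] exI[of _ "H \<circ> (\<lambda>t. (t, ?p))"]) auto
next
  fix x k g
  assume x: "x \<in> topspace E" and g: "continuous_map (nsphere k) B g \<and> g sph_base = f x"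
  define c where "c = cap_collapse k 1"
  define S where "S = sph k \<times> {0::real}"
  \<comment> \<open>On the sphere \<open>\<zeta>\<close> vanishes only at the base point, and
    \<open>\<zeta> < 1\<close> holds only inside the cap on which \<open>c\<close> is
    constant.\<close>
  define \<zeta> where "\<zeta> z = min 1 (2 * (1 - fst z 0))" for z :: "(nat \<Rightarrow> real) \<times> real"
  have c: "c u \<in> sph k" if "u \<in> sph k" for u using cap_collapse_in_sph that by (simp add: c_def)
  have gc: "homotopic_with (\<lambda>u. u sph_base = f x) (nsphere k) B g (g \<circ> c)"
    using homotopic_cap_collapse[of k B g "f x"] g by (simp add: c_def)
  then have "continuous_map (top_of_set (sph k)) B (g \<circ> c)"
    using homotopic_with_imp_continuous_maps[OF gc] by (auto simp: nsphere_top_of_set)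
  moreover have "continuous_map (top_of_set S) (top_of_set (sph k)) fst"
    by (auto simp: S_def continuous_map_in_subtopology intro!: continuous_on_fst continuous_on_snd continuous_on_Pair continuous_on_id continuous_on_const)
  ultimately have v: "continuous_map (top_of_set S) B ((g \<circ> c) \<circ> fst)"
    using continuous_map_compose by blast
  have coord: "continuous_on T (\<lambda>z::(nat \<Rightarrow> real) \<times> real. fst z i)" for T i
    by (rule continuous_on_compose2[OF continuous_on_product_coordinates continuous_on_fst[OF continuous_on_id]]) auto
  have "continuous_on S \<zeta>" unfolding \<zeta>_def
    by (intro continuous_on_min continuous_on_const continuous_on_mult continuous_on_diff coord)
  moreover have "\<zeta> ` S \<subseteq> {0..1}" using sph_coord_le[of _ k 0] by (auto simp: \<zeta>_def S_def abs_le_iff)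
  moreover have "compact S" by (auto simp: S_def intro!: compact_Times compact_sph)
  moreover have "f x = ((g \<circ> c) \<circ> fst) z" if "\<zeta> z < 1" for z
  proof -
    have "1/2 \<le> fst z 0" using that by (simp add: \<zeta>_def)
    then show ?thesis using g cap_collapse_1[of "fst z" k] by (simp add: c_def)
  qed
  moreover have "continuous_map (top_of_set {z\<in>S. \<zeta> z < 1}) E (\<lambda>_. x)" using x by simp
  ultimately obtain h H where h: "continuous_map (top_of_set S) E h" "\<forall>z\<in>S. \<zeta> z = 0 \<longrightarrow> h z = x"
    and H: "continuous_map (top_of_set ({0..1::real} \<times> S)) B H"
      "\<forall>z\<in>S. H (0, z) = f (h z) \<and> H (1, z) = ((g \<circ> c) \<circ> fst) z"
      "\<forall>z\<in>S. \<forall>t\<in>{0..1}. \<zeta> z = 0 \<longrightarrow> H (t, z) = ((g \<circ> c) \<circ> fst) z"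
    using lift[unfolded relative_lifting_def, rule_format, of S "(g \<circ> c) \<circ> fst" \<zeta> "\<lambda>_. x"] v by auto
  have base: "(sph_base, 0) \<in> S" "\<zeta> (sph_base, 0) = 0"
    using sph_base_in_sph by (auto simp: S_def \<zeta>_def sph_base_def)
  have cm: "continuous_map (top_of_set (sph k)) (top_of_set S) (\<lambda>s. (s, 0))"
    by (auto simp: S_def continuous_map_in_subtopology intro!: continuous_on_fst continuous_on_snd continuous_on_Pair continuous_on_id continuous_on_const)
  let ?h = "\<lambda>s. h (s, 0)"
  have "continuous_map (nsphere k) E ?h"
    using continuous_map_compose[OF cm h(1)] by (simp add: nsphere_top_of_set o_def)
  moreover have "?h sph_base = x" using h base by blast
  moreover have "homotopic_with (\<lambda>u. u sph_base = f x) (nsphere k) B (f \<circ> ?h) (g \<circ> c)"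
  proof (subst homotopic_with, goal_cases)
    case (1 l l')
    have "l sph_base = l' sph_base" using 1 sph_base_in_sph by (simp add: nsphere_top_of_set)
    then show ?case by simp
  next
    case 2
    have "continuous_map (prod_topology (top_of_set {0..1}) (nsphere k)) (top_of_set ({0..1::real} \<times> S))
        (\<lambda>(t, s). (t, (s, 0)))"
      by (auto simp: nsphere_top_of_set S_def continuous_map_in_subtopology case_prod_unfold
          intro!: continuous_on_fst continuous_on_snd continuous_on_Pair continuous_on_id continuous_on_const)
    from continuous_map_compose[OF this H(1)]
    have "continuous_map (prod_topology (top_of_set {0..1}) (nsphere k)) B (\<lambda>(t, s). H (t, (s, 0)))"
      by (simp add: o_def case_prod_unfold)
    moreover have "g (c sph_base) = f x" using g by (simp add: c_def cap_collapse_base)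
    ultimately show ?case
      using H(2,3) base
      by (intro exI[of _ "\<lambda>(t, s). H (t, (s, 0))"]) (auto simp: nsphere_top_of_set S_def)
  qed
  ultimately show "\<exists>h. continuous_map (nsphere k) E h \<and> h sph_base = x \<and>
      homotopic_with (\<lambda>u. u sph_base = f x) (nsphere k) B (f \<circ> h) g"
    using homotopic_with_trans[OF _ homotopic_with_symD[OF gc]] by (intro exI[of _ ?h]) simp
next
  fix x k h1 h2
  assume x: "x \<in> topspace E"
    and hh: "continuous_map (nsphere k) E h1 \<and> h1 sph_base = x \<and>
         continuous_map (nsphere k) E h2 \<and> h2 sph_base = x \<and>
         homotopic_with (\<lambda>u. u sph_base = f x) (nsphere k) B (f \<circ> h1) (f \<circ> h2)"
  define c where "c = cap_collapse k 1"
  define S where "S = sph k \<times> {0..1::real}"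
  \<comment> \<open>The first part is the cut-off of the cap; the second is below 1 within 1/4 of
    either end of the cylinder. There the clamp \<open>r\<close> rests at 0 or at 1, so that
    \<open>h1 \<circ> c\<close> and \<open>h2 \<circ> c\<close> lift \<open>v\<close>.\<close>
  define \<zeta> where "\<zeta> z = min (min 1 (2 * (1 - fst z 0))) (min (4 * snd z) (4 * (1 - snd z)))" for z :: "(nat \<Rightarrow> real) \<times> real"
  define r where "r t = min 1 (max 0 (2 * t - 1/2))" for t :: real
  have c: "c u \<in> sph k" if "u \<in> sph k" for u using cap_collapse_in_sph that by (simp add: c_def)
  have "continuous_on (sph k) (Pair (1::real))"
    by (intro continuous_on_Pair continuous_on_const continuous_on_id)
  from continuous_on_compose2[OF continuous_on_cap_collapse[of k] this]
  have cont_c: "continuous_on (sph k) c" by (fastforce simp: c_def)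
  have cap: "c (fst z) = sph_base" if "1/2 \<le> fst z 0" for z :: "(nat \<Rightarrow> real) \<times> real"
    using that by (simp add: c_def cap_collapse_1)
  obtain HH where HH: "continuous_map (prod_topology (top_of_set {0..1::real}) (nsphere k)) B HH"
    "\<And>s. HH (0, s) = f (h1 s)" "\<And>s. HH (1, s) = f (h2 s)" "\<And>t. t \<in> {0..1} \<Longrightarrow> HH (t, sph_base) = f x"
    using hh unfolding homotopic_with_def by auto
  define v where "v z = HH (r (snd z), c (fst z))" for z
  define u where "u z = (if snd z \<le> 1/2 then h1 (c (fst z)) else h2 (c (fst z)))" for z :: "(nat \<Rightarrow> real) \<times> real"
  have cc: "continuous_on S (\<lambda>z. c (fst z))"
    by (rule continuous_on_compose2[OF cont_c]) (auto simp: S_def intro!: continuous_on_fst continuous_on_snd continuous_on_Pair continuous_on_id continuous_on_const)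
  have "continuous_map (top_of_set S) (prod_topology (top_of_set {0..1::real}) (nsphere k)) (\<lambda>z. (r (snd z), c (fst z)))"
    using c by (auto simp: nsphere_top_of_set S_def[symmetric] continuous_map_in_subtopology r_def intro!: continuous_intros cc)
       (auto simp: S_def)
  from continuous_map_compose[OF this HH(1)]
  have v: "continuous_map (top_of_set S) B v" by (simp add: o_def v_def[abs_def])
  have coord: "continuous_on T (\<lambda>z::(nat \<Rightarrow> real) \<times> real. fst z i)" for T i
    by (rule continuous_on_compose2[OF continuous_on_product_coordinates continuous_on_fst[OF continuous_on_id]]) auto
  have "continuous_on S \<zeta>" unfolding \<zeta>_def
    by (intro continuous_on_min continuous_on_const continuous_on_mult continuous_on_diff coord continuous_on_snd continuous_on_id)
  moreover have "\<zeta> ` S \<subseteq> {0..1}" using sph_coord_le[of _ k 0] by (auto simp: \<zeta>_def S_def abs_le_iff)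
  moreover have "compact S" by (auto simp: S_def intro!: compact_Times compact_sph)
  moreover have "f (u z) = v z" if z: "z \<in> S" "\<zeta> z < 1" for z
  proof -
    have "1/2 \<le> fst z 0 \<or> snd z \<le> 1/4 \<or> snd z \<ge> 3/4" using z(2) unfolding \<zeta>_def min_less_iff_disj by (cases "fst z 0 < 1/2"; cases "snd z \<le> 1/4"; simp)
    then consider "1/2 \<le> fst z 0" | "snd z \<le> 1/4" | "snd z \<ge> 3/4" by argo
    then show ?thesis
    proof cases
      case 1
      have "r (snd z) \<in> {0..1}" by (auto simp: r_def)
      then show ?thesis using 1 hh HH(4) by (simp add: u_def v_def cap)
    next
      case 2 then have "r (snd z) = 0" by (simp add: r_def)
      then show ?thesis using 2 HH(2) by (simp add: u_def v_def)
    next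
      case 3 then have "r (snd z) = 1" by (simp add: r_def)
      then show ?thesis using 3 HH(3) by (simp add: u_def v_def)
    qed
  qed
  moreover have "continuous_map (top_of_set {z\<in>S. \<zeta> z < 1}) E u"
  proof -
    let ?U = "{z\<in>S. \<zeta> z < 1}"
    have cmc: "continuous_map (top_of_set T) (nsphere k) (\<lambda>z. c (fst z))" if "T \<subseteq> S" for T
      using c continuous_on_subset[OF cc that] that 
      by (fastforce simp: nsphere_top_of_set continuous_map_in_subtopology S_def)
    have h12: "continuous_map (top_of_set T) E (\<lambda>z. h1 (c (fst z)))" "continuous_map (top_of_set T) E (\<lambda>z. h2 (c (fst z)))" if "T \<subseteq> S" for T
      using continuous_map_compose[OF cmc[OF that], of E] hh by (auto simp: o_def)
    have cl: "closedin (top_of_set ?U) {z\<in>?U. snd z \<le> 1/2}" "closedin (top_of_set ?U) {z\<in>?U. snd z \<ge> 1/2}"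
      using continuous_closedin_preimage[OF continuous_on_snd[OF continuous_on_id], of "{..1/2}" ?U]
        continuous_closedin_preimage[OF continuous_on_snd[OF continuous_on_id], of "{1/2..}" ?U]
      by (auto simp: vimage_def Int_def)
    \<comment> \<open>The two halves meet at height 1/2, where \<open>\<zeta> < 1\<close> leaves
      only points over the cap; both branches take the value \<open>x\<close> there.\<close>
    show ?thesis
    proof (rule pasting_lemma_closed[where I = "{True, False}" and
          T = "\<lambda>b. if b then {z\<in>?U. snd z \<le> 1/2} else {z\<in>?U. snd z \<ge> 1/2}" and
          f = "\<lambda>b z. if b then h1 (c (fst z)) else h2 (c (fst z))"], goal_cases)
      case (3 i)
      have "?U \<inter> {z\<in>?U. snd z \<le> 1/2} \<subseteq> S" "?U \<inter> {z\<in>?U. snd z \<ge> 1/2} \<subseteq> S" by auto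
      then show ?case using h12 by (simp add: subtopology_subtopology)
    next
      case (4 i j z)
      show ?case
      proof (cases "i = j")
        case False
        with 4 have z: "z \<in> ?U" "snd z = 1/2" by (auto split: if_splits)
        then have "1/2 \<le> fst z 0" by (auto simp: \<zeta>_def)
        then show ?thesis using hh cap by simp
      qed simp
    next
      case (5 z)
      then show ?case by (cases "snd z \<le> 1/2") (auto simp: u_def)
    qed (use cl in auto)
  qed
  ultimately obtain h where h: "continuous_map (top_of_set S) E h" "\<forall>z\<in>S. \<zeta> z = 0 \<longrightarrow> h z = u z"
    using lift[unfolded relative_lifting_def, rule_format, of S v \<zeta> u] v by blast
  have z0: "h (s, 0) = h1 (c s)" "h (s, 1) = h2 (c s)" if "s \<in> sph k" for s
    using that h(2) sph_coord_le[OF that, of 0] by (auto simp: S_def \<zeta>_def u_def abs_le_iff)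
  have zb: "h (sph_base, t) = x" if "t \<in> {0..1}" for t
    using that h(2) sph_base_in_sph hh cap[of "(sph_base, t)"] by (auto simp: S_def \<zeta>_def u_def sph_base_def)
  have "homotopic_with (\<lambda>u. u sph_base = x) (nsphere k) E (h1 \<circ> c) (h2 \<circ> c)"
  proof (subst homotopic_with, goal_cases)
    case (1 l l')
    have "l sph_base = l' sph_base" using 1 sph_base_in_sph by (simp add: nsphere_top_of_set)
    then show ?case by simp
  next
    case 2
    have "continuous_map (prod_topology (top_of_set {0..1}) (nsphere k)) (top_of_set S) (\<lambda>(t, s). (s, t))"
      by (auto simp: nsphere_top_of_set S_def continuous_map_in_subtopology case_prod_unfold
          intro!: continuous_on_fst continuous_on_snd continuous_on_Pair continuous_on_id continuous_on_const)
    from continuous_map_compose[OF this h(1)]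
    have "continuous_map (prod_topology (top_of_set {0..1}) (nsphere k)) E (\<lambda>(t, s). h (s, t))"
      by (simp add: o_def case_prod_unfold)
    then show ?case
      using z0 zb by (intro exI[of _ "\<lambda>(t, s). h (s, t)"]) (auto simp: nsphere_top_of_set)
  qed
  moreover have "homotopic_with (\<lambda>u. u sph_base = x) (nsphere k) E h1 (h1 \<circ> c)"
    "homotopic_with (\<lambda>u. u sph_base = x) (nsphere k) E h2 (h2 \<circ> c)"
    using homotopic_cap_collapse[of k E h1 x] homotopic_cap_collapse[of k E h2 x] hh by (simp_all add: c_def)
  ultimately show "homotopic_with (\<lambda>u. u sph_base = x) (nsphere k) E h1 h2"
    by (meson homotopic_with_symD homotopic_with_trans)
qed

section \<open>Realisations in coordinates\<close>

lemma quotient_map_quotient_topology: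
  assumes R: "equiv (topspace X) R"
  shows "quotient_map X (quotient_topology X R) (\<lambda>e. R `` {e})"
proof -
  \<comment> \<open>Distinct classes are disjoint, so uniting classes commutes with intersecting
    families of them; this makes the predicate in \<open>quotient_topology\<close> a
    topology.\<close>
  have disj: "\<Union>(S \<inter> S') = \<Union>S \<inter> \<Union>S'" if "S \<subseteq> topspace X // R" "S' \<subseteq> topspace X // R" for S S'
    using quotient_disj[OF R] that by blast
  let ?L = "\<lambda>U. U \<subseteq> topspace X // R \<and> openin X (\<Union>U)"
  have "?L (S \<inter> S')" if "?L S" "?L S'" for S S'
    using disj[of S S'] that by auto
  moreover have "?L (\<Union>K)" if "\<forall>S\<in>K. ?L S" for K
  proof -
    have "\<Union>(\<Union>K) = (\<Union>S\<in>K. \<Union>S)" by auto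
    then show ?thesis using that by auto
  qed
  ultimately have "istopology ?L" unfolding istopology_def by simp
  then have op: "openin (quotient_topology X R) U \<longleftrightarrow> U \<subseteq> topspace X // R \<and> openin X (\<Union>U)" for U
    by (simp add: quotient_topology_def)
  have un: "\<Union>(topspace X // R) = topspace X"
    using Union_quotient[OF R] .
  have top: "topspace (quotient_topology X R) = topspace X // R"
    using op un by (auto simp: topspace_def[of "quotient_topology X R"])
  have pre: "{e \<in> topspace X. R `` {e} \<in> U} = \<Union>U" if "U \<subseteq> topspace X // R" for U
  proof (rule equalityI; rule subsetI)
    fix e assume "e \<in> {e \<in> topspace X. R `` {e} \<in> U}"
    then show "e \<in> \<Union>U" using equiv_class_self[OF R, of e] by blast
  next
    fix e assume "e \<in> \<Union>U"
    then obtain Y where Y: "Y \<in> U" "e \<in> Y" by auto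
    then have "Y \<in> topspace X // R" using that by auto
    moreover from this Y have e: "e \<in> topspace X" using un by auto
    ultimately have "R `` {e} = Y" using Y(2) 
      by (metis R equiv_class_eq_iff quotientE Image_singleton_iff)
    then show "e \<in> {e \<in> topspace X. R `` {e} \<in> U}" using Y e by auto
  qed
  show ?thesis
    unfolding quotient_map_def top
    using pre op by (auto simp: quotient_def)
qed

lemma continuous_map_from_sum_topology:
  assumes "\<And>i. i \<in> I \<Longrightarrow> continuous_map (X i) Y (\<lambda>x. f (i, x))"
  shows "continuous_map (sum_topology X I) Y f"
  using assms unfolding continuous_map_def openin_sum_topology
  by (auto simp: Pi_iff) 

text \<open>One framework for |X_P| and for |P|: \<open>T\<close> is the space of pairs of
  \<open>x\<close> and \<open>p\<close> with \<open>R x p\<close>, up to a change of notation by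
  \<open>\<xi>\<close>, \<open>\<rho>\<close> and \<open>mk\<close>. For |P| the space
  \<open>X\<close> is a single point and \<open>R\<close> is always true.\<close>

locale topological_poset_over =
  fixes X :: "'x topology" and P :: "'p set" and le :: "'p \<Rightarrow> 'p \<Rightarrow> bool" and R :: "'x \<Rightarrow> 'p \<Rightarrow> bool"
    and T :: "'c topology" and lq :: "'c \<Rightarrow> 'c \<Rightarrow> bool" and \<xi> :: "'c \<Rightarrow> 'x" and \<rho> :: "'c \<Rightarrow> 'p"
    and mk :: "'x \<Rightarrow> 'p \<Rightarrow> 'c"
  assumes finite_P: "finite P"
    and le_refl: "p \<in> P \<Longrightarrow> le p p"
    and le_antisym: "\<lbrakk>p \<in> P; q \<in> P; le p q; le q p\<rbrakk> \<Longrightarrow> p = q"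
    and le_trans: "\<lbrakk>p \<in> P; q \<in> P; r \<in> P; le p q; le q r\<rbrakk> \<Longrightarrow> le p r"
    and Hausdorff_X: "Hausdorff_space X"
    and openin_R: "p \<in> P \<Longrightarrow> openin X {x \<in> topspace X. R x p}"
    and R_mono: "\<lbrakk>x \<in> topspace X; p \<in> P; q \<in> P; R x p; le p q\<rbrakk> \<Longrightarrow> R x q"
    and T_coords: "c \<in> topspace T \<Longrightarrow> \<xi> c \<in> topspace X \<and> \<rho> c \<in> P \<and> R (\<xi> c) (\<rho> c) \<and> mk (\<xi> c) (\<rho> c) = c"
    and mk_coords: "\<lbrakk>x \<in> topspace X; p \<in> P; R x p\<rbrakk> \<Longrightarrow> mk x p \<in> topspace T \<and> \<xi> (mk x p) = x \<and> \<rho> (mk x p) = p"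
    and cont_\<xi>: "continuous_map T X \<xi>"
    and cont_\<rho>: "continuous_map T (discrete_topology P) \<rho>"
    and cont_mk: "p \<in> P \<Longrightarrow> continuous_map (subtopology X {x. R x p}) T (\<lambda>x. mk x p)"
    and lq_iff: "\<lbrakk>c \<in> topspace T; d \<in> topspace T\<rbrakk> \<Longrightarrow> lq c d \<longleftrightarrow> \<xi> c = \<xi> d \<and> le (\<rho> c) (\<rho> d)"
begin

section \<open>Coordinates of the points of a simplex\<close>

definition pcoord :: "nat \<times> (nat \<Rightarrow> real) \<times> (nat \<Rightarrow> 'c) \<Rightarrow> 'x" where
  "pcoord e = \<xi> (snd (snd e) 0)"

text \<open>Indexing barycentric coordinates by elements of \<open>P\<close> instead of positions
  merges repeated vertices and forgets vertices of weight 0, just as the simplicial identifications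
  do.\<close>

definition wcoord :: "nat \<times> (nat \<Rightarrow> real) \<times> (nat \<Rightarrow> 'c) \<Rightarrow> 'p \<Rightarrow> real" where
  "wcoord e p = (\<Sum>i\<in>{i. i \<le> fst e \<and> \<rho> (snd (snd e) i) = p}. fst (snd e) i)"

abbreviation "\<Sigma>T \<equiv> simplex_sum T lq"

definition chain :: "'p set \<Rightarrow> bool" where
  "chain C \<longleftrightarrow> C \<subseteq> P \<and> C \<noteq> {} \<and> (\<forall>p\<in>C. \<forall>q\<in>C. le p q \<or> le q p)"

definition rank :: "'p set \<Rightarrow> 'p \<Rightarrow> nat" where
  "rank C p = card {q \<in> C. le q p \<and> q \<noteq> p}"

abbreviation enum :: "'p set \<Rightarrow> nat \<Rightarrow> 'p" where
  "enum C \<equiv> inv_into C (rank C)"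

text \<open>\<open>C\<close> may exceed the support of \<open>w\<close>; the surplus vertices then
  have weight 0. So one formula can serve on a set where some weights in \<open>C\<close>
  vanish.\<close>

definition simp_of :: "'p set \<Rightarrow> 'x \<Rightarrow> ('p \<Rightarrow> real) \<Rightarrow> nat \<times> (nat \<Rightarrow> real) \<times> (nat \<Rightarrow> 'c)" where
  "simp_of C x w = (card C - 1, \<lambda>i. if i < card C then w (enum C i) else 0,
      \<lambda>i\<in>{..card C - 1}. mk x (enum C i))"

definition valid :: "'x \<Rightarrow> ('p \<Rightarrow> real) \<Rightarrow> bool" where
  "valid x w \<longleftrightarrow> x \<in> topspace X \<and> (\<forall>p. 0 \<le> w p) \<and> (\<forall>p. p \<notin> P \<longrightarrow> w p = 0) \<and> (\<Sum>p\<in>P. w p) = 1 \<and>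
     (\<forall>p q. 0 < w p \<and> 0 < w q \<longrightarrow> le p q \<or> le q p) \<and> (\<forall>p. 0 < w p \<longrightarrow> R x p)"

lemma topspace_simplex_sum_iff:
  "(m, t, c) \<in> topspace \<Sigma>T \<longleftrightarrow>
     t \<in> standard_simplex m \<and> c \<in> {..m} \<rightarrow>\<^sub>E topspace T \<and> (\<forall>i<m. lq (c i) (c (Suc i)))"
  by (auto simp: simplex_sum_def simplex_top_def nerve_def)

lemma topspace_nerve_iff:
  "c \<in> topspace (nerve T lq m) \<longleftrightarrow> c \<in> {..m} \<rightarrow>\<^sub>E topspace T \<and> (\<forall>i<m. lq (c i) (c (Suc i)))"
  by (auto simp: nerve_def)

lemma nerve_mono:
  assumes c: "c \<in> topspace (nerve T lq m)" and "i \<le> j" "j \<le> m"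
  shows "\<xi> (c i) = \<xi> (c j) \<and> le (\<rho> (c i)) (\<rho> (c j))"
  using assms(2,3)
proof (induction j rule: dec_induct)
  case base
  then have "c i \<in> topspace T" using c by (auto simp: topspace_nerve_iff)
  then show ?case using T_coords le_refl by blast
next
  case (step k)
  then have T: "c i \<in> topspace T" "c k \<in> topspace T" "c (Suc k) \<in> topspace T" "lq (c k) (c (Suc k))"
    using c by (auto simp: topspace_nerve_iff)
  then have "\<xi> (c k) = \<xi> (c (Suc k))" "le (\<rho> (c k)) (\<rho> (c (Suc k)))" using lq_iff by blast+
  moreover have "\<xi> (c i) = \<xi> (c k)" "le (\<rho> (c i)) (\<rho> (c k))" using step by auto
  ultimately show ?case using T T_coords le_trans by metis
qed

lemma nerveI:
  assumes "c \<in> {..m} \<rightarrow>\<^sub>E topspace T" "\<And>i j. i \<le> j \<Longrightarrow> j \<le> m \<Longrightarrow> \<xi> (c i) = \<xi> (c j) \<and> le (\<rho> (c i)) (\<rho> (c j))"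
  shows "c \<in> topspace (nerve T lq m)"
  unfolding topspace_nerve_iff
proof (intro conjI allI impI)
  fix i assume "i < m"
  then have "c i \<in> topspace T" "c (Suc i) \<in> topspace T" using assms(1) by (auto simp: PiE_iff)
  then show "lq (c i) (c (Suc i))" using lq_iff assms(2)[of i "Suc i"] \<open>i < m\<close> by simp
qed (use assms(1) in auto)

lemma simp_push_standard_simplex:
  assumes "\<theta> \<in> {..k} \<rightarrow> {..m}" "t \<in> standard_simplex k"
  shows "simp_push k \<theta> t \<in> standard_simplex m"
proof -
  have nn: "0 \<le> t i" for i using assms(2) by (auto simp: standard_simplex_def)
  have g: "(\<Sum>j\<le>m. simp_push k \<theta> t j) = 1"
  proof -
    have "(\<Sum>j\<le>m. sum t {i. i \<in> {..k} \<and> \<theta> i = j}) = sum t {..k}"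
      using assms(1) by (intro sum.group) auto
    then show ?thesis using assms(2) by (simp add: simp_push_def standard_simplex_def)
  qed
  have z: "simp_push k \<theta> t j = 0" if "j > m" for j
  proof -
    have "{i. i \<le> k \<and> \<theta> i = j} = {}" using that assms(1) by (force simp: Pi_iff)
    then show ?thesis unfolding simp_push_def by (simp only: sum.empty)
  qed
  have n: "0 \<le> simp_push k \<theta> t j" for j using nn by (auto simp: simp_push_def intro: sum_nonneg)
  have "simp_push k \<theta> t j \<le> 1" for j
  proof (cases "j \<le> m")
    case True
    have "simp_push k \<theta> t j \<le> (\<Sum>j\<le>m. simp_push k \<theta> t j)"
      using n True by (intro member_le_sum) auto
    then show ?thesis using g by simp
  qed (simp add: z)
  then show ?thesis using n z g by (simp add: standard_simplex_def)
qed

text \<open>Pushing along \<open>\<theta>\<close> sums over the fibres of \<open>\<theta>\<close>;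
  summing further over the fibres of the labelling by \<open>P\<close> gives the weights of the
  original simplex.\<close>

lemma real_gen_coords:
  assumes "(e, e') \<in> real_gen T lq"
  shows "e \<in> topspace \<Sigma>T \<and> e' \<in> topspace \<Sigma>T \<and> pcoord e = pcoord e' \<and> wcoord e = wcoord e'"
proof -
  from assms obtain k m \<theta> t c where
    e: "e = (k, (t, restrict (c \<circ> \<theta>) {..k}))" "e' = (m, (simp_push k \<theta> t, c))"
    and \<theta>: "simp_op k m \<theta>" and t: "t \<in> standard_simplex k" and c: "c \<in> topspace (nerve T lq m)"
    by (auto simp: real_gen_def)
  have \<theta>m: "\<theta> i \<le> m" if "i \<le> k" for i using \<theta> that by (auto simp: simp_op_def Pi_iff)
  have "restrict (c \<circ> \<theta>) {..k} \<in> topspace (nerve T lq k)"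
  proof (rule nerveI)
    show "restrict (c \<circ> \<theta>) {..k} \<in> {..k} \<rightarrow>\<^sub>E topspace T"
      using \<theta>m c by (auto simp: topspace_nerve_iff)
    fix i j :: nat assume "i \<le> j" "j \<le> k"
    then show "\<xi> (restrict (c \<circ> \<theta>) {..k} i) = \<xi> (restrict (c \<circ> \<theta>) {..k} j) \<and>
         le (\<rho> (restrict (c \<circ> \<theta>) {..k} i)) (\<rho> (restrict (c \<circ> \<theta>) {..k} j))"
      using nerve_mono[OF c, of "\<theta> i" "\<theta> j"] \<theta> by (auto simp: simp_op_def)
  qed
  then have "e \<in> topspace \<Sigma>T" using t by (simp add: e topspace_simplex_sum_iff topspace_nerve_iff)
  moreover have "e' \<in> topspace \<Sigma>T"
    using c simp_push_standard_simplex[OF _ t] \<theta> by (simp add: e topspace_simplex_sum_iff topspace_nerve_iff simp_op_def)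
  moreover have "pcoord e = pcoord e'"
    using nerve_mono[OF c, of 0 "\<theta> 0"] \<theta>m[of 0] by (simp add: e pcoord_def)
  moreover have "wcoord e p = wcoord e' p" for p
  proof -
    let ?S = "{i. i \<le> k \<and> \<rho> (c (\<theta> i)) = p}" let ?T = "{j. j \<le> m \<and> \<rho> (c j) = p}"
    have "sum t ?S = (\<Sum>j\<in>?T. sum t {i \<in> ?S. \<theta> i = j})"
      using \<theta>m by (intro sum.group[symmetric]) auto
    also have "\<dots> = (\<Sum>j\<in>?T. simp_push k \<theta> t j)"
      unfolding simp_push_def by (intro sum.cong refl) auto
    finally show ?thesis by (simp add: e wcoord_def cong: conj_cong)
  qed
  ultimately show ?thesis by auto
qed

lemma real_rel_coords:
  assumes "(e, e') \<in> real_rel T lq"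
  shows "e \<in> topspace \<Sigma>T \<and> e' \<in> topspace \<Sigma>T \<and> pcoord e = pcoord e' \<and> wcoord e = wcoord e'"
proof -
  have "(e, e') \<in> (real_gen T lq \<union> (real_gen T lq)\<inverse>)\<^sup>+ \<Longrightarrow> ?thesis"
  proof (induction rule: trancl_induct)
    case (base y) then show ?case using real_gen_coords by fastforce
  next
    case (step y z)
    then have "y \<in> topspace \<Sigma>T \<and> z \<in> topspace \<Sigma>T \<and> pcoord y = pcoord z \<and> wcoord y = wcoord z"
      using real_gen_coords[of y z] real_gen_coords[of z y] by auto
    then show ?case using step by simp
  qed
  then show ?thesis using assms by (auto simp: real_rel_def Id_on_def)
qed

lemma equiv_real_rel: "equiv (topspace \<Sigma>T) (real_rel T lq)"
proof (rule equivI)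
  show "real_rel T lq \<subseteq> topspace \<Sigma>T \<times> topspace \<Sigma>T" using real_rel_coords by auto
  show "refl_on (topspace \<Sigma>T) (real_rel T lq)"
    by (auto simp: refl_on_def real_rel_def)
  show "sym (real_rel T lq)"
    unfolding real_rel_def by (intro sym_Un sym_Id_on sym_trancl sym_Un_converse)
  show "trans (real_rel T lq)"
    unfolding real_rel_def
    by (rule transI) (auto simp: Id_on_def dest: trancl_trans)
qed

section \<open>Chains and their increasing enumeration\<close>

lemma finite_chain: "chain C \<Longrightarrow> finite C"
  using finite_P finite_subset by (auto simp: chain_def)

lemma lower_mono:
  assumes "chain C" "p \<in> C" "q \<in> C" "le p q"
  shows "{r \<in> C. le r p \<and> r \<noteq> p} \<subseteq> {r \<in> C. le r q \<and> r \<noteq> q}"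
proof clarify
  fix r assume r: "r \<in> C" "le r p" "r \<noteq> p"
  have P: "p \<in> P" "q \<in> P" "r \<in> P" using assms r by (auto simp: chain_def)
  then show "le r q \<and> r \<noteq> q" using le_trans[of r p q] le_antisym[of p q] r assms(4) by auto
qed

lemma rank_mono:
  assumes "chain C" "p \<in> C" "q \<in> C" "le p q" shows "rank C p \<le> rank C q"
  unfolding rank_def
proof (rule card_mono[OF _ lower_mono])
qed (use assms finite_chain[OF assms(1)] in auto)

lemma rank_strict:
  assumes "chain C" "p \<in> C" "q \<in> C" "le p q" "p \<noteq> q" shows "rank C p < rank C q"
  unfolding rank_def
proof (rule psubset_card_mono)
  have "{r \<in> C. le r p \<and> r \<noteq> p} \<subseteq> {r \<in> C. le r q \<and> r \<noteq> q}"
    using lower_mono assms by simp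
  moreover have "p \<in> {r \<in> C. le r q \<and> r \<noteq> q}" using assms by auto
  ultimately show "{r \<in> C. le r p \<and> r \<noteq> p} \<subset> {r \<in> C. le r q \<and> r \<noteq> q}" by auto
qed (use finite_chain[OF assms(1)] in auto)

lemma bij_rank:
  assumes C: "chain C" shows "bij_betw (rank C) C {..<card C}"
proof -
  have "inj_on (rank C) C"
  proof (rule inj_onI)
    fix p q assume "p \<in> C" "q \<in> C" "rank C p = rank C q"
    then show "p = q" using rank_strict[OF C, of p q] rank_strict[OF C, of q p] C 
      by (auto simp: chain_def)
  qed
  moreover have "rank C ` C \<subseteq> {..<card C}"
  proof clarsimp
    fix p assume "p \<in> C"
    then show "rank C p < card C" unfolding rank_def
      using finite_chain[OF C] by (intro psubset_card_mono) auto
  qed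
  ultimately show ?thesis
    unfolding bij_betw_def by (metis card_image card_lessThan card_subset_eq finite_lessThan)
qed

lemma enum_in: "chain C \<Longrightarrow> i < card C \<Longrightarrow> enum C i \<in> C"
  using bij_rank by (metis bij_betw_imp_surj_on inv_into_into lessThan_iff)

lemma rank_enum: "chain C \<Longrightarrow> i < card C \<Longrightarrow> rank C (enum C i) = i"
  using bij_rank by (metis bij_betw_inv_into_right lessThan_iff)

lemma enum_rank: "chain C \<Longrightarrow> p \<in> C \<Longrightarrow> enum C (rank C p) = p"
  using bij_rank by (metis bij_betw_inv_into_left)

lemma rank_less: "chain C \<Longrightarrow> p \<in> C \<Longrightarrow> rank C p < card C"
  using bij_rank by (auto simp: bij_betw_def)

lemma card_chain_pos: "chain C \<Longrightarrow> 0 < card C"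
  using finite_chain by (auto simp: chain_def card_gt_0_iff)

lemma enum_mono:
  assumes "chain C" "i \<le> j" "j < card C" shows "le (enum C i) (enum C j)"
proof -
  have m: "enum C i \<in> C" "enum C j \<in> C" using assms enum_in by auto
  then consider "le (enum C i) (enum C j)" | "le (enum C j) (enum C i)" using assms(1) by (auto simp: chain_def)
  then show ?thesis
  proof cases
    case 2
    then have "j \<le> i" using rank_mono[OF assms(1) m(2,1)] rank_enum assms by simp
    then show ?thesis using assms 2 by simp
  qed
qed

lemma simp_of_eq:
  assumes C: "chain C" and x: "x \<in> topspace X" and R: "\<And>p. p \<in> C \<Longrightarrow> R x p"
    and w: "\<And>p. 0 \<le> w p" "\<And>p. p \<notin> C \<Longrightarrow> w p = 0" "sum w C = 1"
  shows "simp_of C x w \<in> topspace \<Sigma>T" "pcoord (simp_of C x w) = x" "wcoord (simp_of C x w) = w"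
proof -
  let ?m = "card C - 1" and ?c = "\<lambda>i\<in>{..card C - 1}. mk x (enum C i)"
  let ?t = "\<lambda>i. if i < card C then w (enum C i) else 0"
  have lt: "i \<le> ?m \<longleftrightarrow> i < card C" for i using card_chain_pos[OF C] by auto
  have CP: "C \<subseteq> P" using C by (simp add: chain_def)
  have mk: "mk x (enum C i) \<in> topspace T \<and> \<xi> (mk x (enum C i)) = x \<and> \<rho> (mk x (enum C i)) = enum C i" if "i < card C" for i
    using mk_coords x R enum_in[OF C that] CP by blast
  have c: "?c \<in> topspace (nerve T lq ?m)"
    by (rule nerveI) (use mk lt enum_mono[OF C] in auto)
  have "(\<Sum>i\<le>?m. ?t i) = (\<Sum>i<card C. w (enum C i))"
    using lt by (intro sum.cong) auto
  also have "\<dots> = sum w C"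
    using sum.reindex_bij_betw[OF bij_betw_inv_into[OF bij_rank[OF C]], of w] .
  finally have sum1: "(\<Sum>i\<le>?m. ?t i) = 1" using w by simp
  have "?t i \<le> 1" for i
  proof (cases "i \<le> ?m")
    case True
    have "?t i \<le> (\<Sum>i\<le>?m. ?t i)" using w(1) True by (intro member_le_sum) auto
    then show ?thesis using sum1 by simp
  qed (use lt in auto)
  then have "?t \<in> standard_simplex ?m" using sum1 w(1) lt
    unfolding standard_simplex_def by (intro CollectI conjI allI impI) auto
  then show "simp_of C x w \<in> topspace \<Sigma>T"
    using c unfolding simp_of_def topspace_simplex_sum_iff topspace_nerve_iff by blast
  show "pcoord (simp_of C x w) = x" using mk card_chain_pos[OF C] by (simp add: pcoord_def simp_of_def)
  show "wcoord (simp_of C x w) = w"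
  proof
    fix p
    show "wcoord (simp_of C x w) p = w p"
    proof (cases "p \<in> C")
      case True
      have "{i. i \<le> ?m \<and> \<rho> (?c i) = p} = {rank C p}"
        using True mk lt rank_less[OF C] rank_enum[OF C] enum_rank[OF C] by auto
      then have "wcoord (simp_of C x w) p = ?t (rank C p)"
        unfolding wcoord_def simp_of_def by simp
      then show ?thesis using True rank_less[OF C] enum_rank[OF C] by simp
    next
      case False
      have "{i. i \<le> ?m \<and> \<rho> (?c i) = p} = {}"
        using False mk lt enum_in[OF C] by auto
      then have "wcoord (simp_of C x w) p = 0"
        unfolding wcoord_def simp_of_def by simp
      then show ?thesis using False w by simp
    qed
  qed
qed

text \<open>The operator taking \<open>i\<close> to the rank of the \<open>i\<close>-th vertex may
  repeat and omit values; it combines degeneracies and faces, so that one generating pair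
  suffices.\<close>

lemma gen_simp_of:
  assumes e: "(m, t, c) \<in> topspace \<Sigma>T" and C: "chain C" "\<rho> ` c ` {..m} \<subseteq> C"
    and R: "\<And>p. p \<in> C \<Longrightarrow> R (pcoord (m, t, c)) p"
  shows "((m, t, c), simp_of C (pcoord (m, t, c)) (wcoord (m, t, c))) \<in> real_gen T lq"
proof -
  let ?x = "pcoord (m, t, c)" and ?w = "wcoord (m, t, c)"
  define \<theta> where "\<theta> i = rank C (\<rho> (c i))" for i
  define c' where "c' = (\<lambda>i\<in>{..card C - 1}. mk ?x (enum C i))"
  have cN: "c \<in> topspace (nerve T lq m)" and t: "t \<in> standard_simplex m"
    and cT: "\<And>i. i \<le> m \<Longrightarrow> c i \<in> topspace T" and cex: "c \<in> extensional {..m}"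
    using e by (auto simp: topspace_simplex_sum_iff topspace_nerve_iff PiE_iff)
  have in_C: "\<rho> (c i) \<in> C" if "i \<le> m" for i using C that by auto
  have x: "?x \<in> topspace X" using cT[of 0] T_coords by (simp add: pcoord_def)
  have CP: "C \<subseteq> P" using C by (simp add: chain_def)
  have lt: "\<theta> i \<le> card C - 1" if "i \<le> m" for i
    using rank_less[OF C(1) in_C[OF that]] by (simp add: \<theta>_def)
  have "simp_op m (card C - 1) \<theta>"
    unfolding simp_op_def
  proof (intro conjI allI impI)
    fix i j :: nat assume "i \<le> j \<and> j \<le> m"
    then show "\<theta> i \<le> \<theta> j"
      unfolding \<theta>_def using rank_mono[OF C(1)] in_C nerve_mono[OF cN, of i j] by auto
  qed (use lt in auto)
  moreover have c: "restrict (c' \<circ> \<theta>) {..m} = c"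
  proof (rule extensionalityI[OF _ cex])
    fix i assume "i \<in> {..m}"
    then have i: "i \<le> m" by simp
    have "\<xi> (c i) = ?x" using nerve_mono[OF cN, of 0 i] i by (simp add: pcoord_def)
    then have "mk ?x (\<rho> (c i)) = c i" using T_coords[OF cT[OF i]] by simp
    then show "restrict (c' \<circ> \<theta>) {..m} i = c i"
      using i lt[OF i] enum_rank[OF C(1) in_C[OF i]] by (simp add: c'_def \<theta>_def)
  qed auto
  moreover have "simp_push m \<theta> t = (\<lambda>i. if i < card C then ?w (enum C i) else 0)"
  proof
    fix j
    show "simp_push m \<theta> t j = (if j < card C then ?w (enum C j) else 0)"
    proof (cases "j < card C")
      case True
      have "{i. i \<le> m \<and> \<theta> i = j} = {i. i \<le> m \<and> \<rho> (c i) = enum C j}"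
        using True in_C enum_rank[OF C(1)] rank_enum[OF C(1)] by (auto simp: \<theta>_def)
      then show ?thesis using True by (simp add: simp_push_def wcoord_def)
    next
      case False
      have emp: "{i. i \<le> m \<and> \<theta> i = j} = {}"
        using False in_C rank_less[OF C(1)] by (auto simp: \<theta>_def)
      show ?thesis using False unfolding simp_push_def emp by simp
    qed
  qed
  moreover have "c' \<in> topspace (nerve T lq (card C - 1))"
  proof (rule nerveI)
    have lt: "i \<le> card C - 1 \<longleftrightarrow> i < card C" for i using card_chain_pos[OF C(1)] by auto
    have mk: "mk ?x (enum C i) \<in> topspace T \<and> \<xi> (mk ?x (enum C i)) = ?x \<and> \<rho> (mk ?x (enum C i)) = enum C i" if "i < card C" for i
      using mk_coords x R enum_in[OF C(1) that] CP by blast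
    show "c' \<in> {..card C - 1} \<rightarrow>\<^sub>E topspace T" using mk lt by (auto simp: c'_def)
    fix i j :: nat assume "i \<le> j" "j \<le> card C - 1"
    then show "\<xi> (c' i) = \<xi> (c' j) \<and> le (\<rho> (c' i)) (\<rho> (c' j))"
      using mk lt enum_mono[OF C(1)] by (auto simp: c'_def)
  qed
  ultimately show ?thesis using t unfolding real_gen_def simp_of_def c'_def[symmetric]
    by (intro CollectI exI[of _ m] exI[of _ "card C - 1"] exI[of _ \<theta>] exI[of _ t] exI[of _ c']) simp
qed

lemma valid_coords:
  assumes e: "e \<in> topspace \<Sigma>T" shows "valid (pcoord e) (wcoord e)"
proof -
  obtain m t c where e_eq: "e = (m, t, c)" by (cases e)
  have cN: "c \<in> topspace (nerve T lq m)" and t: "t \<in> standard_simplex m"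
    and cT: "\<And>i. i \<le> m \<Longrightarrow> c i \<in> topspace T"
    using e by (auto simp: e_eq topspace_simplex_sum_iff topspace_nerve_iff PiE_iff)
  have ex: "\<exists>i\<le>m. \<rho> (c i) = p" if "wcoord e p \<noteq> 0" for p
  proof (rule ccontr)
    assume "\<not> ?thesis"
    then have emp: "{i. i \<le> m \<and> \<rho> (c i) = p} = {}" by auto
    show False using that unfolding wcoord_def e_eq fst_conv snd_conv emp by simp
  qed
  have "sum t {..m} = (\<Sum>p\<in>P. sum t {i \<in> {..m}. \<rho> (c i) = p})"
    using finite_P cT T_coords by (intro sum.group[symmetric]) auto
  then have "(\<Sum>p\<in>P. wcoord e p) = 1"
    using t by (simp add: wcoord_def e_eq standard_simplex_def)
  moreover have "R (pcoord e) p" if "wcoord e p > 0" for p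
  proof -
    obtain i where "i \<le> m" "\<rho> (c i) = p" using ex[of p] \<open>wcoord e p > 0\<close> by auto
    then show ?thesis using nerve_mono[OF cN, of 0 i] T_coords[OF cT[of i]] by (auto simp: pcoord_def e_eq)
  qed
  moreover have "le p q \<or> le q p" if pq: "wcoord e p > 0" "wcoord e q > 0" for p q
  proof -
    obtain i j where "i \<le> m" "\<rho> (c i) = p" "j \<le> m" "\<rho> (c j) = q"
      using ex[of p] ex[of q] pq by fastforce
    then show ?thesis using nerve_mono[OF cN, of i j] nerve_mono[OF cN, of j i] nat_le_linear[of i j] by auto
  qed
  moreover have "0 \<le> wcoord e p" for p
    using t by (auto simp: wcoord_def e_eq standard_simplex_def intro: sum_nonneg)
  moreover have "wcoord e p = 0" if "p \<notin> P" for p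
    using ex[of p] that cT T_coords by blast
  moreover have "pcoord e \<in> topspace X" using cT[of 0] T_coords by (simp add: pcoord_def e_eq)
  ultimately show ?thesis by (simp add: valid_def)
qed

lemma valid_supp:
  assumes "valid x w"
  defines "C \<equiv> {p. 0 < w p}"
  shows "chain C" "x \<in> topspace X" "\<And>p. p \<in> C \<Longrightarrow> R x p" "\<And>p. p \<notin> C \<Longrightarrow> w p = 0" "\<And>p. 0 \<le> w p" "sum w C = 1"
proof -
  note v = assms(1)[unfolded valid_def]
  show "\<And>p. p \<notin> C \<Longrightarrow> w p = 0" using v by (auto simp: C_def) (metis antisym_conv2)
  have CP: "C \<subseteq> P" using v unfolding C_def by (metis less_irrefl mem_Collect_eq subsetI)
  have "sum w C = sum w P" using v
    by (intro sum.mono_neutral_left finite_P CP) (auto simp: C_def order.order_iff_strict)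
  then show s: "sum w C = 1" using v by simp
  then have "C \<noteq> {}" by auto
  then show "chain C" using v CP by (auto simp: chain_def C_def)
  show "x \<in> topspace X" "\<And>p. p \<in> C \<Longrightarrow> R x p" "\<And>p. 0 \<le> w p" using v by (auto simp: C_def)
qed

text \<open>\<open>e\<close> may have repeated vertices and vertices of weight 0. Both
  \<open>e\<close> and the simplex on its support are linked by a generating pair to the simplex on
  all vertices of \<open>e\<close>. So each class has a representative that is computed from the
  coordinates.\<close>

lemma real_rel_supp:
  assumes e: "e \<in> topspace \<Sigma>T"
  shows "(e, simp_of {p. 0 < wcoord e p} (pcoord e) (wcoord e)) \<in> real_rel T lq"
proof -
  obtain m t c where e_eq: "e = (m, t, c)" by (cases e)
  have cN: "c \<in> topspace (nerve T lq m)" and cT: "\<And>i. i \<le> m \<Longrightarrow> c i \<in> topspace T"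
    using e by (auto simp: e_eq topspace_simplex_sum_iff topspace_nerve_iff PiE_iff)
  let ?x = "pcoord e" and ?w = "wcoord e"
  note v = valid_supp[OF valid_coords[OF e]]
  let ?S = "{p. 0 < ?w p}" and ?C = "\<rho> ` c ` {..m}"
  have C: "chain ?C"
    unfolding chain_def
  proof (intro conjI ballI)
    show "?C \<subseteq> P" using cT T_coords by auto
    fix p q assume "p \<in> ?C" "q \<in> ?C"
    then obtain i j where "i \<le> m" "\<rho> (c i) = p" "j \<le> m" "\<rho> (c j) = q" by auto
    then show "le p q \<or> le q p" using nerve_mono[OF cN, of i j] nerve_mono[OF cN, of j i] nat_le_linear[of i j] by auto
  qed auto
  have RC: "R ?x p" if p: "p \<in> ?C" for p
  proof -
    obtain i where "i \<le> m" "\<rho> (c i) = p" using p by auto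
    then show ?thesis using nerve_mono[OF cN, of 0 i] T_coords[OF cT[of i]] by (auto simp: pcoord_def e_eq)
  qed
  have SC: "?S \<subseteq> ?C"
  proof (rule subsetI, rule ccontr)
    fix p assume p: "p \<in> ?S" "p \<notin> ?C"
    then have emp: "{i. i \<le> m \<and> \<rho> (c i) = p} = {}" by auto
    have "?w p = 0" unfolding wcoord_def e_eq fst_conv snd_conv emp by simp
    then show False using p by simp
  qed
  let ?e1 = "simp_of ?C ?x ?w" and ?e2 = "simp_of ?S ?x ?w"
  have g1: "(e, ?e1) \<in> real_gen T lq"
    using gen_simp_of[OF e[unfolded e_eq] C] RC unfolding e_eq by auto
  note s = simp_of_eq[OF v(1-3,5,4,6), simplified]
  obtain m2 t2 c2 where e2: "?e2 = (m2, t2, c2)" by (cases ?e2)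
  have "\<rho> ` c2 ` {..m2} \<subseteq> ?S"
  proof
    fix p assume "p \<in> \<rho> ` c2 ` {..m2}"
    then obtain i where im: "i \<le> m2" and p: "p = \<rho> (c2 i)" by auto
    have "m2 = fst ?e2" and c2: "c2 = snd (snd ?e2)" using e2 by simp_all
    then have m2: "m2 = card ?S - 1" by (simp add: simp_of_def)
    then have i: "i < card ?S" using im card_chain_pos[OF v(1)] by linarith
    have "c2 i = mk ?x (enum ?S i)" using im m2 unfolding c2 simp_of_def by simp
    moreover have en: "enum ?S i \<in> ?S" using enum_in[OF v(1) i] .
    ultimately have "\<rho> (c2 i) = enum ?S i"
      using mk_coords[of ?x "enum ?S i"] v(1-3) by (auto simp: chain_def)
    then show "p \<in> ?S" using en p by simp
  qed
  then have g2: "(?e2, ?e1) \<in> real_gen T lq"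
    using gen_simp_of[of m2 t2 c2 ?C] C SC RC s e2 by (metis (no_types, lifting) subset_trans)
  from g1 g2 show ?thesis unfolding real_rel_def
    by (meson Un_iff converseI r_into_trancl trancl_into_trancl)
qed

lemma real_rel_iff:
  "(e, e') \<in> real_rel T lq \<longleftrightarrow>
     e \<in> topspace \<Sigma>T \<and> e' \<in> topspace \<Sigma>T \<and> pcoord e = pcoord e' \<and> wcoord e = wcoord e'"
proof
  assume "e \<in> topspace \<Sigma>T \<and> e' \<in> topspace \<Sigma>T \<and> pcoord e = pcoord e' \<and> wcoord e = wcoord e'"
  then show "(e, e') \<in> real_rel T lq"
    using real_rel_supp[of e] real_rel_supp[of e'] equiv_real_rel by (auto simp: equiv_def elim: symE transE)
qed (use real_rel_coords in blast)

section \<open>Points of the realisation\<close>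

definition pt :: "'x \<Rightarrow> ('p \<Rightarrow> real) \<Rightarrow> (nat \<times> (nat \<Rightarrow> real) \<times> (nat \<Rightarrow> 'c)) set" where
  "pt x w = {e \<in> topspace \<Sigma>T. pcoord e = x \<and> wcoord e = w}"

text \<open>The coordinates are constant on classes, so the choice is harmless. It is the choice
  made in \<open>XP_mu\<close>, which therefore equals this function everywhere.\<close>

definition px :: "(nat \<times> (nat \<Rightarrow> real) \<times> (nat \<Rightarrow> 'c)) set \<Rightarrow> 'x" where
  "px U = pcoord (SOME e. e \<in> U)"

definition wx :: "(nat \<times> (nat \<Rightarrow> real) \<times> (nat \<Rightarrow> 'c)) set \<Rightarrow> 'p \<Rightarrow> real" where
  "wx U = wcoord (SOME e. e \<in> U)"

abbreviation "E \<equiv> realization T lq"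

lemma real_class_eq_pt:
  assumes "e \<in> topspace \<Sigma>T" shows "real_class T lq e = pt (pcoord e) (wcoord e)"
  using assms by (auto simp: real_class_def pt_def real_rel_iff)

lemma px_pt: assumes "e \<in> topspace \<Sigma>T" shows "px (pt (pcoord e) (wcoord e)) = pcoord e" "wx (pt (pcoord e) (wcoord e)) = wcoord e"
proof -
  have "e \<in> pt (pcoord e) (wcoord e)" using assms by (simp add: pt_def)
  then have "(SOME e'. e' \<in> pt (pcoord e) (wcoord e)) \<in> pt (pcoord e) (wcoord e)" by (rule someI)
  then show "px (pt (pcoord e) (wcoord e)) = pcoord e" "wx (pt (pcoord e) (wcoord e)) = wcoord e"
    by (auto simp: px_def wx_def pt_def)
qed

lemma quotient_map_real_class: "quotient_map \<Sigma>T E (real_class T lq)"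
  using quotient_map_quotient_topology[OF equiv_real_rel]
  by (simp add: realization_def real_class_def[abs_def])

lemma valid_imp_ex:
  assumes "valid x w" shows "\<exists>e\<in>topspace \<Sigma>T. pcoord e = x \<and> wcoord e = w"
  using simp_of_eq[OF valid_supp(1-3,5,4,6)[OF assms], simplified] by blast

lemma topspace_E: "U \<in> topspace E \<longleftrightarrow> (\<exists>x w. valid x w \<and> U = pt x w)"
proof -
  have "topspace E = real_class T lq ` topspace \<Sigma>T"
    using quotient_imp_surjective_map[OF quotient_map_real_class] by simp
  moreover have "U \<in> real_class T lq ` topspace \<Sigma>T \<Longrightarrow> \<exists>x w. valid x w \<and> U = pt x w"
    using real_class_eq_pt valid_coords by blast
  moreover have "valid x w \<Longrightarrow> pt x w \<in> real_class T lq ` topspace \<Sigma>T" for x w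
    using real_class_eq_pt valid_imp_ex by (metis image_eqI)
  ultimately show ?thesis by auto
qed

lemma pt_coords:
  assumes "valid x w" shows "pt x w \<in> topspace E" "px (pt x w) = x" "wx (pt x w) = w"
  using assms topspace_E valid_imp_ex[OF assms] px_pt by auto

lemma E_coords:
  assumes "U \<in> topspace E" shows "valid (px U) (wx U)" "pt (px U) (wx U) = U"
  using assms topspace_E pt_coords by auto

lemma px_real_class: "e \<in> topspace \<Sigma>T \<Longrightarrow> px (real_class T lq e) = pcoord e"
  and wx_real_class: "e \<in> topspace \<Sigma>T \<Longrightarrow> wx (real_class T lq e) = wcoord e"
  by (simp_all add: real_class_eq_pt px_pt)

section \<open>Continuous maps into a realisation\<close>

lemma continuous_map_slice_vertex:
  assumes "i \<le> m"
  shows "continuous_map (prod_topology (simplex_top m) (nerve T lq m)) T (\<lambda>z. snd z i)"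
proof -
  have "continuous_map (nerve T lq m) T (\<lambda>c. c i)"
    unfolding nerve_def using assms
    by (intro continuous_map_from_subtopology continuous_map_product_projection) auto
  from continuous_map_compose[OF continuous_map_snd this] show ?thesis by (simp add: o_def)
qed

lemma continuous_map_slice_weight:
  "continuous_map (prod_topology (simplex_top m) (nerve T lq m)) euclideanreal (\<lambda>z. fst z i)"
proof -
  have "continuous_map (simplex_top m) euclideanreal (\<lambda>t. t i)"
    unfolding simplex_top_def
    by (intro continuous_map_from_subtopology continuous_map_product_projection) auto
  from continuous_map_compose[OF continuous_map_fst this] show ?thesis by (simp add: o_def)
qed

lemma continuous_map_pcoord: "continuous_map \<Sigma>T X pcoord"
  unfolding simplex_sum_def
proof (rule continuous_map_from_sum_topology)
  fix m :: nat
  show "continuous_map (prod_topology (simplex_top m) (nerve T lq m)) X (\<lambda>z. pcoord (m, z))"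
    using continuous_map_compose[OF continuous_map_slice_vertex cont_\<xi>, of 0 m]
    by (simp add: o_def pcoord_def)
qed

lemma continuous_map_vertex_indicator:
  assumes "i \<le> m"
  shows "continuous_map (prod_topology (simplex_top m) (nerve T lq m)) euclideanreal
           (\<lambda>z. if \<rho> (snd z i) = p then 1 else 0)"
proof -
  have "continuous_map (discrete_topology P) euclideanreal (\<lambda>q. if q = p then 1 else 0)"
    by simp
  from continuous_map_compose[OF continuous_map_compose[OF continuous_map_slice_vertex[OF assms] cont_\<rho>] this]
  show ?thesis by (simp add: o_def)
qed

lemma continuous_map_wcoord: "continuous_map \<Sigma>T euclideanreal (\<lambda>e. wcoord e p)"
  unfolding simplex_sum_def
proof (rule continuous_map_from_sum_topology)
  fix m :: nat
  have eq: "wcoord (m, z) p = (\<Sum>i\<le>m. (if \<rho> (snd z i) = p then 1 else 0) * fst z i)" for z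
  proof -
    have "(\<Sum>i\<in>{i. i \<le> m \<and> \<rho> (snd z i) = p}. fst z i) = (\<Sum>i\<le>m. if \<rho> (snd z i) = p then fst z i else 0)"
      by (subst sum.inter_filter[symmetric]) simp_all
    also have "\<dots> = (\<Sum>i\<le>m. (if \<rho> (snd z i) = p then 1 else 0) * fst z i)"
      by (intro sum.cong) auto
    finally show ?thesis by (simp add: wcoord_def)
  qed
  show "continuous_map (prod_topology (simplex_top m) (nerve T lq m)) euclideanreal (\<lambda>z. wcoord (m, z) p)"
    unfolding eq
    by (intro continuous_map_sum continuous_map_real_mult continuous_map_vertex_indicator continuous_map_slice_weight) auto
qed

lemma continuous_map_px: "continuous_map E X px"
proof (rule continuous_compose_quotient_map[OF quotient_map_real_class])
  show "continuous_map \<Sigma>T X (px \<circ> real_class T lq)"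
    by (rule continuous_map_eq[OF continuous_map_pcoord]) (simp add: px_real_class)
qed

lemma continuous_map_wx: "continuous_map E euclideanreal (\<lambda>U. wx U p)"
proof (rule continuous_compose_quotient_map[OF quotient_map_real_class])
  show "continuous_map \<Sigma>T euclideanreal ((\<lambda>U. wx U p) \<circ> real_class T lq)"
    by (rule continuous_map_eq[OF continuous_map_wcoord]) (simp add: wx_real_class)
qed

lemma openin_avoid_vertex: "openin \<Sigma>T {e \<in> topspace \<Sigma>T. \<forall>i\<le>fst e. \<rho> (snd (snd e) i) \<noteq> p}"
proof -
  have "openin (prod_topology (simplex_top m) (nerve T lq m))
      {z. (m, z) \<in> topspace \<Sigma>T \<and> (\<forall>i\<le>m. \<rho> (snd z i) \<noteq> p)}" for m
  proof -
    let ?Y = "prod_topology (simplex_top m) (nerve T lq m)"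
    have "openin ?Y {z \<in> topspace ?Y. (if \<rho> (snd z i) = p then 1 else 0) \<in> - {1::real}}" if "i \<le> m" for i
      by (rule openin_continuous_map_preimage[OF continuous_map_vertex_indicator[OF that]]) auto
    then have "openin ?Y (\<Inter>i\<in>{..m}. {z \<in> topspace ?Y. (if \<rho> (snd z i) = p then 1 else 0) \<in> - {1::real}})"
      by (intro openin_INT2) auto
    moreover have "(\<Inter>i\<in>{..m}. {z \<in> topspace ?Y. (if \<rho> (snd z i) = p then 1 else 0) \<in> - {1::real}}) = 
       {z. (m, z) \<in> topspace \<Sigma>T \<and> (\<forall>i\<le>m. \<rho> (snd z i) \<noteq> p)}"
      by (auto simp: simplex_sum_def split: if_splits)
    ultimately show ?thesis by simp
  qed
  then show ?thesis
    unfolding simplex_sum_def openin_sum_topology by (auto simp: o_def)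
qed

text \<open>The reason why convergence of the coordinates is not enough: a sequence can leave the region of a
  vertex \<open>p\<close> only if the weight of \<open>p\<close> vanishes before the limit, however fast it tends to 0.\<close>

lemma closedin_sequence:
  assumes p: "p \<in> P" and xs: "limitin X xs x' sequentially" and R: "\<not> R x' p" and a: "\<And>j. 0 < a j"
  shows "closedin E {U \<in> topspace E. \<exists>j. px U = xs j \<and> wx U p = a j}"
proof -
  let ?D = "{e \<in> topspace \<Sigma>T. \<exists>j. pcoord e = xs j \<and> wcoord e p = a j}"
  have x': "x' \<in> topspace X" using xs by (rule limitin_topspace)
  \<comment> \<open>A simplex without vertex \<open>p\<close> has a neighbourhood of such simplices,
    whose weight 0 at \<open>p\<close> is none of the \<open>a j\<close>. A simplex with vertex
    \<open>p\<close> lies over a point other than \<open>x'\<close>; separating the two points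
    leaves finitely many \<open>j\<close> to exclude, each by removing a closed set.\<close>
  have "openin \<Sigma>T (topspace \<Sigma>T - ?D)"
  proof (subst openin_subopen, intro ballI)
    fix e assume e: "e \<in> topspace \<Sigma>T - ?D"
    show "\<exists>N. openin \<Sigma>T N \<and> e \<in> N \<and> N \<subseteq> topspace \<Sigma>T - ?D"
    proof (cases "\<forall>i\<le>fst e. \<rho> (snd (snd e) i) \<noteq> p")
      case True
      have "wcoord d p = 0" if "\<forall>i\<le>fst d. \<rho> (snd (snd d) i) \<noteq> p" for d
      proof -
        have emp: "{i. i \<le> fst d \<and> \<rho> (snd (snd d) i) = p} = {}" using that by auto
        show ?thesis unfolding wcoord_def emp by simp
      qed
      then show ?thesis
        using True e a openin_avoid_vertex[of p]
        by (intro exI[of _ "{e \<in> topspace \<Sigma>T. \<forall>i\<le>fst e. \<rho> (snd (snd e) i) \<noteq> p}"]) (auto simp: less_le)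
    next
      case False
      obtain m t c where e_eq: "e = (m, t, c)" by (cases e)
      have cN: "c \<in> topspace (nerve T lq m)" and cT: "\<And>i. i \<le> m \<Longrightarrow> c i \<in> topspace T"
        using e by (auto simp: e_eq topspace_simplex_sum_iff topspace_nerve_iff PiE_iff)
      obtain i where i: "i \<le> m" "\<rho> (c i) = p" using False by (auto simp: e_eq)
      then have "R (pcoord e) p"
        using nerve_mono[OF cN, of 0 i] T_coords[OF cT[of i]] by (auto simp: pcoord_def e_eq)
      then have ne: "pcoord e \<noteq> x'" using R by auto
      have xe: "pcoord e \<in> topspace X" using cT[of 0] T_coords by (simp add: pcoord_def e_eq)
      obtain G G' where G: "openin X G" "openin X G'" "pcoord e \<in> G" "x' \<in> G'" "disjnt G G'"
        using Hausdorff_X xe x' ne unfolding Hausdorff_space_def by metis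
      obtain J where J: "\<And>j. j \<ge> J \<Longrightarrow> xs j \<in> G'"
        using xs G(2,4) by (auto simp: limitin_def eventually_sequentially)
      define K where "K j = {d \<in> topspace \<Sigma>T. pcoord d = xs j \<and> wcoord d p = a j}" for j
      have "closedin \<Sigma>T (K j)" for j
      proof (cases "xs j \<in> topspace X")
        case True
        then have "closedin X {xs j}" using Hausdorff_X by (simp add: closedin_Hausdorff_sing_eq)
        from closedin_Int[OF closedin_continuous_map_preimage[OF continuous_map_pcoord this]
            closedin_continuous_map_preimage[OF continuous_map_wcoord, of "{a j}" p]]
        show ?thesis by (auto simp: K_def Int_def conj_ac cong: conj_cong)
      next
        case False
        have "K j = {}" using False continuous_map_image_subset_topspace[OF continuous_map_pcoord] by (auto simp: K_def)
        then show ?thesis by simp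
      qed
      then have "closedin \<Sigma>T (\<Union>j<J. K j)" by (intro closedin_Union) auto
      then have op: "openin \<Sigma>T ({d \<in> topspace \<Sigma>T. pcoord d \<in> G} - (\<Union>j<J. K j))"
        using openin_continuous_map_preimage[OF continuous_map_pcoord G(1)] by (rule openin_diff[rotated])
      show ?thesis
      proof (intro exI conjI)
        show "openin \<Sigma>T ({d \<in> topspace \<Sigma>T. pcoord d \<in> G} - (\<Union>j<J. K j))" by (fact op)
        show "e \<in> {d \<in> topspace \<Sigma>T. pcoord d \<in> G} - (\<Union>j<J. K j)" using e G by (auto simp: K_def)
        show "{d \<in> topspace \<Sigma>T. pcoord d \<in> G} - (\<Union>j<J. K j) \<subseteq> topspace \<Sigma>T - ?D"
        proof
          fix d assume d: "d \<in> {d \<in> topspace \<Sigma>T. pcoord d \<in> G} - (\<Union>j<J. K j)"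
          have "\<not> (pcoord d = xs j \<and> wcoord d p = a j)" for j
          proof (cases "j < J")
            case True then show ?thesis using d by (auto simp: K_def)
          next
            case False then show ?thesis using J[of j] d G(5) by (auto simp: disjnt_iff)
          qed
          then show "d \<in> topspace \<Sigma>T - ?D" using d by auto
        qed
      qed
    qed
  qed
  then have "closedin \<Sigma>T ?D" by (simp add: closedin_def)
  moreover have "{e \<in> topspace \<Sigma>T. real_class T lq e \<in> {U \<in> topspace E. \<exists>j. px U = xs j \<and> wx U p = a j}} = ?D"
    using quotient_imp_surjective_map[OF quotient_map_real_class] px_real_class wx_real_class by auto
  ultimately show ?thesis
    using quotient_map_real_class[unfolded quotient_map_closedin, THEN conjunct2, rule_format,
        of "{U \<in> topspace E. \<exists>j. px U = xs j \<and> wx U p = a j}"] by auto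
qed

section \<open>Maps from metric spaces in coordinates\<close>

definition supports :: "'k::metric_space set \<Rightarrow> ('k \<Rightarrow> 'x) \<Rightarrow> ('k \<Rightarrow> 'p \<Rightarrow> real) \<Rightarrow> bool" where
  "supports S x w \<longleftrightarrow> (\<forall>p\<in>P. \<forall>k\<in>S. k \<in> closure {k'\<in>S. 0 < w k' p} \<longrightarrow> R (x k) p)"

definition good :: "'k::metric_space set \<Rightarrow> ('k \<Rightarrow> 'x) \<Rightarrow> ('k \<Rightarrow> 'p \<Rightarrow> real) \<Rightarrow> bool" where
  "good S x w \<longleftrightarrow> (\<forall>k\<in>S. valid (x k) (w k)) \<and> continuous_map (top_of_set S) X x \<and>
     (\<forall>p\<in>P. continuous_on S (\<lambda>k. w k p)) \<and> supports S x w"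

text \<open>A violation at \<open>k\<close> gives a sequence tending to \<open>k\<close> along which
  \<open>p\<close> has positive weight. By \<open>closedin_sequence\<close> the points that share
  base point and weight at \<open>p\<close> with some member form a closed set. So
  \<open>u k\<close> belongs to it, has positive weight at \<open>p\<close>, and lies over the
  region of \<open>p\<close> after all.\<close>

lemma good_of_continuous_map:
  fixes u :: "'k::metric_space \<Rightarrow> _"
  assumes u: "continuous_map (top_of_set S) E u"
  shows "good S (\<lambda>k. px (u k)) (\<lambda>k. wx (u k))"
proof -
  have uE: "u k \<in> topspace E" if "k \<in> S" for k
    using u that by (auto simp: continuous_map_def)
  have x: "continuous_map (top_of_set S) X (\<lambda>k. px (u k))"
    using continuous_map_compose[OF u continuous_map_px] by (simp add: o_def)
  have w: "continuous_on S (\<lambda>k. wx (u k) p)" for p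
    using continuous_map_compose[OF u continuous_map_wx[of p]] by (simp add: o_def)
  have "R (px (u k)) p" if p: "p \<in> P" and k: "k \<in> S" and cl: "k \<in> closure {k'\<in>S. 0 < wx (u k') p}" for p k
  proof (rule ccontr)
    assume nR: "\<not> R (px (u k)) p"
    obtain ks where ks: "\<And>n. ks n \<in> S" "\<And>n::nat. 0 < wx (u (ks n)) p" and lim: "ks \<longlonglongrightarrow> k"
      using cl unfolding closure_sequential by auto
    have "limitin (top_of_set S) ks k sequentially"
      using ks lim k by (simp add: limitin_subtopology)
    from continuous_map_limit[OF x this]
    have "limitin X (\<lambda>n. px (u (ks n))) (px (u k)) sequentially" by (simp add: o_def)
    from closedin_sequence[OF p this nR ks(2)]
    have "closedin E {U \<in> topspace E. \<exists>j. px U = px (u (ks j)) \<and> wx U p = wx (u (ks j)) p}" .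
    from closedin_continuous_map_preimage[OF u this]
    have "closedin (top_of_set S) {s \<in> S. \<exists>j. px (u s) = px (u (ks j)) \<and> wx (u s) p = wx (u (ks j)) p}"
      using uE by (auto cong: conj_cong)
    then obtain C where C: "closed C" "{s \<in> S. \<exists>j. px (u s) = px (u (ks j)) \<and> wx (u s) p = wx (u (ks j)) p} = S \<inter> C"
      by (auto simp: closedin_closed)
    have "ks n \<in> C" for n using C(2) ks(1)[of n] by blast
    then have "k \<in> C" using C(1) lim closed_sequentially by blast
    then obtain j where "px (u k) = px (u (ks j))" "wx (u k) p = wx (u (ks j)) p" using C(2) k by blast
    then have "0 < wx (u k) p" using ks(2) by simp
    then have "R (px (u k)) p" using E_coords(1)[OF uE[OF k]] by (auto simp: valid_def)
    then show False using nR by simp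
  qed
  then show ?thesis
    using x w E_coords uE by (auto simp: good_def supports_def)
qed

lemma continuous_map_simp_of:
  fixes x :: "'k::metric_space \<Rightarrow> 'x"
  assumes C: "chain C" and x: "continuous_map (top_of_set Z) X x"
    and R: "\<And>k p. k \<in> Z \<Longrightarrow> p \<in> C \<Longrightarrow> R (x k) p"
    and w: "\<And>p. p \<in> C \<Longrightarrow> continuous_on Z (\<lambda>k. w k p)"
    and top: "\<And>k. k \<in> Z \<Longrightarrow> simp_of C (x k) (w k) \<in> topspace \<Sigma>T"
  shows "continuous_map (top_of_set Z) \<Sigma>T (\<lambda>k. simp_of C (x k) (w k))"
proof -
  let ?m = "card C - 1"
  let ?t = "\<lambda>k i. if i < card C then w k (enum C i) else 0"
  let ?c = "\<lambda>k. \<lambda>i\<in>{..?m}. mk (x k) (enum C i)"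
  have lt: "i \<le> ?m \<longleftrightarrow> i < card C" for i using card_chain_pos[OF C] by auto
  have st: "?t k \<in> standard_simplex ?m" "?c k \<in> topspace (nerve T lq ?m)" if "k \<in> Z" for k
    using top[OF that] unfolding simp_of_def topspace_simplex_sum_iff topspace_nerve_iff by auto
  have "continuous_map (top_of_set Z) euclideanreal (\<lambda>k. ?t k i)" for i
    using w enum_in[OF C] by (cases "i < card C") auto
  then have "continuous_map (top_of_set Z) (powertop_real UNIV) ?t"
    by (simp only: continuous_map_componentwise_UNIV) simp
  then have 1: "continuous_map (top_of_set Z) (simplex_top ?m) ?t"
    unfolding simplex_top_def continuous_map_in_subtopology using st by auto
  have mk: "continuous_map (top_of_set Z) T (\<lambda>k. mk (x k) (enum C i))" if "i \<le> ?m" for i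
  proof -
    have en: "enum C i \<in> C" "enum C i \<in> P" using that lt enum_in[OF C] C by (auto simp: chain_def)
    have "continuous_map (top_of_set Z) (subtopology X {y. R y (enum C i)}) x"
      unfolding continuous_map_in_subtopology using x R en by auto
    from continuous_map_compose[OF this cont_mk[OF en(2)]] show ?thesis by (simp add: o_def)
  qed
  have "continuous_map (top_of_set Z) (product_topology (\<lambda>_. T) {..?m}) ?c"
    unfolding continuous_map_componentwise using mk by auto
  then have 2: "continuous_map (top_of_set Z) (nerve T lq ?m) ?c"
    unfolding nerve_def continuous_map_in_subtopology using st by (auto simp: nerve_def)
  have "continuous_map (top_of_set Z) (prod_topology (simplex_top ?m) (nerve T lq ?m)) (\<lambda>k. (?t k, ?c k))"
    using 1 2 by (rule continuous_map_paired[THEN iffD2, OF conjI])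
  from continuous_map_compose[OF this continuous_map_component_injection[of ?m UNIV "\<lambda>m. prod_topology (simplex_top m) (nerve T lq m)"]]
  show ?thesis by (simp add: simp_of_def simplex_sum_def o_def)
qed

text \<open>The closures of the sets of constant support \<open>C\<close> form a finite closed
  cover. On the closure belonging to \<open>C\<close> the weights still vanish off \<open>C\<close>,
  and the support condition says that all of \<open>C\<close> may be used as vertices, even where
  weights in \<open>C\<close> vanish. So the simplex on \<open>C\<close> varies continuously there,
  and the pieces agree in the quotient.\<close>

lemma continuous_map_of_good:
  fixes x :: "'k::metric_space \<Rightarrow> 'x"
  assumes g: "good S x w"
  shows "continuous_map (top_of_set S) E (\<lambda>k. pt (x k) (w k))"
proof -
  define Z where "Z C = S \<inter> closure {k\<in>S. {p. 0 < w k p} = C}" for C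
  have v: "valid (x k) (w k)" if "k \<in> S" for k using g that by (simp add: good_def)
  have wc: "continuous_on S (\<lambda>k. w k p)" if "p \<in> P" for p using g that by (simp add: good_def)
  have Z0: "w k p = 0" if k: "k \<in> Z C" and p: "p \<notin> C" for k p C
  proof (cases "p \<in> P")
    case True
    have "closedin (top_of_set S) {k \<in> S. w k p \<in> {..0}}"
      using continuous_closedin_preimage[OF wc[OF True], of "{..0}"] by (simp add: vimage_def Int_def)
    then obtain D where D: "closed D" "{k \<in> S. w k p \<in> {..0}} = S \<inter> D" by (auto simp: closedin_closed)
    have "{k\<in>S. {p. 0 < w k p} = C} \<subseteq> D"
    proof
      fix k' assume "k' \<in> {k\<in>S. {p. 0 < w k p} = C}"
      then have "k' \<in> S" "\<not> 0 < w k' p" using p by auto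
      then have "k' \<in> {k \<in> S. w k p \<in> {..0}}" by auto
      then show "k' \<in> D" using D by blast
    qed
    then have "k \<in> D" using k D(1) closure_minimal by (auto simp: Z_def)
    moreover have "k \<in> S" using k by (simp add: Z_def)
    ultimately have "w k p \<le> 0" using D by blast
    then show ?thesis using v[OF \<open>k \<in> S\<close>] by (simp add: valid_def order_antisym)
  next
    case False then show ?thesis using v k by (auto simp: valid_def Z_def)
  qed
  have ZR: "R (x k) p" if k: "k \<in> Z C" and p: "p \<in> C" and C: "C \<subseteq> P" for k p C
  proof -
    have "closure {k\<in>S. {p. 0 < w k p} = C} \<subseteq> closure {k\<in>S. 0 < w k p}"
      using p by (intro closure_mono) auto
    then have "k \<in> closure {k\<in>S. 0 < w k p}" "k \<in> S" using k unfolding Z_def by (auto simp only: Int_iff)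
    then show ?thesis using g p C unfolding good_def supports_def by blast
  qed
  have chZ: "chain C" if k: "k \<in> Z C" for k C
  proof -
    have "{k\<in>S. {p. 0 < w k p} = C} \<noteq> {}"
    proof
      assume emp: "{k\<in>S. {p. 0 < w k p} = C} = {}"
      show False using k unfolding Z_def emp by simp
    qed
    then obtain k' where "k' \<in> S" "{p. 0 < w k' p} = C" by auto
    then show ?thesis using valid_supp(1)[OF v] by auto
  qed
  have sumZ: "sum (w k) C = 1" if k: "k \<in> Z C" for k C
  proof -
    have "C \<subseteq> P" using chZ[OF k] by (simp add: chain_def)
    then have "sum (w k) C = sum (w k) P"
      using Z0[OF k] finite_P by (intro sum.mono_neutral_left) auto
    then show ?thesis using v k by (auto simp: valid_def Z_def)
  qed
  have ZS: "Z C \<subseteq> S" for C by (auto simp: Z_def)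
  have top: "simp_of C (x k) (w k) \<in> topspace \<Sigma>T" "real_class T lq (simp_of C (x k) (w k)) = pt (x k) (w k)" 
    if k: "k \<in> Z C" for k C
  proof -
    have "k \<in> S" using k ZS by auto
    note vk = v[OF this, unfolded valid_def]
    have CP: "C \<subseteq> P" using chZ[OF k] by (simp add: chain_def)
    have a: "x k \<in> topspace X" "\<And>p. 0 \<le> w k p" using vk by auto
    note s = simp_of_eq[OF chZ[OF k] a(1) ZR[OF k _ CP] a(2) Z0[OF k] sumZ[OF k]]
    show "simp_of C (x k) (w k) \<in> topspace \<Sigma>T" by (rule s(1)) 
    then show "real_class T lq (simp_of C (x k) (w k)) = pt (x k) (w k)"
      by (simp add: real_class_eq_pt s)
  qed
  show ?thesis
  proof (rule pasting_lemma_closed[where I = "Pow P" and T = Z and f = "\<lambda>C k. real_class T lq (simp_of C (x k) (w k))"], goal_cases)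
    case 1 show ?case using finite_P by simp
  next
    case (2 C) show ?case by (auto simp: Z_def intro: closedin_closed_Int)
  next
    case (3 C)
    have "continuous_map (top_of_set (Z C)) \<Sigma>T (\<lambda>k. simp_of C (x k) (w k))"
    proof (cases "Z C = {}")
      case False
      then have C: "chain C" using chZ by auto
      then have CP: "C \<subseteq> P" by (simp add: chain_def)
      show ?thesis
      proof (rule continuous_map_simp_of[OF C])
        show "continuous_map (top_of_set (Z C)) X x"
          using g ZS[of C] continuous_map_from_subtopology_mono[of euclidean S X x] unfolding good_def by blast
        show "continuous_on (Z C) (\<lambda>k. w k p)" if "p \<in> C" for p
          using continuous_on_subset[OF wc ZS] CP that by auto
      qed (use ZR CP top in auto)
    qed simp
    from continuous_map_compose[OF this quotient_imp_continuous_map[OF quotient_map_real_class]]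
    have "continuous_map (top_of_set (Z C)) E (\<lambda>k. real_class T lq (simp_of C (x k) (w k)))" by (simp add: o_def)
    moreover have "S \<inter> Z C = Z C" using ZS by auto
    ultimately show ?case by (simp add: subtopology_subtopology)
  next
    case (4 C D k)
    then show ?case using top by auto
  next
    case (5 k)
    then have k: "k \<in> S" by simp
    have "k \<in> Z {p. 0 < w k p}" unfolding Z_def using k closure_subset by fastforce
    moreover have "{p. 0 < w k p} \<in> Pow P" using valid_supp(1)[OF v[OF k]] by (simp add: chain_def)
    ultimately show ?case using top by metis
  qed
qed

section \<open>Lifting along the projection to the space\<close>

text \<open>Only finitely many closures are involved, so one neighbourhood avoids all those that
  miss \<open>k\<close>.\<close>

lemma eventually_supports:
  assumes sup: "supports U x w" and fin: "k \<in> U"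
  shows "\<forall>\<^sub>F k' in nhds k. k' \<in> U \<longrightarrow> (\<forall>p\<in>P. 0 < w k' p \<longrightarrow> R (x k) p)"
proof -
  have "\<forall>\<^sub>F k' in nhds k. k' \<in> U \<longrightarrow> 0 < w k' p \<longrightarrow> R (x k) p" if p: "p \<in> P" for p
  proof (cases "R (x k) p")
    case False
    then have "k \<in> - closure {k'\<in>U. 0 < w k' p}"
      using sup p fin by (auto simp: supports_def)
    then have "\<forall>\<^sub>F k' in nhds k. k' \<in> - closure {k'\<in>U. 0 < w k' p}"
      by (intro eventually_nhds_in_open) auto
    moreover have "{k'\<in>U. 0 < w k' p} \<subseteq> closure {k'\<in>U. 0 < w k' p}" by (rule closure_subset)
    ultimately show ?thesis by (auto elim!: eventually_mono)
  qed simp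
  then have "\<forall>\<^sub>F k' in nhds k. \<forall>p\<in>P. k' \<in> U \<longrightarrow> 0 < w k' p \<longrightarrow> R (x k) p"
    using finite_P by (intro eventually_ball_finite) auto
  then show ?thesis by eventually_elim auto
qed

lemma eventually_nhds_openin:
  assumes "openin (top_of_set S) A" "k \<in> A"
  shows "\<forall>\<^sub>F k' in nhds k. k' \<in> S \<longrightarrow> k' \<in> A"
proof -
  obtain O' where O': "open O'" "A = S \<inter> O'" using assms(1) by (auto simp: openin_open)
  then have "\<forall>\<^sub>F k' in nhds k. k' \<in> O'" using assms(2) by (intro eventually_nhds_in_open) auto
  then show ?thesis by eventually_elim (use O' in auto)
qed

text \<open>Among the balls through a given point, the largest one contains the centres of all the others;
  hence the values of \<open>\<psi>\<close> at these centres form a chain.\<close>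

lemma relative_lifting_px:
  assumes psi: "\<And>x. x \<in> topspace X \<Longrightarrow> \<psi> x \<in> P"
    and R_psi: "\<And>x p. x \<in> topspace X \<Longrightarrow> p \<in> P \<Longrightarrow> R x p \<longleftrightarrow> le (\<psi> x) p"
  shows "relative_lifting E X px"
  unfolding relative_lifting_def
proof (intro allI impI, elim conjE)
  fix S :: "((nat \<Rightarrow> real) \<times> real) set" and v \<zeta> u
  assume S: "compact S" and v: "continuous_map (top_of_set S) X v" and \<zeta>: "continuous_on S \<zeta>" "\<zeta> ` S \<subseteq> {0..1::real}"
    and u: "continuous_map (top_of_set {k\<in>S. \<zeta> k < 1}) E u" and uv: "\<forall>k\<in>S. \<zeta> k < 1 \<longrightarrow> px (u k) = v k"
  define U where "U = {k\<in>S. \<zeta> k < 1}"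
  define w0 where "w0 k = wx (u k)" for k
  have good_U: "good U (\<lambda>k. px (u k)) w0"
    using good_of_continuous_map[OF u] by (simp add: U_def w0_def[abs_def])
  have vX: "v k \<in> topspace X" if "k \<in> S" for k using v that by (auto simp: continuous_map_def)
  have pv: "\<psi> (v k) \<in> P" if "k \<in> S" for k using psi vX that by blast
  have pxv: "px (u k) = v k" if "k \<in> U" for k using uv that by (simp add: U_def)
  have valid0: "valid (v k) (w0 k)" if "k \<in> U" for k
    using good_U that pxv unfolding good_def by metis
  have supU: "R (v k) p" if "k \<in> U" "p \<in> P" "k \<in> closure {k'\<in>U. 0 < w0 k' p}" for k p
  proof -
    have "supports U (\<lambda>k. px (u k)) w0" using good_U unfolding good_def by blast
    then have "R (px (u k)) p" using that unfolding supports_def by blast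
    then show ?thesis using pxv[OF that(1)] by simp
  qed
  have opU: "openin (top_of_set S) U"
    using continuous_openin_preimage_gen[OF \<zeta>(1), of "{..<1}"] by (simp add: U_def vimage_def Int_def)
  \<comment> \<open>The radius at \<open>b\<close> is so small that \<open>\<psi> (v b)\<close> may
    be a vertex throughout the ball and lies below all vertices of the partial lift there. A ball
    centred outside \<open>U\<close> has to avoid \<open>\<zeta> \<le> 1/2\<close>, where the
    partial lift is still in use.\<close>
  have "\<exists>r>0. \<forall>k\<in>S. dist k b < r \<longrightarrow> R (v k) (\<psi> (v b)) \<and>
      (if b \<in> U then k \<in> U \<and> (\<forall>p\<in>P. 0 < w0 k p \<longrightarrow> le (\<psi> (v b)) p) else 1/2 < \<zeta> k)" if b: "b \<in> S" for b
  proof -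
    have "openin (top_of_set S) {k \<in> S. v k \<in> {x \<in> topspace X. R x (\<psi> (v b))}}"
      using openin_continuous_map_preimage[OF v openin_R[OF pv[OF b]]] by simp
    moreover have "b \<in> {k \<in> S. v k \<in> {x \<in> topspace X. R x (\<psi> (v b))}}"
      using b vX R_psi pv le_refl by auto
    ultimately have 1: "\<forall>\<^sub>F k in nhds b. k \<in> S \<longrightarrow> R (v k) (\<psi> (v b))"
      by (rule eventually_mono[OF eventually_nhds_openin]) auto
    have 2: "\<forall>\<^sub>F k in nhds b. k \<in> S \<longrightarrow> 
       (if b \<in> U then k \<in> U \<and> (\<forall>p\<in>P. 0 < w0 k p \<longrightarrow> le (\<psi> (v b)) p) else 1/2 < \<zeta> k)"
    proof (cases "b \<in> U")
      case True
      have "supports U (\<lambda>k. px (u k)) w0" using good_U by (simp add: good_def)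
      from eventually_conj[OF eventually_supports[OF this True] eventually_nhds_openin[OF opU True]]
      show ?thesis
        by eventually_elim (use True uv R_psi[OF vX[OF b]] in \<open>auto simp: U_def\<close>)
    next
      case False
      have "openin (top_of_set S) {k \<in> S. 1/2 < \<zeta> k}"
        using continuous_openin_preimage_gen[OF \<zeta>(1), of "{1/2<..}"] by (simp add: vimage_def Int_def)
      from eventually_nhds_openin[OF this, of b] show ?thesis
        using False b by (auto simp: U_def)
    qed
    from eventually_conj[OF 1 2] show ?thesis
      unfolding eventually_nhds_metric by (auto simp: imp_conjR) 
  qed
  then have "\<forall>b\<in>S. \<exists>r>0. \<forall>k\<in>S. dist k b < r \<longrightarrow> R (v k) (\<psi> (v b)) \<and>
      (if b \<in> U then k \<in> U \<and> (\<forall>p\<in>P. 0 < w0 k p \<longrightarrow> le (\<psi> (v b)) p) else 1/2 < \<zeta> k)" by blast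
  from bchoice[OF this] obtain r where "\<forall>b\<in>S. 0 < r b \<and> (\<forall>k\<in>S. dist k b < r b \<longrightarrow> R (v k) (\<psi> (v b)) \<and>
      (if b \<in> U then k \<in> U \<and> (\<forall>p\<in>P. 0 < w0 k p \<longrightarrow> le (\<psi> (v b)) p) else 1/2 < \<zeta> k))" by blast
  then have r: "\<And>b. b \<in> S \<Longrightarrow> 0 < r b"
    and rR: "\<And>b k. b \<in> S \<Longrightarrow> k \<in> S \<Longrightarrow> dist k b < r b \<Longrightarrow> R (v k) (\<psi> (v b))"
    and rU: "\<And>b k. b \<in> S \<Longrightarrow> k \<in> S \<Longrightarrow> dist k b < r b \<Longrightarrow>
       (if b \<in> U then k \<in> U \<and> (\<forall>p\<in>P. 0 < w0 k p \<longrightarrow> le (\<psi> (v b)) p) else 1/2 < \<zeta> k)"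
    by blast+
  \<comment> \<open>Halving the radii ensures that when two balls meet, the centre of the one with
    the smaller radius is within the full radius of the other.\<close>
  have "S \<subseteq> (\<Union>b\<in>S. ball b (r b / 2))" using r by (force intro: centre_in_ball[THEN iffD2])
  then obtain B where B: "B \<subseteq> S" "finite B" "S \<subseteq> (\<Union>b\<in>B. ball b (r b / 2))"
    using compactE_image[OF S, of S "\<lambda>b. ball b (r b / 2)"] by auto
  define bump where "bump b k = max 0 (r b / 2 - dist k b)" for b k :: "(nat \<Rightarrow> real) \<times> real"
  define L where "L k = (\<Sum>b\<in>B. bump b k)" for k
  define wl where "wl k p = (\<Sum>b\<in>{b\<in>B. \<psi> (v b) = p}. bump b k) / L k" for k p
  \<comment> \<open>The partial lift is faded out on the closed set
    \<open>\<zeta> \<le> 1/2\<close>, well inside its domain \<open>\<zeta> < 1\<close>, so that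
    limits of points where it is used stay in the domain.\<close>
  define w where "w k p = (if \<zeta> k \<le> 1/2 then (1 - 2 * \<zeta> k) * w0 k p + 2 * \<zeta> k * wl k p else wl k p)" for k p
  have bump0: "0 \<le> bump b k" for b k by (simp add: bump_def)
  have L: "0 < L k" if kS: "k \<in> S" for k
  proof -
    obtain b where "b \<in> B" "k \<in> ball b (r b / 2)" using subsetD[OF B(3) kS] by blast
    then show ?thesis unfolding L_def using B(2) bump0
      by (intro sum_pos2[of B b]) (auto simp: bump_def dist_commute)
  qed
  have wl0: "0 \<le> wl k p" if "k \<in> S" for k p
    unfolding wl_def using bump0 L[OF that] by (intro divide_nonneg_pos sum_nonneg) auto
  have wl_supp: "\<exists>b\<in>B. \<psi> (v b) = p \<and> dist k b < r b / 2" if "0 < wl k p" for k p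
  proof (rule ccontr)
    assume "\<not> ?thesis"
    then have "(\<Sum>b\<in>{b\<in>B. \<psi> (v b) = p}. bump b k) = 0"
      by (intro sum.neutral) (auto simp: bump_def)
    then show False using that by (simp add: wl_def)
  qed
  have wlP: "wl k p = 0" if "p \<notin> P" for k p
  proof -
    have emp: "{b\<in>B. \<psi> (v b) = p} = {}" using pv B(1) that by auto
    show ?thesis unfolding wl_def emp by simp
  qed
  have wl_sum: "(\<Sum>p\<in>P. wl k p) = 1" if "k \<in> S" for k
  proof -
    have "(\<Sum>p\<in>P. \<Sum>b\<in>{b\<in>B. \<psi> (v b) = p}. bump b k) = L k"
      unfolding L_def using B pv finite_P by (intro sum.group) auto
    then show ?thesis using L[OF that] by (simp add: wl_def sum_divide_distrib[symmetric])
  qed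
  have rr: "r b / 2 < r b" if "b \<in> B" for b using r[of b] that B(1) by auto
  have wl_chain: "le p q \<or> le q p" if k: "k \<in> S" and p: "0 < wl k p" and q: "0 < wl k q" for k p q
  proof -
    obtain b b' where b: "b \<in> B" "\<psi> (v b) = p" "dist k b < r b / 2"
      and b': "b' \<in> B" "\<psi> (v b') = q" "dist k b' < r b' / 2" using wl_supp[OF p] wl_supp[OF q] by blast
    have S: "b \<in> S" "b' \<in> S" using b b' B by auto
    have "dist b b' < r b / 2 + r b' / 2"
      using b(3) b'(3) dist_triangle[of b b' k] by (simp add: dist_commute)
    then consider "dist b b' < r b'" | "dist b' b < r b" by (cases "r b \<le> r b'") (auto simp: dist_commute)
    then show ?thesis
    proof cases
      case 1
      then have "R (v b) q" using rR[OF S(2,1)] b' by auto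
      then show ?thesis using R_psi[OF vX[OF S(1)]] pv[OF S(2)] b b' by auto
    next
      case 2
      then have "R (v b') p" using rR[OF S(1,2)] b by auto
      then show ?thesis using R_psi[OF vX[OF S(2)]] pv[OF S(1)] b b' by auto
    qed
  qed
  have wl_R: "R (v k) p" if k: "k \<in> S" and cl: "k \<in> closure {k'\<in>S. 0 < wl k' p}" for k p
  proof -
    have "{k'\<in>S. 0 < wl k' p} \<subseteq> (\<Union>b\<in>{b\<in>B. \<psi> (v b) = p}. cball b (r b / 2))"
      using wl_supp by (fastforce simp: dist_commute)
    moreover have "closed (\<Union>b\<in>{b\<in>B. \<psi> (v b) = p}. cball b (r b / 2))"
      using B(2) by (intro closed_UN) auto
    ultimately have "k \<in> (\<Union>b\<in>{b\<in>B. \<psi> (v b) = p}. cball b (r b / 2))"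
      using cl closure_minimal by blast
    then obtain b where b: "b \<in> B" "\<psi> (v b) = p" "dist k b \<le> r b / 2" by (auto simp: dist_commute)
    then show ?thesis using rR[of b k] rr[OF b(1)] k B(1) by auto
  qed
  have w_supp: "0 < wl k p \<or> (\<zeta> k < 1/2 \<and> 0 < w0 k p)" if k: "k \<in> S" and pos: "0 < w k p" for k p
  proof (rule ccontr)
    assume neg: "\<not> ?thesis"
    then have "wl k p = 0" using wl0[OF k, of p] by auto
    then have *: "\<zeta> k \<le> 1/2 \<and> 0 < (1 - 2 * \<zeta> k) * w0 k p" using pos by (auto simp: w_def split: if_splits)
    then have "1 - 2 * \<zeta> k \<noteq> 0" by auto
    then have "\<zeta> k < 1/2" using * by auto
    then show False using * neg by (auto simp: zero_less_mult_iff)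
  qed
  have mixed: "le p q" if k: "k \<in> S" "\<zeta> k < 1/2" and p: "0 < wl k p" and q: "0 < w0 k q" for k p q
  proof -
    obtain b where b: "b \<in> B" "\<psi> (v b) = p" "dist k b < r b / 2" using wl_supp[OF p] by blast
    have bS: "b \<in> S" and d: "dist k b < r b" using b B rr[OF b(1)] by auto
    \<comment> \<open>A ball centred outside \<open>U\<close> would force
      \<open>1/2 < \<zeta> k\<close>.\<close>
    have "b \<in> U" using rU[OF bS k(1) d] k(2) by (auto split: if_splits)
    moreover have "q \<in> P" using valid0[of k] q k by (force simp: valid_def U_def)
    ultimately show ?thesis using rU[OF bS k(1) d] q b by auto
  qed
  have w0_sum: "(\<Sum>p\<in>P. w0 k p) = 1" "\<And>p. 0 \<le> w0 k p" "\<And>p. p \<notin> P \<Longrightarrow> w0 k p = 0" if "k \<in> S" "\<zeta> k \<le> 1/2" for k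
    using valid0[of k] that by (auto simp: valid_def U_def)
  have sup: "supports S v w"
    unfolding supports_def
  proof (intro ballI impI)
    fix p k assume p: "p \<in> P" and k: "k \<in> S" and cl: "k \<in> closure {k'\<in>S. 0 < w k' p}"
    have "{k'\<in>S. 0 < w k' p} \<subseteq> {k'\<in>S. 0 < wl k' p} \<union> {k'\<in>S. \<zeta> k' < 1/2 \<and> 0 < w0 k' p}" 
      using w_supp by blast
    then have "k \<in> closure ({k'\<in>S. 0 < wl k' p} \<union> {k'\<in>S. \<zeta> k' < 1/2 \<and> 0 < w0 k' p})"
      using cl closure_mono by blast
    then consider "k \<in> closure {k'\<in>S. 0 < wl k' p}" | "k \<in> closure {k'\<in>S. \<zeta> k' < 1/2 \<and> 0 < w0 k' p}"
      unfolding closure_Un by blast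
    then show "R (v k) p"
    proof cases
      case 1 then show ?thesis using wl_R k by blast
    next
      case 2
      have "closedin (top_of_set S) (S \<inter> \<zeta> -` {..1/2})" by (rule continuous_closedin_preimage[OF \<zeta>(1)]) auto
      then obtain D where D: "closed D" "S \<inter> \<zeta> -` {..1/2} = S \<inter> D" by (auto simp: closedin_closed)
      then have "{k'\<in>S. \<zeta> k' < 1/2 \<and> 0 < w0 k' p} \<subseteq> D" by auto
      then have "k \<in> D" using 2 D(1) closure_minimal by blast
      then have "k \<in> S \<inter> \<zeta> -` {..1/2}" unfolding D(2) using k by blast
      then have "k \<in> U" by (auto simp: U_def)
      moreover have "{k'\<in>S. \<zeta> k' < 1/2 \<and> 0 < w0 k' p} \<subseteq> {k'\<in>U. 0 < w0 k' p}" by (auto simp: U_def)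
      then have "k \<in> closure {k'\<in>U. 0 < w0 k' p}" using 2 closure_mono by blast
      ultimately show ?thesis using supU p by blast
    qed
  qed
  have val: "valid (v k) (w k)" if k: "k \<in> S" for k
    unfolding valid_def
  proof (intro conjI allI impI)
    show "v k \<in> topspace X" using vX k by blast
    have z: "0 \<le> \<zeta> k" using \<zeta>(2) k by auto
    show "0 \<le> w k p" for p using wl0[OF k] w0_sum[OF k] z by (auto simp: w_def)
    show "w k p = 0" if "p \<notin> P" for p using wlP[OF that] w0_sum[OF k] that by (auto simp: w_def)
    show "(\<Sum>p\<in>P. w k p) = 1"
      using wl_sum[OF k] w0_sum(1)[OF k]
      by (cases "\<zeta> k \<le> 1/2") (simp_all add: w_def sum.distrib sum_distrib_left[symmetric])
    show "le p q \<or> le q p" if "0 < w k p \<and> 0 < w k q" for p q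
    proof -
      have p: "0 < wl k p \<or> (\<zeta> k < 1/2 \<and> 0 < w0 k p)" and q: "0 < wl k q \<or> (\<zeta> k < 1/2 \<and> 0 < w0 k q)"
        using w_supp[OF k] that by auto
      have "\<zeta> k < 1/2 \<Longrightarrow> 0 < w0 k p \<Longrightarrow> 0 < w0 k q \<Longrightarrow> le p q \<or> le q p"
        using valid0[of k] k by (auto simp: valid_def U_def)
      then show ?thesis using p q mixed[OF k] wl_chain[OF k] by blast
    qed
    show "R (v k) p" if pos: "0 < w k p" for p
    proof -
      have "p \<in> P"
      proof (rule ccontr)
        assume "p \<notin> P"
        then have "w k p = 0" using wlP w0_sum(3)[OF k] by (simp add: w_def)
        then show False using pos by simp
      qed
      moreover have "k \<in> closure {k'\<in>S. 0 < w k' p}"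
        using closure_subset[of "{k'\<in>S. 0 < w k' p}"] k pos by blast
      ultimately show ?thesis using sup k unfolding supports_def by blast
    qed
  qed
  have contL: "continuous_on S (\<lambda>k. bump b k)" for b
    unfolding bump_def by (intro continuous_on_max continuous_on_const continuous_on_diff continuous_on_dist continuous_on_id)
  have "continuous_on S L"
    unfolding L_def by (intro continuous_on_sum contL)
  moreover have "\<forall>k\<in>S. L k \<noteq> 0" using L by fastforce
  ultimately have contwl: "continuous_on S (\<lambda>k. wl k p)" for p
    unfolding wl_def by (intro continuous_on_divide continuous_on_sum contL)
  have contw: "continuous_on S (\<lambda>k. w k p)" if p: "p \<in> P" for p
    unfolding w_def
  proof (rule continuous_on_cases_le[OF _ _ \<zeta>(1)])
    have sub: "{t \<in> S. \<zeta> t \<le> 1/2} \<subseteq> U" "{t \<in> S. \<zeta> t \<le> 1/2} \<subseteq> S" by (auto simp: U_def)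
    have "continuous_on U (\<lambda>k. w0 k p)" using good_U p by (simp add: good_def)
    then show "continuous_on {t \<in> S. \<zeta> t \<le> 1/2} (\<lambda>k. (1 - 2 * \<zeta> k) * w0 k p + 2 * \<zeta> k * wl k p)"
      using sub by (intro continuous_on_add continuous_on_mult continuous_on_diff continuous_on_const
         continuous_on_subset[OF \<zeta>(1)] continuous_on_subset[OF contwl]) (auto intro: continuous_on_subset)
    show "continuous_on {t \<in> S. 1/2 \<le> \<zeta> t} (\<lambda>k. wl k p)"
      by (rule continuous_on_subset[OF contwl]) auto
    show "(1 - 2 * \<zeta> k) * w0 k p + 2 * \<zeta> k * wl k p = wl k p" if "\<zeta> k = 1/2" for k
    proof -
      have z: "2 * \<zeta> k = 1" using that by simp
      show ?thesis unfolding z by simp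
    qed
  qed
  have g: "good S v w" using val v contw sup by (simp add: good_def)
  show "\<exists>h H. continuous_map (top_of_set S) E h \<and> (\<forall>k\<in>S. \<zeta> k = 0 \<longrightarrow> h k = u k) \<and>
        continuous_map (top_of_set ({0..1::real} \<times> S)) X H \<and>
        (\<forall>k\<in>S. H (0, k) = px (h k) \<and> H (1, k) = v k) \<and>
        (\<forall>k\<in>S. \<forall>t\<in>{0..1}. \<zeta> k = 0 \<longrightarrow> H (t, k) = v k)"
  proof (intro exI conjI ballI impI)
    show "continuous_map (top_of_set S) E (\<lambda>k. pt (v k) (w k))" by (rule continuous_map_of_good[OF g])
    show "pt (v k) (w k) = u k" if "k \<in> S" "\<zeta> k = 0" for k
    proof -
      have "w k = wx (u k)" using that by (auto simp: w_def w0_def fun_eq_iff)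
      moreover have "v k = px (u k)" using uv that by auto
      moreover have "u k \<in> topspace E" using u that by (auto simp: continuous_map_def)
      ultimately show ?thesis using E_coords(2) by simp
    qed
    \<comment> \<open>The lift lies over \<open>v\<close> itself, so the homotopy is
      constant.\<close>
    have "continuous_map (top_of_set ({0..1::real} \<times> S)) (top_of_set S) snd"
      by (auto simp: continuous_map_in_subtopology intro!: continuous_on_snd continuous_on_id)
    from continuous_map_compose[OF this v]
    show "continuous_map (top_of_set ({0..1::real} \<times> S)) X (v \<circ> snd)" .
  qed (use pt_coords[OF val] in auto)
qed

end

section \<open>Lifting along the projection to the poset\<close>

context topological_poset_over
begin

section \<open>Weights on chains and their truncation\<close>

definition weights :: "('p \<Rightarrow> real) \<Rightarrow> bool" where
  "weights w \<longleftrightarrow> (\<forall>p. 0 \<le> w p) \<and> (\<forall>p. p \<notin> P \<longrightarrow> w p = 0) \<and> (\<Sum>p\<in>P. w p) = 1 \<and>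
     (\<forall>p q. 0 < w p \<and> 0 < w q \<longrightarrow> le p q \<or> le q p)"

lemma valid_iff_weights: "valid x w \<longleftrightarrow> x \<in> topspace X \<and> weights w \<and> (\<forall>p. 0 < w p \<longrightarrow> R x p)"
  by (auto simp: valid_def weights_def)

definition below :: "('p \<Rightarrow> real) \<Rightarrow> 'p \<Rightarrow> real" where
  "below w q = sum w {r\<in>P. le r q \<and> r \<noteq> q}"

text \<open>In the picture of a distribution, \<open>p\<close> owns the interval of length
  \<open>w p\<close> that starts at \<open>below w p\<close>; this is the length of the part of it
  beyond \<open>\<tau>\<close>.\<close>

definition cut :: "real \<Rightarrow> ('p \<Rightarrow> real) \<Rightarrow> 'p \<Rightarrow> real" where
  "cut \<tau> w p = min (w p) (max 0 (below w p + w p - \<tau>))"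

text \<open>Read a weight on a chain as a distribution on \<open>[0,1]\<close>; \<open>truncate \<tau>\<close> removes its lowest part, of
  mass \<open>\<tau>\<close>, and rescales.\<close>

definition truncate :: "real \<Rightarrow> ('p \<Rightarrow> real) \<Rightarrow> 'p \<Rightarrow> real" where
  "truncate \<tau> w p = cut \<tau> w p / (\<Sum>q\<in>P. cut \<tau> w q)"

lemma weights_supp:
  assumes "weights w"
  shows "chain {p. 0 < w p}" "sum w {p. 0 < w p} = 1"
proof -
  note v = assms[unfolded weights_def]
  have CP: "{p. 0 < w p} \<subseteq> P" using v by (metis less_irrefl mem_Collect_eq subsetI)
  have "sum w {p. 0 < w p} = sum w P" using v
    by (intro sum.mono_neutral_left finite_P CP) (auto simp: order.order_iff_strict)
  then show s: "sum w {p. 0 < w p} = 1" using v by simp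
  then have "{p. 0 < w p} \<noteq> {}" by (metis sum.empty zero_neq_one)
  then show "chain {p. 0 < w p}" using v CP by (auto simp: chain_def)
qed

lemma weights_least:
  assumes w: "weights w" obtains q where "q \<in> P" "0 < w q" "below w q = 0"
proof -
  let ?C = "{p. 0 < w p}"
  note C = weights_supp(1)[OF w]
  let ?q = "enum ?C 0"
  have q: "?q \<in> ?C" "rank ?C ?q = 0" using enum_in[OF C] rank_enum[OF C] card_chain_pos[OF C] by auto
  have "w r = 0" if "r \<in> P" "le r ?q" "r \<noteq> ?q" for r
    using rank_strict[OF C, of r ?q] that q w unfolding weights_def by (metis mem_Collect_eq not_less0 order_le_less)
  then have "below w ?q = 0" unfolding below_def by (intro sum.neutral) auto
  then show ?thesis using that[of ?q] q C by (auto simp: chain_def)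
qed

lemma below_add:
  assumes "q \<in> P" shows "below w q + w q = sum w {r\<in>P. le r q}"
proof -
  have "{r\<in>P. le r q} = insert q {r\<in>P. le r q \<and> r \<noteq> q}" using assms le_refl by auto
  then show ?thesis using finite_P by (simp add: below_def)
qed

lemma weights_greatest:
  assumes w: "weights w" obtains q where "q \<in> P" "0 < w q" "below w q + w q = 1"
proof -
  let ?C = "{p. 0 < w p}"
  note C = weights_supp(1)[OF w]
  let ?q = "enum ?C (card ?C - 1)"
  have lt: "card ?C - 1 < card ?C" using card_chain_pos[OF C] by auto
  have q: "?q \<in> ?C" "rank ?C ?q = card ?C - 1" using enum_in[OF C lt] rank_enum[OF C lt] by auto
  have CP: "?C \<subseteq> P" using C by (simp add: chain_def)
  have "le r ?q" if r: "r \<in> ?C" for r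
  proof -
    have "rank ?C r \<le> card ?C - 1" using rank_less[OF C r] by linarith
    from enum_mono[OF C this lt] show ?thesis by (simp add: enum_rank[OF C r])
  qed
  then have "sum w ?C = sum w {r\<in>P. le r ?q}"
    using finite_P CP w by (intro sum.mono_neutral_left) (auto simp: weights_def order.order_iff_strict)
  then have "below w ?q + w ?q = 1" using weights_supp(2)[OF w] below_add q(1) CP by auto
  then show ?thesis using that[of ?q] q CP by auto
qed

lemma below_nonneg: "weights w \<Longrightarrow> 0 \<le> below w p"
  by (auto simp: below_def weights_def intro: sum_nonneg)

lemma cut_nonneg: "weights w \<Longrightarrow> 0 \<le> cut \<tau> w p"
  by (auto simp: cut_def weights_def)

text \<open>The interval of the greatest element of the support ends at 1, beyond
  \<open>\<tau>\<close>.\<close>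

lemma sum_cut_pos:
  assumes "weights w" "\<tau> < 1" shows "0 < (\<Sum>q\<in>P. cut \<tau> w q)"
proof -
  obtain q where q: "q \<in> P" "0 < w q" "below w q + w q = 1" using weights_greatest[OF assms(1)] .
  then have "0 < cut \<tau> w q" using assms(2) by (auto simp: cut_def)
  then show ?thesis using q(1) finite_P cut_nonneg[OF assms(1)] by (intro sum_pos2) auto
qed

lemma truncate_pos:
  assumes "weights w" "\<tau> < 1"
  shows "0 < truncate \<tau> w p \<longleftrightarrow> 0 < w p \<and> \<tau> < below w p + w p"
  using sum_cut_pos[OF assms] by (auto simp: truncate_def zero_less_divide_iff cut_def)

lemma weights_truncate:
  assumes "weights w" "\<tau> < 1" shows "weights (truncate \<tau> w)"
  unfolding weights_def
proof (intro conjI allI impI)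
  show "0 \<le> truncate \<tau> w p" for p
    using sum_cut_pos[OF assms] cut_nonneg[OF assms(1)] by (simp add: truncate_def)
  show "truncate \<tau> w p = 0" if "p \<notin> P" for p
    using that assms(1) by (simp add: truncate_def cut_def weights_def)
  show "(\<Sum>p\<in>P. truncate \<tau> w p) = 1"
    using sum_cut_pos[OF assms] by (simp add: truncate_def sum_divide_distrib[symmetric])
  show "le p q \<or> le q p" if "0 < truncate \<tau> w p \<and> 0 < truncate \<tau> w q" for p q
    using that assms truncate_pos[OF assms] by (auto simp: weights_def)
qed

lemma truncate_0:
  assumes "weights w" shows "truncate 0 w = w"
proof -
  have "cut 0 w p = w p" for p
    using below_nonneg[OF assms, of p] assms by (auto simp: cut_def weights_def)
  then show ?thesis using assms by (simp add: truncate_def weights_def fun_eq_iff)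
qed

lemma continuous_on_below:
  assumes "\<And>p. p \<in> P \<Longrightarrow> continuous_on S (\<lambda>k. w k p)"
  shows "continuous_on S (\<lambda>k. below (w k) q)"
  unfolding below_def using assms by (intro continuous_on_sum) auto

lemma continuous_on_truncate:
  assumes w: "\<And>p. p \<in> P \<Longrightarrow> continuous_on S (\<lambda>k. w k p)" and \<tau>: "continuous_on S \<tau>"
    and "\<And>k. k \<in> S \<Longrightarrow> weights (w k) \<and> \<tau> k < 1" and p: "p \<in> P"
  shows "continuous_on S (\<lambda>k. truncate (\<tau> k) (w k) p)"
proof -
  have c: "continuous_on S (\<lambda>k. cut (\<tau> k) (w k) q)" if "q \<in> P" for q
    unfolding cut_def using w[OF that] continuous_on_below[OF w] \<tau>
    by (intro continuous_on_min continuous_on_max continuous_on_const continuous_on_diff continuous_on_add)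
  have "\<forall>k\<in>S. (\<Sum>q\<in>P. cut (\<tau> k) (w k) q) \<noteq> 0" using sum_cut_pos assms(3) by fastforce
  then show ?thesis unfolding truncate_def by (intro continuous_on_divide continuous_on_sum c p) auto
qed

end

text \<open>The contractions are defined on a larger space \<open>Y\<close>, so that they can be composed without any
  membership condition.\<close>

locale contractible_regions = topological_poset_over X P le R T lq \<xi> \<rho> mk
  for X :: "'x topology" and P :: "'p set" and le R and T :: "'c topology" and lq \<xi> \<rho> mk +
  fixes Y :: "'x topology" and \<Omega> :: "'x set" and C :: "'p \<Rightarrow> real \<Rightarrow> 'x \<Rightarrow> 'x" and y :: "'p \<Rightarrow> 'x"
  assumes X_def: "X = subtopology Y \<Omega>"
    and cont_C: "p \<in> P \<Longrightarrow> continuous_map (prod_topology (top_of_set {0..1}) Y) Y (\<lambda>(s, x). C p s x)"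
    and C_0: "p \<in> P \<Longrightarrow> x \<in> topspace Y \<Longrightarrow> C p 0 x = x"
    and C_1: "p \<in> P \<Longrightarrow> x \<in> topspace Y \<Longrightarrow> C p 1 x = y p"
    and C_R: "\<lbrakk>p \<in> P; x \<in> topspace X; R x p; 0 \<le> s; s \<le> 1\<rbrakk> \<Longrightarrow> C p s x \<in> topspace X \<and> R (C p s x) p"
    and y_R: "p \<in> P \<Longrightarrow> y p \<in> topspace X \<and> R (y p) p"
begin

section \<open>Contractions run in succession\<close>

abbreviation run :: "'p list \<Rightarrow> ('p \<Rightarrow> real) \<Rightarrow> 'x \<Rightarrow> 'x" where
  "run ps s \<equiv> fold (\<lambda>p. C p (s p)) ps"

lemma topspace_X_Y: "x \<in> topspace X \<Longrightarrow> x \<in> topspace Y"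
  by (simp add: X_def)

lemma C_in_Y:
  assumes "p \<in> P" "x \<in> topspace Y" "0 \<le> s" "s \<le> 1" shows "C p s x \<in> topspace Y"
proof -
  have "(s, x) \<in> topspace (prod_topology (top_of_set {0..1}) Y)" using assms by simp
  then have "(\<lambda>(s, x). C p s x) (s, x) \<in> topspace Y"
    using cont_C[OF assms(1)] unfolding continuous_map_def by blast
  then show ?thesis by simp
qed

lemma continuous_map_run:
  assumes "set ps \<subseteq> P" and "continuous_map Z Y x"
    and "\<And>p. p \<in> P \<Longrightarrow> continuous_map Z (top_of_set {0..1}) (\<lambda>k. s k p)"
  shows "continuous_map Z Y (\<lambda>k. run ps (s k) (x k))"
  using assms(1,2)
proof (induction ps arbitrary: x)
  case (Cons p ps)
  have p: "p \<in> P" using Cons by auto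
  have "continuous_map Z (prod_topology (top_of_set {0..1}) Y) (\<lambda>k. (s k p, x k))"
    using assms(3)[OF p] Cons.prems(2) by (rule continuous_map_paired[THEN iffD2, OF conjI])
  from continuous_map_compose[OF this cont_C[OF p]]
  have "continuous_map Z Y (\<lambda>k. C p (s k p) (x k))" by (simp add: o_def)
  from Cons.IH[OF _ this] show ?case using Cons.prems(1) by simp
qed simp

text \<open>Call \<open>p\<close> active if \<open>s p \<noteq> 0\<close>. After the contraction for
  an active \<open>p\<close> the point is in the region of \<open>p\<close>, hence in the regions of
  all larger elements. Active elements form a chain and are met in increasing order, so the later
  contractions still apply, and regions of elements above all of them are never left.\<close>

lemma run_R:
  assumes ps: "set ps \<subseteq> P" "sorted_wrt (\<lambda>p q. le q p \<longrightarrow> p = q) ps"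
    and s: "\<And>p. p \<in> P \<Longrightarrow> 0 \<le> s p \<and> s p \<le> 1"
    and comparable: "\<And>p q. p \<in> P \<Longrightarrow> q \<in> P \<Longrightarrow> s p \<noteq> 0 \<Longrightarrow> s q \<noteq> 0 \<Longrightarrow> le p q \<or> le q p"
    and x: "x \<in> topspace X" "\<And>p. p \<in> set ps \<Longrightarrow> s p \<noteq> 0 \<Longrightarrow> R x p"
  shows "run ps s x \<in> topspace X \<and>
     (\<forall>q\<in>P. R x q \<and> (\<forall>p\<in>set ps. s p \<noteq> 0 \<longrightarrow> le p q) \<longrightarrow> R (run ps s x) q)"
  using ps x
proof (induction ps arbitrary: x)
  case (Cons p ps)
  have p: "p \<in> P" "set ps \<subseteq> P" "sorted_wrt (\<lambda>p q. le q p \<longrightarrow> p = q) ps"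
    using Cons.prems by auto
  show ?case
  proof (cases "s p = 0")
    case True
    then have "run (p # ps) s x = run ps s x" using C_0[OF p(1)] topspace_X_Y[OF Cons.prems(3)] by simp
    then show ?thesis using Cons.IH[OF p(2,3) Cons.prems(3)] Cons.prems(4) by auto
  next
    case False
    let ?x = "C p (s p) x"
    have x1: "?x \<in> topspace X" "R ?x p"
      using C_R[OF p(1) Cons.prems(3)] Cons.prems(4)[of p] False s[OF p(1)] by auto
    have x1R: "R ?x q" if "q \<in> P" "le p q" for q using R_mono[OF x1(1) p(1) that(1) x1(2) that(2)] .
    have "R ?x q" if q: "q \<in> set ps" "s q \<noteq> 0" for q
    proof -
      have "q \<in> P" using q p by auto
      then have "le p q \<or> le q p" using comparable[OF p(1)] q False by auto
      then have "le p q" using Cons.prems(2) q(1) le_refl[OF p(1)] by auto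
      then show ?thesis using x1R \<open>q \<in> P\<close> by blast
    qed
    from Cons.IH[OF p(2,3) x1(1) this] show ?thesis using x1R False by auto
  qed
qed auto

text \<open>A complete contraction sends everything to \<open>y r\<close>. So the start is
  forgotten, together with whatever earlier contractions did to it, even outside \<open>X\<close>;
  from \<open>y r\<close> on, \<open>run_R\<close> applies.\<close>

lemma run_reset:
  assumes ps: "set ps \<subseteq> P" "sorted_wrt (\<lambda>p q. le q p \<longrightarrow> p = q) ps"
    and s: "\<And>p. p \<in> P \<Longrightarrow> 0 \<le> s p \<and> s p \<le> 1"
    and comparable: "\<And>p q. p \<in> P \<Longrightarrow> q \<in> P \<Longrightarrow> s p \<noteq> 0 \<Longrightarrow> s q \<noteq> 0 \<Longrightarrow> le p q \<or> le q p"
    and x: "x \<in> topspace Y" "x' \<in> topspace Y" and r: "r \<in> set ps" "s r = 1"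
  shows "run ps s x = run ps s x' \<and> run ps s x \<in> topspace X \<and>
     (\<forall>q\<in>P. (\<forall>p\<in>set ps. s p \<noteq> 0 \<longrightarrow> le p q) \<longrightarrow> R (run ps s x) q)"
  using ps x r(1)
proof (induction ps arbitrary: x x')
  case (Cons p ps)
  have p: "p \<in> P" "set ps \<subseteq> P" "sorted_wrt (\<lambda>p q. le q p \<longrightarrow> p = q) ps"
    using Cons.prems by auto
  show ?case
  proof (cases "s p = 1")
    case True
    have eq: "run (p # ps) s x = run ps s (y p)" "run (p # ps) s x' = run ps s (y p)"
      using C_1[OF p(1)] Cons.prems(3,4) True by auto
    have yX: "y p \<in> topspace X" "R (y p) p" using y_R[OF p(1)] by auto
    have yR: "R (y p) q" if "q \<in> P" "le p q" for q using R_mono[OF yX(1) p(1) that(1) yX(2) that(2)] .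
    have "R (y p) q" if q: "q \<in> set ps" "s q \<noteq> 0" for q
    proof -
      have "q \<in> P" using q p by auto
      then have "le p q \<or> le q p" using comparable[OF p(1)] q True by auto
      then have "le p q" using Cons.prems(2) q(1) le_refl[OF p(1)] by auto
      then show ?thesis using yR \<open>q \<in> P\<close> by blast
    qed
    then have "run ps s (y p) \<in> topspace X \<and>
       (\<forall>q\<in>P. R (y p) q \<and> (\<forall>p\<in>set ps. s p \<noteq> 0 \<longrightarrow> le p q) \<longrightarrow> R (run ps s (y p)) q)"
      using p(2,3) s comparable yX(1) by (intro run_R) blast+
    note run_y = conjunct1[OF this] conjunct2[OF this]
    show ?thesis
      unfolding eq
    proof (intro conjI ballI impI refl run_y(1))
      fix q assume q: "q \<in> P" "\<forall>p'\<in>set (p # ps). s p' \<noteq> 0 \<longrightarrow> le p' q"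
      then have "R (y p) q" using yR True by simp
      then show "R (run ps s (y p)) q" using run_y(2) q by simp
    qed
  next
    case False
    then have r': "r \<in> set ps" using Cons.prems(5) r(2) by auto
    have "C p (s p) x \<in> topspace Y" "C p (s p) x' \<in> topspace Y"
      using C_in_Y[OF p(1)] Cons.prems(3,4) s[OF p(1)] by auto
    note IH = Cons.IH[OF p(2,3) this r']
    have eq: "run (p # ps) s x = run ps s (C p (s p) x)" "run (p # ps) s x' = run ps s (C p (s p) x')" by simp_all
    show ?thesis
      unfolding eq
    proof (intro conjI ballI impI)
      fix q assume q: "q \<in> P" "\<forall>p'\<in>set (p # ps). s p' \<noteq> 0 \<longrightarrow> le p' q"
      then have "\<forall>p'\<in>set ps. s p' \<noteq> 0 \<longrightarrow> le p' q" by simp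
      then show "R (run ps s (C p (s p) x)) q" using IH q(1) by blast
    qed (use IH in blast)+
  qed
qed simp

text \<open>Sorting by the number of elements below works, since that number grows strictly along
  the order.\<close>

lemma ex_linear_extension: "\<exists>ps. set ps = P \<and> sorted_wrt (\<lambda>p q. le q p \<longrightarrow> p = q) ps"
proof -
  obtain xs where xs: "set xs = P" using finite_P finite_list by blast
  define key where "key p = card {q\<in>P. le q p}" for p
  have key: "p = q" if "p \<in> P" "q \<in> P" "le q p" "key p \<le> key q" for p q
  proof (rule ccontr)
    assume "p \<noteq> q"
    then have "{r\<in>P. le r q} \<subset> {r\<in>P. le r p}"
    proof (intro psubsetI subsetI)
      show "r \<in> {r\<in>P. le r p}" if "r \<in> {r\<in>P. le r q}" for r
        using that le_trans[of r q p] \<open>p \<in> P\<close> \<open>q \<in> P\<close> \<open>le q p\<close> by simp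
      have "p \<notin> {r\<in>P. le r q}" using le_antisym[of p q] that \<open>p \<noteq> q\<close> by auto
      moreover have "p \<in> {r\<in>P. le r p}" using le_refl that by simp
      ultimately show "{r\<in>P. le r q} \<noteq> {r\<in>P. le r p}" by blast
    qed
    then have "key q < key p" unfolding key_def using finite_P by (intro psubset_card_mono) auto
    then show False using that by simp
  qed
  have "sorted_wrt (\<lambda>p q. key p \<le> key q) (sort_key key xs)"
    using sorted_sort_key[of key xs] by (simp add: sorted_wrt_map)
  then have "sorted_wrt (\<lambda>p q. le q p \<longrightarrow> p = q) (sort_key key xs)"
    by (rule sorted_wrt_mono_rel[rotated]) (use key xs in auto)
  then show ?thesis using xs by (intro exI[of _ "sort_key key xs"]) auto
qed

text \<open>The summand \<open>1/2 - \<beta>\<close> in \<open>step\<close> keeps the denominator positive while \<open>\<beta> < 1/2\<close>; for \<open>\<beta> = 1/2\<close>, the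
  largest \<open>push\<close> yields a step of size 1.\<close>

definition push :: "real \<Rightarrow> ('p \<Rightarrow> real) \<Rightarrow> 'p \<Rightarrow> real" where
  "push \<beta> w q = w q * max 0 (\<beta> - below w q)"

definition step :: "real \<Rightarrow> ('p \<Rightarrow> real) \<Rightarrow> 'p \<Rightarrow> real" where
  "step \<beta> w q = min 1 (real (card P) * push \<beta> w q / ((1/2 - \<beta>) + (\<Sum>p\<in>P. push \<beta> w p)))"

lemma push_nonneg: "weights w \<Longrightarrow> 0 \<le> push \<beta> w q"
  by (auto simp: push_def weights_def)

text \<open>For \<open>\<beta> = 1/2\<close> the least element of the support, having no mass below
  it, has positive push.\<close>

lemma step_denominator_pos:
  assumes w: "weights w" and b: "\<beta> \<le> 1/2" shows "0 < (1/2 - \<beta>) + (\<Sum>p\<in>P. push \<beta> w p)"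
proof (cases "\<beta> < 1/2")
  case True
  then show ?thesis using push_nonneg[OF w] by (intro add_pos_nonneg sum_nonneg) auto
next
  case False
  obtain q where q: "q \<in> P" "0 < w q" "below w q = 0" using weights_least[OF w] .
  then have "0 < push \<beta> w q" using False by (simp add: push_def)
  then have "0 < (\<Sum>p\<in>P. push \<beta> w p)"
    using q(1) finite_P push_nonneg[OF w] by (intro sum_pos2) auto
  then show ?thesis using b by simp
qed

lemma step_range:
  assumes "weights w" "\<beta> \<le> 1/2" shows "0 \<le> step \<beta> w q \<and> step \<beta> w q \<le> 1"
  using step_denominator_pos[OF assms] push_nonneg[OF assms(1), of \<beta> q] by (auto simp: step_def)

text \<open>Active elements have intervals beginning before \<open>\<beta>\<close>, whereas
  \<open>truncate \<beta>\<close> keeps elements whose intervals end after \<open>\<beta>\<close>.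
  On a chain the active elements therefore lie below the remaining ones, as the contractions
  require.\<close>

lemma step_nonzero:
  assumes "step \<beta> w q \<noteq> 0" "weights w" shows "0 < w q \<and> below w q < \<beta>"
proof -
  have "push \<beta> w q \<noteq> 0" using assms(1) by (auto simp: step_def)
  then have "w q \<noteq> 0" "below w q < \<beta>" by (auto simp: push_def max_def split: if_splits)
  then show ?thesis using assms(2) by (metis weights_def order_le_less)
qed

lemma step_0:
  assumes "weights w" shows "step 0 w q = 0"
  using step_nonzero[OF _ assms, of 0 q] below_nonneg[OF assms, of q] by force

text \<open>Some push is at least the average, and the factor \<open>card P\<close> raises its
  quotient to 1 or more.\<close>

lemma step_one:
  assumes w: "weights w" shows "\<exists>q\<in>P. step (1/2) w q = 1"
proof (rule ccontr)
  assume no: "\<not> ?thesis"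
  let ?G = "\<Sum>p\<in>P. push (1/2) w p"
  have G: "0 < ?G" using step_denominator_pos[OF w, of "1/2"] by simp
  have "real (card P) * push (1/2) w q < ?G" if "q \<in> P" for q
  proof (rule ccontr)
    assume "\<not> ?thesis"
    then have "1 \<le> real (card P) * push (1/2) w q / ?G" using G by (simp add: le_divide_eq)
    then have "step (1/2) w q = 1" by (simp add: step_def)
    then show False using no that by blast
  qed
  moreover have "P \<noteq> {}" using weights_least[OF w] by blast
  ultimately have "(\<Sum>q\<in>P. real (card P) * push (1/2) w q) < (\<Sum>q\<in>P. ?G)"
    using finite_P by (intro sum_strict_mono) auto
  then show False by (simp add: sum_distrib_left[symmetric])
qed

lemma continuous_on_step:
  assumes w: "\<And>p. p \<in> P \<Longrightarrow> continuous_on S (\<lambda>k. w k p)" and \<beta>: "continuous_on S \<beta>"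
    and "\<And>k. k \<in> S \<Longrightarrow> weights (w k) \<and> \<beta> k \<le> 1/2" and q: "q \<in> P"
  shows "continuous_on S (\<lambda>k. step (\<beta> k) (w k) q)"
proof -
  have c: "continuous_on S (\<lambda>k. push (\<beta> k) (w k) p)" if "p \<in> P" for p
    unfolding push_def using w[OF that] continuous_on_below[OF w] \<beta>
    by (intro continuous_on_mult continuous_on_max continuous_on_const continuous_on_diff)
  have "\<forall>k\<in>S. (1/2 - \<beta> k) + (\<Sum>p\<in>P. push (\<beta> k) (w k) p) \<noteq> 0" using step_denominator_pos assms(3) by fastforce
  then show ?thesis unfolding step_def
    by (intro continuous_on_min continuous_on_const continuous_on_divide continuous_on_mult continuous_on_add
         continuous_on_diff continuous_on_sum c q \<beta>) auto
qed

text \<open>\<open>E'\<close> stands for |P|, which is a realisation over another base and is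
  accessed only through its weights. The lift carries truncated weights, and the homotopy undoes the
  truncation.\<close>

lemma relative_lifting_weights:
  fixes E' :: "'e topology" and pt' :: "('p \<Rightarrow> real) \<Rightarrow> 'e" and wx' :: "'e \<Rightarrow> 'p \<Rightarrow> real"
  assumes E_weights: "\<And>e. e \<in> topspace E' \<Longrightarrow> weights (wx' e) \<and> pt' (wx' e) = e"
    and wx_pt': "\<And>w. weights w \<Longrightarrow> wx' (pt' w) = w"
    and cont_wx': "\<And>p. continuous_map E' euclideanreal (\<lambda>e. wx' e p)"
    and cont_pt': "\<And>(S :: (real \<times> (nat \<Rightarrow> real) \<times> real) set) w.
       (\<And>k. k \<in> S \<Longrightarrow> weights (w k)) \<Longrightarrow> (\<And>p. p \<in> P \<Longrightarrow> continuous_on S (\<lambda>k. w k p)) \<Longrightarrow>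
       continuous_map (top_of_set S) E' (\<lambda>k. pt' (w k))"
  shows "relative_lifting E E' (\<lambda>U. pt' (wx U))"
  unfolding relative_lifting_def
proof (intro allI impI, elim conjE)
  fix S :: "((nat \<Rightarrow> real) \<times> real) set" and v \<zeta> u
  assume S: "compact S" and v: "continuous_map (top_of_set S) E' v" and \<zeta>: "continuous_on S \<zeta>" "\<zeta> ` S \<subseteq> {0..1::real}"
    and u: "continuous_map (top_of_set {k\<in>S. \<zeta> k < 1}) E u" and uv: "\<forall>k\<in>S. \<zeta> k < 1 \<longrightarrow> pt' (wx (u k)) = v k"
  define U where "U = {k\<in>S. \<zeta> k < 1}"
  define w where "w k = wx' (v k)" for k
  \<comment> \<open>\<open>\<beta>\<close> is the mass removed: 0 where the partial lift must be
    kept, and 1/2, where some contraction is complete, from \<open>\<zeta> = 1/2\<close> on.\<close>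
  define \<beta> where "\<beta> k = min (1/2) (\<zeta> k)" for k
  define w' where "w' k = truncate (\<beta> k) (w k)" for k
  obtain ps where ps: "set ps = P" "sorted_wrt (\<lambda>p q. le q p \<longrightarrow> p = q) ps"
    using ex_linear_extension by blast
  \<comment> \<open>An arbitrary choice: it is the start only where \<open>\<beta> k = 1/2\<close>,
    and there the start is forgotten.\<close>
  define x0 where "x0 = y (hd ps)"
  define x where "x k = (if \<zeta> k \<le> 1/2 then run ps (step (\<beta> k) (w k)) (px (u k))
     else run ps (step (\<beta> k) (w k)) x0)" for k
  have vE: "v k \<in> topspace E'" if "k \<in> S" for k using v that by (auto simp: continuous_map_def)
  have uE: "u k \<in> topspace E" if "k \<in> U" for k using u that by (auto simp: continuous_map_def U_def)
  have W: "weights (w k)" if "k \<in> S" for k using E_weights vE that by (simp add: w_def)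
  have wu: "wx (u k) = w k" if k: "k \<in> U" for k
  proof -
    have "weights (wx (u k))" using E_coords(1)[OF uE[OF k]] by (simp add: valid_iff_weights)
    from wx_pt'[OF this] show ?thesis using uv k by (simp add: w_def U_def)
  qed
  have contw: "continuous_on S (\<lambda>k. w k p)" for p
    using continuous_map_compose[OF v cont_wx'[of p]] by (simp add: o_def w_def)
  have \<beta>: "0 \<le> \<beta> k \<and> \<beta> k \<le> 1/2" if "k \<in> S" for k using \<zeta>(2) that by (auto simp: \<beta>_def)
  have cont\<beta>: "continuous_on S \<beta>" unfolding \<beta>_def by (intro continuous_on_min continuous_on_const \<zeta>(1))
  have contw': "continuous_on S (\<lambda>k. w' k p)" if "p \<in> P" for p
  proof -
    have "\<beta> k < 1" if "k \<in> S" for k using \<beta>[OF that] by linarith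
    then show ?thesis
      unfolding w'_def using W by (intro continuous_on_truncate contw cont\<beta> that) blast
  qed
  have W': "weights (w' k)" if "k \<in> S" for k
    unfolding w'_def using W[OF that] \<beta>[OF that] by (intro weights_truncate) auto
  have w'_pos: "0 < w' k p \<longleftrightarrow> 0 < w k p \<and> \<beta> k < below (w k) p + w k p" if "k \<in> S" for k p
    unfolding w'_def using truncate_pos[OF W[OF that]] \<beta>[OF that] by auto
  have step01: "0 \<le> step (\<beta> k) (w k) p \<and> step (\<beta> k) (w k) p \<le> 1" if "k \<in> S" for k p
    using step_range W \<beta> that by blast
  have active: "0 < w k q \<and> below (w k) q < \<beta> k" if "k \<in> S" "step (\<beta> k) (w k) q \<noteq> 0" for k q
    using step_nonzero[OF that(2) W[OF that(1)]] .
  have comparable: "le p q \<or> le q p"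
    if "k \<in> S" "p \<in> P" "q \<in> P" "step (\<beta> k) (w k) p \<noteq> 0" "step (\<beta> k) (w k) q \<noteq> 0" for k p q
    using active[OF that(1,4)] active[OF that(1,5)] W[OF that(1)] by (simp add: weights_def)
  have contstep: "continuous_on S (\<lambda>k. step (\<beta> k) (w k) q)" if "q \<in> P" for q
    using \<beta> W by (intro continuous_on_step contw cont\<beta> that) auto
  have U_half: "k \<in> U" if "k \<in> S" "\<zeta> k \<le> 1/2" for k using that by (simp add: U_def)
  have pxu: "px (u k) \<in> topspace X" if "k \<in> U" for k
    using E_coords(1)[OF uE[OF that]] by (simp add: valid_iff_weights)
  have x0X: "x0 \<in> topspace X" if k: "k \<in> S" for k :: "(nat \<Rightarrow> real) \<times> real"
  proof -
    obtain q where "q \<in> P" using weights_least[OF W[OF k]] by blast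
    then have "hd ps \<in> P" using ps(1) by (metis empty_iff hd_in_set list.set(1))
    then show ?thesis using y_R by (simp add: x0_def)
  qed
  have reset: "\<exists>q\<in>set ps. step (\<beta> k) (w k) q = 1" if "k \<in> S" "1/2 \<le> \<zeta> k" for k
    using step_one[OF W[OF that(1)]] that(2) ps(1) by (simp add: \<beta>_def min_absorb1)
  have R_x: "x k \<in> topspace X \<and> (\<forall>q\<in>P. (\<zeta> k < 1/2 \<longrightarrow> R (px (u k)) q) \<and>
      (\<forall>p\<in>P. step (\<beta> k) (w k) p \<noteq> 0 \<longrightarrow> le p q) \<longrightarrow> R (x k) q)" if k: "k \<in> S" for k
  proof (cases "\<zeta> k < 1/2")
    case True
    then have kU: "k \<in> U" using U_half k by simp
    have "R (px (u k)) p" if "step (\<beta> k) (w k) p \<noteq> 0" for p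
      using active[OF k that] E_coords(1)[OF uE[OF kU]] wu[OF kU] by (simp add: valid_def)
    then show ?thesis
      using run_R[OF _ ps(2), of "step (\<beta> k) (w k)" "px (u k)"] step01[OF k] comparable[OF k] pxu[OF kU] True ps(1)
      by (simp add: x_def)
  next
    case False
    then obtain r where r: "r \<in> set ps" "step (\<beta> k) (w k) r = 1" using reset[OF k] by auto
    let ?x = "if \<zeta> k \<le> 1/2 then px (u k) else x0"
    have "?x \<in> topspace Y" using pxu U_half[OF k] x0X[OF k] topspace_X_Y by auto
    from run_reset[where s = "step (\<beta> k) (w k)", OF _ ps(2) step01[OF k] comparable[OF k] this this r]
    have "run ps (step (\<beta> k) (w k)) ?x \<in> topspace X \<and>
      (\<forall>q\<in>P. (\<forall>p\<in>P. step (\<beta> k) (w k) p \<noteq> 0 \<longrightarrow> le p q) \<longrightarrow> R (run ps (step (\<beta> k) (w k)) ?x) q)"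
      using ps(1) by simp
    moreover have "x k = run ps (step (\<beta> k) (w k)) ?x" by (simp add: x_def)
    ultimately show ?thesis using False by simp
  qed
  have sup: "supports S x w'"
    unfolding supports_def
  proof (intro ballI impI)
    fix p k assume p: "p \<in> P" and k: "k \<in> S" and cl: "k \<in> closure {k'\<in>S. 0 < w' k' p}"
    have "continuous_on S (\<lambda>k. below (w k) p + w k p - \<beta> k)"
      by (intro continuous_on_diff continuous_on_add continuous_on_below contw cont\<beta>)
    from continuous_closedin_preimage[OF this, of "{0..}"]
    obtain D where D: "closed D" "S \<inter> (\<lambda>k. below (w k) p + w k p - \<beta> k) -` {0..} = S \<inter> D"
      by (auto simp: closedin_closed)
    have "{k'\<in>S. 0 < w' k' p} \<subseteq> S \<inter> (\<lambda>k. below (w k) p + w k p - \<beta> k) -` {0..}"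
      using w'_pos by auto
    then have "{k'\<in>S. 0 < w' k' p} \<subseteq> D" unfolding D(2) by blast
    then have "k \<in> D" using cl D(1) closure_minimal by blast
    then have "k \<in> S \<inter> (\<lambda>k. below (w k) p + w k p - \<beta> k) -` {0..}" unfolding D(2) using k by blast
    then have ge: "\<beta> k \<le> below (w k) p + w k p" by simp
    \<comment> \<open>By \<open>ge\<close> the interval of \<open>p\<close> ends at
      \<open>\<beta> k\<close> or later, although \<open>p\<close> may have no weight at
      \<open>k\<close> itself; that of the active \<open>q\<close> begins strictly before
      \<open>\<beta> k\<close>. Both have positive weight at some nearby \<open>k'\<close>, so they
      are comparable. If \<open>p\<close> were strictly below \<open>q\<close>, its interval would
      end before that of \<open>q\<close> begins.\<close>
    have act: "le q p" if q: "q \<in> P" "step (\<beta> k) (w k) q \<noteq> 0" for q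
    proof -
      note a = active[OF k q(2)]
      obtain O' where O': "open O'" "S \<inter> (\<lambda>k. w k q) -` {0<..} = O' \<inter> S"
        using continuous_on_open_invariant[THEN iffD1, OF contw[of q], rule_format, of "{0<..}"] by (metis Int_commute open_greaterThan)
      then have "k \<in> O'" using a k by auto
      then obtain k' where "k' \<in> {k'\<in>S. 0 < w' k' p}" "k' \<in> O'"
        using cl O'(1) by (meson closure_iff_nhds_not_empty disjoint_iff open_Int_closure_eq_empty)
      then have k': "k' \<in> S" "0 < w' k' p" "0 < w k' q" using O'(2) by auto
      then have "0 < w k' p" using w'_pos by blast
      then have "le p q \<or> le q p" using W[OF k'(1)] k'(3) by (simp add: weights_def)
      moreover have "p = q" if "le p q"
      proof (rule ccontr)
        assume "p \<noteq> q"
        have "{r\<in>P. le r p} \<subseteq> {r\<in>P. le r q \<and> r \<noteq> q}"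
        proof clarify
          fix r assume r: "r \<in> P" "le r p"
          have "r \<noteq> q" using r \<open>p \<noteq> q\<close> that p le_antisym by blast
          then show "le r q \<and> r \<noteq> q" using le_trans[OF r(1) p q(1) r(2) that] by simp
        qed
        then have "sum (w k) {r\<in>P. le r p} \<le> below (w k) q"
          unfolding below_def using W[OF k] finite_P by (intro sum_mono2) (auto simp: weights_def)
        then show False using below_add[OF p, of "w k"] ge a by simp
      qed
      ultimately show ?thesis using le_refl p by blast
    qed
    \<comment> \<open>Truncation only shrinks supports, and \<open>U\<close> is open in
      \<open>S\<close>, so the support condition of the partial lift carries over.\<close>
    have "R (px (u k)) p" if lt: "\<zeta> k < 1/2"
    proof -
      have kU: "k \<in> U" using U_half k lt by simp
      have "openin (top_of_set S) U"
        using continuous_openin_preimage_gen[OF \<zeta>(1), of "{..<1}"] by (simp add: U_def vimage_def Int_def)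
      then obtain O' where O': "open O'" "U = S \<inter> O'" by (auto simp: openin_open)
      have "k \<in> O' \<inter> closure {k'\<in>S. 0 < w' k' p}" using O' kU cl by auto
      then have "k \<in> closure (O' \<inter> {k'\<in>S. 0 < w' k' p})" using open_Int_closure_subset[OF O'(1)] by blast
      moreover have "O' \<inter> {k'\<in>S. 0 < w' k' p} \<subseteq> {k'\<in>U. 0 < wx (u k') p}"
        using O'(2) wu w'_pos by auto
      ultimately have "k \<in> closure {k'\<in>U. 0 < wx (u k') p}" using closure_mono by blast
      moreover have "supports U (\<lambda>k. px (u k)) (\<lambda>k. wx (u k))"
        using good_of_continuous_map[OF u] by (simp add: good_def U_def)
      ultimately show ?thesis using p kU unfolding supports_def by blast
    qed
    then show "R (x k) p" using R_x[OF k] p act by blast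
  qed
  have contx: "continuous_map (top_of_set S) X x"
  proof -
    have step_cm: "continuous_map (top_of_set A) (top_of_set {0..1}) (\<lambda>k. step (\<beta> k) (w k) p)" if "p \<in> P" "A \<subseteq> S" for p A
      using continuous_on_subset[OF contstep[OF that(1)] that(2)] step01 that(2)
      by (auto simp: continuous_map_in_subtopology)
    have z: "continuous_map (top_of_set S) euclideanreal \<zeta>" using \<zeta>(1) by simp
    have "continuous_map (top_of_set S) Y x"
      unfolding x_def
    proof (rule continuous_map_cases_le[OF z continuous_map_const[THEN iffD2]], goal_cases)
      case 2
      let ?A = "{k \<in> S. \<zeta> k \<le> 1/2}"
      have "continuous_map (top_of_set U) X (\<lambda>k. px (u k))"
        using continuous_map_compose[OF u continuous_map_px] by (simp add: o_def U_def)
      then have "continuous_map (top_of_set U) Y (\<lambda>k. px (u k))"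
        unfolding X_def by (simp add: continuous_map_in_subtopology)
      then have "continuous_map (top_of_set ?A) Y (\<lambda>k. px (u k))"
        by (rule continuous_map_from_subtopology_mono) (auto simp: U_def)
      then have "continuous_map (top_of_set ?A) Y (\<lambda>k. run ps (step (\<beta> k) (w k)) (px (u k)))"
        using ps(1) step_cm[of _ ?A] by (intro continuous_map_run) auto
      moreover have "S \<inter> ?A = ?A" by auto
      ultimately show ?case by (simp add: subtopology_subtopology)
    next
      case 3
      let ?A = "{k \<in> S. 1/2 \<le> \<zeta> k}"
      have "continuous_map (top_of_set ?A) Y (\<lambda>k. x0)"
      proof (cases "S = {}")
        case False
        then obtain k where "k \<in> S" by blast
        then show ?thesis using x0X topspace_X_Y by simp
      qed simp
      then have "continuous_map (top_of_set ?A) Y (\<lambda>k. run ps (step (\<beta> k) (w k)) x0)"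
        using ps(1) step_cm[of _ ?A] by (intro continuous_map_run) auto
      moreover have "S \<inter> ?A = ?A" by auto
      ultimately show ?case by (simp add: subtopology_subtopology)
    next
      \<comment> \<open>At \<open>\<zeta> k = 1/2\<close> some step has size 1, so both starting
        points have the same image.\<close>
      case (4 k)
      then have k: "k \<in> S" by simp
      then obtain r where r: "r \<in> set ps" "step (\<beta> k) (w k) r = 1" using reset[OF k] 4 by auto
      have "px (u k) \<in> topspace Y" "x0 \<in> topspace Y" using pxu U_half[OF k] x0X[OF k] topspace_X_Y 4 by auto
      from run_reset[where s = "step (\<beta> k) (w k)", OF _ ps(2) step01[OF k] comparable[OF k] this r]
      show ?case using ps(1) by simp
    qed simp
    then show ?thesis using R_x by (auto simp: X_def continuous_map_in_subtopology)
  qed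
  have g: "good S x w'"
    unfolding good_def
  proof (intro conjI ballI)
    show "valid (x k) (w' k)" if k: "k \<in> S" for k
      unfolding valid_iff_weights
    proof (intro conjI allI impI)
      show "x k \<in> topspace X" using R_x k by blast
      show "weights (w' k)" using W' k .
      show "R (x k) p" if pos: "0 < w' k p" for p
      proof -
        have "p \<in> P" using W'[OF k] pos unfolding weights_def by (metis less_irrefl)
        moreover have "k \<in> closure {k'\<in>S. 0 < w' k' p}"
          using closure_subset[of "{k'\<in>S. 0 < w' k' p}"] k pos by blast
        ultimately show ?thesis using sup k unfolding supports_def by blast
      qed
    qed
  qed (use contx contw' sup in auto)
  have wx_h: "wx (pt (x k) (w' k)) = w' k" if "k \<in> S" for k
    using pt_coords(3) g that by (simp add: good_def)
  show "\<exists>h H. continuous_map (top_of_set S) E h \<and> (\<forall>k\<in>S. \<zeta> k = 0 \<longrightarrow> h k = u k) \<and>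
        continuous_map (top_of_set ({0..1::real} \<times> S)) E' H \<and>
        (\<forall>k\<in>S. H (0, k) = pt' (wx (h k)) \<and> H (1, k) = v k) \<and>
        (\<forall>k\<in>S. \<forall>t\<in>{0..1}. \<zeta> k = 0 \<longrightarrow> H (t, k) = v k)"
  proof (intro exI conjI ballI impI)
    \<comment> \<open>Reducing the removed mass from \<open>\<beta> k\<close> to 0 leads from the
      weights of the lift back to \<open>w k\<close>.\<close>
    let ?H = "\<lambda>(t, k). pt' (truncate ((1 - t) * \<beta> k) (w k))"
    show "continuous_map (top_of_set S) E (\<lambda>k. pt (x k) (w' k))" by (rule continuous_map_of_good[OF g])
    have pv: "pt' (w k) = v k" if "k \<in> S" for k using E_weights vE that by (simp add: w_def)
    show "pt (x k) (w' k) = u k" if k: "k \<in> S" "\<zeta> k = 0" for k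
    proof -
      have kU: "k \<in> U" using k by (simp add: U_def)
      have b: "\<beta> k = 0" using k by (simp add: \<beta>_def)
      have s0: "step (\<beta> k) (w k) p = 0" for p using step_0[OF W[OF k(1)]] b by simp
      have "set qs \<subseteq> P \<Longrightarrow> run qs (step (\<beta> k) (w k)) z = z" if "z \<in> topspace Y" for qs z
        using that by (induction qs) (simp_all add: s0 C_0)
      then have "x k = px (u k)" using ps(1) k(2) topspace_X_Y[OF pxu[OF kU]] by (simp add: x_def)
      moreover have "w' k = wx (u k)" using truncate_0[OF W[OF k(1)]] wu[OF kU] by (simp add: w'_def b)
      ultimately show ?thesis using E_coords(2)[OF uE[OF kU]] by simp
    qed
    have lt1: "(1 - t) * \<beta> k < 1" if "k \<in> S" "t \<in> {0..1}" for t k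
    proof -
      have "(1 - t) * \<beta> k \<le> 1 * (1/2)" using \<beta>[OF that(1)] that(2) by (intro mult_mono) auto
      then show ?thesis by simp
    qed
    have snd: "continuous_on ({0..1::real} \<times> S) (\<lambda>z. f (snd z))" if "continuous_on S f" for f :: "(nat \<Rightarrow> real) \<times> real \<Rightarrow> real"
      by (rule continuous_on_compose2[OF that continuous_on_snd[OF continuous_on_id]]) auto
    have "continuous_map (top_of_set ({0..1} \<times> S)) E' (\<lambda>z. pt' (truncate ((1 - fst z) * \<beta> (snd z)) (w (snd z))))"
    proof (rule cont_pt')
      show "weights (truncate ((1 - fst z) * \<beta> (snd z)) (w (snd z)))" if "z \<in> {0..1} \<times> S" for z
        using that lt1 by (intro weights_truncate W) auto
      show "continuous_on ({0..1} \<times> S) (\<lambda>z. truncate ((1 - fst z) * \<beta> (snd z)) (w (snd z)) p)" if "p \<in> P" for p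
      proof (rule continuous_on_truncate[OF _ _ _ that])
        show "continuous_on ({0..1} \<times> S) (\<lambda>z. (1 - fst z) * \<beta> (snd z))"
          by (intro continuous_on_mult continuous_on_diff continuous_on_const continuous_on_fst continuous_on_id snd cont\<beta>)
      qed (use snd contw lt1 W in auto)
    qed
    then show "continuous_map (top_of_set ({0..1::real} \<times> S)) E' ?H" by (simp add: case_prod_unfold)
    show "?H (0, k) = pt' (wx (pt (x k) (w' k)))" if "k \<in> S" for k
      using wx_h[OF that] by (simp add: w'_def)
    show "?H (1, k) = v k" if "k \<in> S" for k
      using truncate_0[OF W[OF that]] pv[OF that] by simp
    show "?H (t, k) = v k" if "k \<in> S" "t \<in> {0..1}" "\<zeta> k = 0" for t k
      using truncate_0[OF W[OF that(1)]] pv[OF that(1)] that(3) by (simp add: \<beta>_def)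
  qed
qed

end

section \<open>Configurations and weighted graphs\<close>

lemma Gn_edge:
  assumes "g \<in> Gn n A" "(a, b, v) \<in> g" shows "a \<in> A" "b \<in> A" "a \<noteq> b" "1 \<le> v" "v \<le> n"
  using assms by (auto simp: Gn_def)

lemma Gn_unique:
  assumes g: "g \<in> Gn n A" and e: "(a, b, v) \<in> g"
  shows "(a, b, w) \<in> g \<longleftrightarrow> w = v" "(b, a, w) \<notin> g"
proof -
  have ab: "a \<in> A" "b \<in> A" "a \<noteq> b" using Gn_edge[OF g e] by auto
  then have ex1: "\<exists>!e. e \<in> g \<and> (\<exists>v. e = (a, b, v) \<or> e = (b, a, v))" using g by (auto simp: Gn_def)
  show "(a, b, w) \<in> g \<longleftrightarrow> w = v" "(b, a, w) \<notin> g" using ex1 e ab(3) by blast+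
qed

lemma Gn_total:
  assumes "g \<in> Gn n A" "a \<in> A" "b \<in> A" "a \<noteq> b" shows "\<exists>v. (a, b, v) \<in> g \<or> (b, a, v) \<in> g"
proof -
  have "\<exists>!e. e \<in> g \<and> (\<exists>v. e = (a, b, v) \<or> e = (b, a, v))" using assms by (auto simp: Gn_def)
  then show ?thesis by blast
qed

lemma Gn_trans:
  assumes "g \<in> Gn n A" "(a, b, v) \<in> g" "(b, c, w) \<in> g" shows "\<exists>u. (a, c, u) \<in> g"
proof -
  have "trans {(a, b). \<exists>v. (a, b, v) \<in> g}" using assms(1) by (simp add: Gn_def strict_linear_order_on_def)
  then show ?thesis using assms(2,3) by (auto dest: transD)
qed

lemma finite_Gn_element:
  assumes "finite A" "g \<in> Gn n A" shows "finite g"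
proof (rule finite_subset)
  show "g \<subseteq> A \<times> A \<times> {1..n}" using assms by (auto simp: Gn_def)
qed (use assms in auto)

lemma finite_Gn:
  assumes "finite A" shows "finite (Gn n A)"
proof (rule finite_subset)
  show "Gn n A \<subseteq> Pow (A \<times> A \<times> {1..n})" by (auto simp: Gn_def)
qed (use assms in auto)

lemma Gn_le_refl: "Gn_le g g"
  by (auto simp: Gn_le_def)

lemma Gn_le_trans:
  assumes "Gn_le g h" "Gn_le h k" shows "Gn_le g k"
  unfolding Gn_le_def
proof clarify
  fix a b v assume e: "(a, b, v) \<in> g" and no: "\<not> (\<exists>w. (b, a, w) \<in> k \<and> v < w)"
  consider w where "(a, b, w) \<in> h" "v \<le> w" | w where "(b, a, w) \<in> h" "v < w"
    using assms(1) e unfolding Gn_le_def by blast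
  then show "\<exists>w. (a, b, w) \<in> k \<and> v \<le> w"
  proof cases
    case 1
    then have "(\<exists>u. (a, b, u) \<in> k \<and> w \<le> u) \<or> (\<exists>u. (b, a, u) \<in> k \<and> w < u)"
      using assms(2) unfolding Gn_le_def by blast
    then show ?thesis using 1(2) no by (meson le_trans le_less_trans)
  next
    case 2
    then have "(\<exists>u. (b, a, u) \<in> k \<and> w \<le> u) \<or> (\<exists>u. (a, b, u) \<in> k \<and> w < u)"
      using assms(2) unfolding Gn_le_def by blast
    then show ?thesis using 2(2) no by (meson less_imp_le_nat less_le_trans less_trans)
  qed
qed

text \<open>Going from \<open>g\<close> to \<open>h\<close> and back never lowers the weight of an
  edge, and raises it if the edge is reversed on the way. As \<open>g\<close> has only one edge on
  each pair, nothing can have changed.\<close>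

lemma Gn_le_subset:
  assumes g: "g \<in> Gn n A" and gh: "Gn_le g h" "Gn_le h g" shows "g \<subseteq> h"
proof clarify
  fix a b v assume e: "(a, b, v) \<in> g"
  consider w where "(a, b, w) \<in> h" "v \<le> w" | w where "(b, a, w) \<in> h" "v < w"
    using gh(1) e unfolding Gn_le_def by blast
  then show "(a, b, v) \<in> h"
  proof cases
    case 1
    then have "(\<exists>u. (a, b, u) \<in> g \<and> w \<le> u) \<or> (\<exists>u. (b, a, u) \<in> g \<and> w < u)"
      using gh(2) unfolding Gn_le_def by blast
    then have "w \<le> v" using Gn_unique[OF g e] by auto
    then show ?thesis using 1 by simp
  next
    case 2
    then have "(\<exists>u. (b, a, u) \<in> g \<and> w \<le> u) \<or> (\<exists>u. (a, b, u) \<in> g \<and> w < u)"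
      using gh(2) unfolding Gn_le_def by blast
    then have "w < v" using Gn_unique[OF g e] by auto
    then show ?thesis using 2 by simp
  qed
qed

lemma Gn_le_antisym:
  assumes "g \<in> Gn n A" "h \<in> Gn n A" "Gn_le g h" "Gn_le h g" shows "g = h"
  using Gn_le_subset assms by blast

text \<open>The space \<open>Y\<close> for \<open>contractible_regions\<close>: without injectivity
  and range conditions, the contractions can be composed freely.\<close>

definition Conf_ambient :: "nat \<Rightarrow> 'a set \<Rightarrow> ('a \<Rightarrow> nat \<Rightarrow> real) topology" where
  "Conf_ambient n A = product_topology (\<lambda>_. product_topology (\<lambda>_. euclideanreal) {..<n}) A"

lemma topspace_Conf_ambient: "topspace (Conf_ambient n A) = A \<rightarrow>\<^sub>E ({..<n} \<rightarrow>\<^sub>E UNIV)"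
  by (simp add: Conf_ambient_def)

lemma topspace_Conf:
  "x \<in> topspace (Conf n A) \<longleftrightarrow> x \<in> topspace (Conf_ambient n A) \<and> inj_on x A \<and> (\<forall>a\<in>A. \<forall>i<n. 0 < x a i \<and> x a i < 1)"
  by (auto simp: Conf_def Conf_ambient_def)

lemma continuous_map_Conf_coord:
  assumes "a \<in> A" "i < n" shows "continuous_map (Conf_ambient n A) euclideanreal (\<lambda>x. x a i)"
proof -
  have "continuous_map (Conf_ambient n A) (product_topology (\<lambda>_. euclideanreal) {..<n}) (\<lambda>x. x a)"
    unfolding Conf_ambient_def by (rule continuous_map_product_projection[OF assms(1)])
  moreover have "continuous_map (product_topology (\<lambda>_. euclideanreal) {..<n}) euclideanreal (\<lambda>f. f i)"
    using assms(2) by (intro continuous_map_product_projection) simp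
  ultimately show ?thesis using continuous_map_compose by (fastforce simp: o_def)
qed

lemma Conf_eq_subtopology:
  "Conf n A = subtopology (Conf_ambient n A) {x. inj_on x A \<and> (\<forall>a\<in>A. \<forall>i<n. 0 < x a i \<and> x a i < 1)}"
  by (simp add: Conf_def Conf_ambient_def)

lemma Hausdorff_Conf: "Hausdorff_space (Conf n A)"
  unfolding Conf_eq_subtopology Conf_ambient_def
  by (intro Hausdorff_space_subtopology) (simp add: Hausdorff_space_product_topology)

text \<open>From index \<open>n\<close> on, all coordinates are \<open>undefined\<close>; so
  \<open>psi\<close>, whose index is not bounded, sees only actual coordinates.\<close>

lemma Conf_outside:
  assumes "x \<in> topspace (Conf_ambient n A)" "a \<in> A" "b \<in> A" "x a i \<noteq> x b i" shows "i < n"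
proof (rule ccontr)
  assume "\<not> i < n"
  then have "x a i = undefined" "x b i = undefined"
    using assms by (auto simp: topspace_Conf_ambient PiE_iff extensional_def)
  then show False using assms(4) by simp
qed

lemma Conf_first_difference:
  assumes x: "x \<in> topspace (Conf n A)" and ab: "a \<in> A" "b \<in> A" "a \<noteq> b"
  obtains i where "i < n" "x a i \<noteq> x b i" "\<And>j. j < i \<Longrightarrow> x a j = x b j"
proof -
  have "x a \<noteq> x b" using x ab by (auto simp: topspace_Conf inj_on_def)
  then have ex: "\<exists>i. x a i \<noteq> x b i" by (auto simp: fun_eq_iff)
  define i where "i = (LEAST i. x a i \<noteq> x b i)"
  have "x a i \<noteq> x b i" unfolding i_def using ex by (rule LeastI_ex)
  moreover have "x a j = x b j" if "j < i" for j using not_less_Least[of j] that by (auto simp: i_def)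
  moreover have "i < n" using Conf_outside[of x n A a b i] x ab calculation by (auto simp: topspace_Conf)
  ultimately show ?thesis using that by blast
qed

section \<open>The graph of a configuration and the regions\<close>

lemma psi_iff:
  "(a, b, v) \<in> psi A x \<longleftrightarrow> a \<in> A \<and> b \<in> A \<and> a \<noteq> b \<and>
     (\<exists>i. v = Suc i \<and> (\<forall>j<i. x a j = x b j) \<and> x a i < x b i)"
  by (auto simp: psi_def)

lemma psi_total:
  assumes "x \<in> topspace (Conf n A)" "a \<in> A" "b \<in> A" "a \<noteq> b"
  obtains i where "i < n" "(a, b, Suc i) \<in> psi A x" | i where "i < n" "(b, a, Suc i) \<in> psi A x"
proof -
  obtain i where i: "i < n" "x a i \<noteq> x b i" "\<And>j. j < i \<Longrightarrow> x a j = x b j"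
    using Conf_first_difference[OF assms] by blast
  then have "(a, b, Suc i) \<in> psi A x \<or> (b, a, Suc i) \<in> psi A x"
    using assms by (auto simp: psi_iff)
  then show ?thesis using i(1) that by blast
qed

lemma psi_first:
  assumes "(a, b, Suc i) \<in> psi A x" "x a j \<noteq> x b j" shows "i \<le> j"
  using assms by (auto simp: psi_iff not_less[symmetric])

lemma psi_in_Gn:
  assumes x: "x \<in> topspace (Conf n A)" shows "psi A x \<in> Gn n A"
  unfolding Gn_def
proof (intro CollectI conjI ballI impI)
  show "psi A x \<subseteq> {(a, b, v). a \<in> A \<and> b \<in> A \<and> a \<noteq> b \<and> v \<in> {1..n}}"
  proof clarify
    fix a b v assume e: "(a, b, v) \<in> psi A x"
    then obtain i where i: "a \<in> A" "b \<in> A" "a \<noteq> b" "v = Suc i" "x a i < x b i" by (auto simp: psi_iff)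
    then have "i < n" using Conf_outside[of x n A a b i] x by (auto simp: topspace_Conf)
    then show "a \<in> A \<and> b \<in> A \<and> a \<noteq> b \<and> v \<in> {1..n}" using i by auto
  qed
next
  fix a b assume ab: "a \<in> A" "b \<in> A" "a \<noteq> b"
  have uniq: "v = w" if "(c, d, v) \<in> psi A x" "(c, d, w) \<in> psi A x" for c d v w
  proof -
    from that obtain i j where "v = Suc i" "w = Suc j" "x c i < x d i" "x c j < x d j" by (auto simp: psi_iff)
    then show ?thesis using that psi_first[of c d i A x j] psi_first[of c d j A x i] by auto
  qed
  have anti: False if "(c, d, v) \<in> psi A x" "(d, c, w) \<in> psi A x" for c d v w
  proof -
    from that obtain i j where "v = Suc i" "w = Suc j" "x c i < x d i" "x d j < x c j" by (auto simp: psi_iff)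
    then show ?thesis using that psi_first[of c d i A x j] psi_first[of d c j A x i] by auto
  qed
  from psi_total[OF x ab] show "\<exists>!e. e \<in> psi A x \<and> (\<exists>v. e = (a, b, v) \<or> e = (b, a, v))"
  proof cases
    case (1 i)
    show ?thesis by (rule ex1I[of _ "(a, b, Suc i)"]) (use 1 uniq anti in blast)+
  next
    case (2 i)
    show ?thesis by (rule ex1I[of _ "(b, a, Suc i)"]) (use 2 uniq anti in blast)+
  qed
next
  show "strict_linear_order_on A {(a, b). \<exists>v. (a, b, v) \<in> psi A x}"
    unfolding strict_linear_order_on_def
  proof (intro conjI)
    show "trans {(a, b). \<exists>v. (a, b, v) \<in> psi A x}"
    proof (rule transI, clarify)
      fix a b c v w assume e: "(a, b, v) \<in> psi A x" "(b, c, w) \<in> psi A x"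
      from e obtain i j where i: "\<And>k. k < i \<Longrightarrow> x a k = x b k" "x a i < x b i" "a \<in> A" "b \<in> A"
        and j: "\<And>k. k < j \<Longrightarrow> x b k = x c k" "x b j < x c j" "c \<in> A" by (auto simp: psi_iff)
      \<comment> \<open>The earlier of the two first differences is the first difference of
        \<open>a\<close> and \<open>c\<close>.\<close>
      have lt: "x a (min i j) < x c (min i j)"
        using i(1)[of j] i(2) j(1)[of i] j(2) by (cases i j rule: linorder_cases) (auto simp: min_def)
      moreover have "x a k = x c k" if "k < min i j" for k using i(1)[of k] j(1)[of k] that by simp
      moreover have "a \<noteq> c" using lt by auto
      ultimately show "\<exists>v. (a, c, v) \<in> psi A x" using i j unfolding psi_iff by blast
    qed
    show "irrefl {(a, b). \<exists>v. (a, b, v) \<in> psi A x}" by (auto simp: irrefl_def psi_iff)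
    show "total_on A {(a, b). \<exists>v. (a, b, v) \<in> psi A x}"
      unfolding total_on_def using psi_total[OF x] by (smt (verit, best) case_prodI mem_Collect_eq)
  qed
qed

text \<open>A description of the region of \<open>p\<close> by open conditions on coordinates, which
  makes sense before \<open>x\<close> is known to be injective. Weights count from 1 and coordinates
  from 0, so weight \<open>v\<close> belongs to coordinate \<open>v - 1\<close>.\<close>

definition admissible :: "'a wgraph \<Rightarrow> ('a \<Rightarrow> nat \<Rightarrow> real) \<Rightarrow> bool" where
  "admissible p x \<longleftrightarrow> (\<forall>(a, b, v)\<in>p. (\<exists>j. Suc j < v \<and> x a j \<noteq> x b j) \<or> x a (v - 1) < x b (v - 1))"

text \<open>Compared with an edge of \<open>p\<close> of weight \<open>v\<close>, the edge of
  \<open>psi A x\<close> on the same pair must have smaller weight, or weight \<open>v\<close> and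
  the same direction. Its weight marks the first coordinate in which the two points differ.\<close>

lemma Gn_le_psi_iff:
  assumes x: "x \<in> topspace (Conf n A)" and p: "p \<in> Gn n A"
  shows "Gn_le (psi A x) p \<longleftrightarrow> admissible p x"
proof
  assume le: "Gn_le (psi A x) p"
  show "admissible p x"
    unfolding admissible_def
  proof clarify
    fix a b v assume e: "(a, b, v) \<in> p" and nlt: "\<not> x a (v - 1) < x b (v - 1)"
    note ab = Gn_edge[OF p e]
    from psi_total[OF x ab(1-3)] show "\<exists>j. Suc j < v \<and> x a j \<noteq> x b j"
    proof cases
      case (1 i)
      then have "(\<exists>w. (a, b, w) \<in> p \<and> Suc i \<le> w) \<or> (\<exists>w. (b, a, w) \<in> p \<and> Suc i < w)"
        using le unfolding Gn_le_def by blast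
      then have "Suc i \<le> v" using Gn_unique[OF p e] by auto
      moreover have "x a i < x b i" using 1 by (auto simp: psi_iff)
      moreover from this have "Suc i \<noteq> v" using nlt by auto
      ultimately show ?thesis by (intro exI[of _ i]) auto
    next
      case (2 i)
      then have "(\<exists>w. (b, a, w) \<in> p \<and> Suc i \<le> w) \<or> (\<exists>w. (a, b, w) \<in> p \<and> Suc i < w)"
        using le unfolding Gn_le_def by blast
      then have "Suc i < v" using Gn_unique[OF p e] by auto
      moreover have "x b i < x a i" using 2 by (auto simp: psi_iff)
      ultimately show ?thesis by (intro exI[of _ i]) auto
    qed
  qed
next
  assume adm: "admissible p x"
  show "Gn_le (psi A x) p"
    unfolding Gn_le_def
  proof clarify
    fix a b v assume e: "(a, b, v) \<in> psi A x" and no: "\<not> (\<exists>w. (b, a, w) \<in> p \<and> v < w)"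
    obtain i where i: "v = Suc i" "a \<in> A" "b \<in> A" "a \<noteq> b" "x a i < x b i" using e by (auto simp: psi_iff)
    obtain w where "(a, b, w) \<in> p \<or> (b, a, w) \<in> p" using Gn_total[OF p i(2-4)] by blast
    then show "\<exists>w. (a, b, w) \<in> p \<and> v \<le> w"
    proof
      assume w: "(a, b, w) \<in> p"
      then have "(\<exists>j. Suc j < w \<and> x a j \<noteq> x b j) \<or> x a (w - 1) < x b (w - 1)" using adm by (auto simp: admissible_def)
      then have "Suc i \<le> w"
      proof
        assume "\<exists>j. Suc j < w \<and> x a j \<noteq> x b j"
        then show ?thesis using psi_first[of a b i A x] e i(1) by fastforce
      next
        assume "x a (w - 1) < x b (w - 1)"
        then have "i \<le> w - 1" using psi_first[of a b i A x "w - 1"] e i(1) by auto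
        then show ?thesis using Gn_edge(4)[OF p w] by linarith
      qed
      then show ?thesis using w i by auto
    next
      assume w: "(b, a, w) \<in> p"
      then have "(\<exists>j. Suc j < w \<and> x b j \<noteq> x a j) \<or> x b (w - 1) < x a (w - 1)" using adm by (auto simp: admissible_def)
      then have "Suc i < w"
      proof
        assume "\<exists>j. Suc j < w \<and> x b j \<noteq> x a j"
        then obtain j where "Suc j < w" "x a j \<noteq> x b j" by metis
        then show ?thesis using psi_first[of a b i A x j] e i(1) by auto
      next
        assume lt: "x b (w - 1) < x a (w - 1)"
        then have "i \<le> w - 1" using psi_first[of a b i A x "w - 1"] e i(1) by auto
        moreover have "i \<noteq> w - 1" using lt i(5) by auto
        ultimately show ?thesis by linarith
      qed
      then show ?thesis using w i no by blast
    qed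
  qed
qed

lemma openin_Conf_region:
  assumes A: "finite A" and p: "p \<in> Gn n A"
  shows "openin (Conf n A) {x \<in> topspace (Conf n A). Gn_le (psi A x) p}"
proof -
  let ?X = "Conf n A"
  have coord: "continuous_map ?X euclideanreal (\<lambda>x. x a i)" if "a \<in> A" "i < n" for a i
    unfolding Conf_eq_subtopology by (intro continuous_map_from_subtopology continuous_map_Conf_coord that)
  have diff: "continuous_map ?X euclideanreal (\<lambda>x. x a i - x b i)" if "a \<in> A" "b \<in> A" "i < n" for a b i
    by (intro continuous_map_diff coord that)
  define O' where "O' = (\<lambda>(a, b, v). (\<Union>j\<in>{j. Suc j < v}. {x \<in> topspace ?X. x a j - x b j \<in> - {0}}) \<union>
      {x \<in> topspace ?X. x a (v - 1) - x b (v - 1) \<in> {..<0}})"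
  have op: "openin ?X (O' e)" if e: "e \<in> p" for e
  proof -
    obtain a b v where abv: "e = (a, b, v)" by (cases e)
    note ab = Gn_edge[OF p e[unfolded abv]]
    have "openin ?X {x \<in> topspace ?X. x a j - x b j \<in> - {0}}" if "Suc j < v" for j
      using that ab by (intro openin_continuous_map_preimage[OF diff]) auto
    moreover have "openin ?X {x \<in> topspace ?X. x a (v - 1) - x b (v - 1) \<in> {..<0}}"
      using ab by (intro openin_continuous_map_preimage[OF diff]) auto
    ultimately show ?thesis unfolding O'_def abv by (auto intro!: openin_Un openin_Union)
  qed
  have "openin ?X (topspace ?X \<inter> \<Inter>(O' ` p))"
  proof (cases "p = {}")
    case False
    have "openin ?X (\<Inter>(O' ` p))"
      using finite_Gn_element[OF A p] False op by (intro openin_Inter) auto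
    then show ?thesis by (intro openin_Int openin_topspace)
  qed simp
  moreover have "{x \<in> topspace ?X. Gn_le (psi A x) p} = topspace ?X \<inter> \<Inter>(O' ` p)"
    using Gn_le_psi_iff[OF _ p] by (force simp: admissible_def O'_def)
  ultimately show ?thesis by simp
qed

text \<open>The rank of \<open>a\<close> in the linear order of \<open>p\<close>, rescaled; the
  summands 1 and 2 keep it strictly between 0 and 1.\<close>

definition pos :: "'a set \<Rightarrow> 'a wgraph \<Rightarrow> 'a \<Rightarrow> real" where
  "pos A p a = (1 + real (card {b\<in>A. \<exists>v. (b, a, v) \<in> p})) / (2 + real (card A))"

lemma pos_range: 
  assumes "finite A" shows "0 < pos A p a \<and> pos A p a < 1"
proof -
  have "card {b\<in>A. \<exists>v. (b, a, v) \<in> p} \<le> card A" using assms by (intro card_mono) auto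
  then show ?thesis by (auto simp: pos_def)
qed

lemma pos_less:
  assumes A: "finite A" and p: "p \<in> Gn n A" and e: "(a, b, v) \<in> p" shows "pos A p a < pos A p b"
proof -
  have "{c\<in>A. \<exists>v. (c, a, v) \<in> p} \<subset> {c\<in>A. \<exists>v. (c, b, v) \<in> p}"
  proof (intro psubsetI subsetI)
    show "c \<in> {c\<in>A. \<exists>v. (c, b, v) \<in> p}" if "c \<in> {c\<in>A. \<exists>v. (c, a, v) \<in> p}" for c
      using that Gn_trans[OF p _ e] by blast
    have "a \<notin> {c\<in>A. \<exists>v. (c, a, v) \<in> p}" using Gn_edge(3)[OF p] by blast
    moreover have "a \<in> {c\<in>A. \<exists>v. (c, b, v) \<in> p}" using Gn_edge(1)[OF p e] e by blast
    ultimately show "{c\<in>A. \<exists>v. (c, a, v) \<in> p} \<noteq> {c\<in>A. \<exists>v. (c, b, v) \<in> p}" by blast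
  qed
  then have "card {c\<in>A. \<exists>v. (c, a, v) \<in> p} < card {c\<in>A. \<exists>v. (c, b, v) \<in> p}"
    using A by (intro psubset_card_mono) auto
  then show ?thesis by (simp add: pos_def divide_strict_right_mono)
qed

text \<open>The coordinates are moved one after the other, starting with the last one: while coordinate \<open>i\<close>
  moves, all edges whose weight exceeds \<open>i + 1\<close> are already ordered correctly by the coordinate of their weight.\<close>

definition clock :: "nat \<Rightarrow> nat \<Rightarrow> real \<Rightarrow> real" where
  "clock n i s = min 1 (max 0 (real n * s - (real n - 1 - real i)))"

definition straighten :: "nat \<Rightarrow> 'a set \<Rightarrow> 'a wgraph \<Rightarrow> real \<Rightarrow> ('a \<Rightarrow> nat \<Rightarrow> real) \<Rightarrow> 'a \<Rightarrow> nat \<Rightarrow> real" where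
  "straighten n A p s x = (\<lambda>a\<in>A. \<lambda>i\<in>{..<n}. (1 - clock n i s) * x a i + clock n i s * pos A p a)"

definition straight :: "nat \<Rightarrow> 'a set \<Rightarrow> 'a wgraph \<Rightarrow> 'a \<Rightarrow> nat \<Rightarrow> real" where
  "straight n A p = (\<lambda>a\<in>A. \<lambda>i\<in>{..<n}. pos A p a)"

lemma clock_range: "0 \<le> clock n i s \<and> clock n i s \<le> 1"
  by (simp add: clock_def)

lemma clock_0: "i < n \<Longrightarrow> clock n i 0 = 0"
  by (simp add: clock_def)

lemma clock_1: "clock n i 1 = 1"
  by (simp add: clock_def)

text \<open>Coordinate \<open>i\<close> moves while \<open>n * s\<close> runs from
  \<open>n - 1 - i\<close> to \<open>n - i\<close>; for \<open>j < i\<close> this is over when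
  coordinate \<open>j\<close> starts.\<close>

lemma clock_order:
  assumes "clock n j s \<noteq> 0" "j < i" shows "clock n i s = 1"
proof -
  have "real n * s - (real n - 1 - real j) > 0" using assms(1) by (auto simp: clock_def max_def split: if_splits)
  then have "1 \<le> real n * s - (real n - 1 - real i)" using assms(2) by linarith
  then show ?thesis by (simp add: clock_def)
qed

lemma straighten_0:
  assumes "x \<in> topspace (Conf_ambient n A)" shows "straighten n A p 0 x = x"
proof -
  have "straighten n A p 0 x a i = x a i" for a i
    using assms by (auto simp: straighten_def clock_0 topspace_Conf_ambient PiE_iff extensional_def)
  then show ?thesis by (simp add: fun_eq_iff)
qed

lemma straighten_1: "straighten n A p 1 x = straight n A p"
  by (simp add: straighten_def straight_def clock_1)

lemma in_ambient:
  "straighten n A p s x \<in> topspace (Conf_ambient n A)" "straight n A p \<in> topspace (Conf_ambient n A)"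
  by (auto simp: straighten_def straight_def topspace_Conf_ambient)

lemma continuous_map_straighten:
  "continuous_map (prod_topology (top_of_set {0..1}) (Conf_ambient n A)) (Conf_ambient n A)
     (\<lambda>(s, x). straighten n A p s x)"
proof -
  let ?Z = "prod_topology (top_of_set {0..1::real}) (Conf_ambient n A)"
  have "continuous_map ?Z euclideanreal fst"
    using continuous_map_fst continuous_map_in_subtopology by blast
  moreover have "continuous_map euclideanreal euclideanreal (clock n i)" for i
    unfolding clock_def by (simp add: continuous_intros)
  ultimately have c: "continuous_map ?Z euclideanreal (\<lambda>z. clock n i (fst z))" for i
    using continuous_map_compose[of ?Z euclideanreal fst euclideanreal "clock n i" for i] by (simp add: o_def)
  have x: "continuous_map ?Z euclideanreal (\<lambda>z. snd z a i)" if "a \<in> A" "i < n" for a i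
    using continuous_map_compose[OF continuous_map_snd continuous_map_Conf_coord[OF that]] by (simp add: o_def)
  have coord: "continuous_map ?Z euclideanreal (\<lambda>z. (1 - clock n i (fst z)) * snd z a i + clock n i (fst z) * pos A p a)"
    if "a \<in> A" "i < n" for a i
    by (intro continuous_map_add continuous_map_real_mult continuous_map_diff c x that) auto
  have "continuous_map ?Z (product_topology (\<lambda>_. euclideanreal) {..<n}) (\<lambda>z. straighten n A p (fst z) (snd z) a)"
    if "a \<in> A" for a
    unfolding continuous_map_componentwise using coord[OF that] that by (auto simp: straighten_def)
  then show ?thesis
    unfolding case_prod_unfold Conf_ambient_def[of n A] continuous_map_componentwise
    by (auto simp: straighten_def Conf_ambient_def)
qed

text \<open>Either alternative in \<open>admissible\<close> separates the ends of an edge, and every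
  pair of points is joined by an edge of \<open>p\<close>.\<close>

lemma admissible_in_Conf:
  assumes p: "p \<in> Gn n A" and z: "z \<in> topspace (Conf_ambient n A)"
    "\<And>a i. a \<in> A \<Longrightarrow> i < n \<Longrightarrow> 0 < z a i \<and> z a i < 1" and adm: "admissible p z"
  shows "z \<in> topspace (Conf n A)"
proof -
  have "z a \<noteq> z b" if "(a, b, v) \<in> p" for a b v
    using adm that by (auto simp: admissible_def)
  then have "z a \<noteq> z b" if "a \<in> A" "b \<in> A" "a \<noteq> b" for a b
    using Gn_total[OF p that] by metis
  then have "inj_on z A" unfolding inj_on_def by blast
  then show ?thesis using z by (auto simp: topspace_Conf)
qed

lemma straight_region:
  assumes A: "finite A" and p: "p \<in> Gn n A"
  shows "straight n A p \<in> topspace (Conf n A) \<and> Gn_le (psi A (straight n A p)) p"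
proof -
  have adm: "admissible p (straight n A p)"
    unfolding admissible_def
  proof clarify
    fix a b v assume e: "(a, b, v) \<in> p" and "\<not> straight n A p a (v - 1) < straight n A p b (v - 1)"
    moreover have "v - 1 < n" using Gn_edge(4,5)[OF p e] by linarith
    ultimately show "\<exists>j. Suc j < v \<and> straight n A p a j \<noteq> straight n A p b j"
      using pos_less[OF A p e] Gn_edge(1,2)[OF p e] by (simp add: straight_def)
  qed
  have "straight n A p \<in> topspace (Conf n A)"
    by (rule admissible_in_Conf[OF p in_ambient(2) _ adm]) (use pos_range[OF A] in \<open>auto simp: straight_def\<close>)
  then show ?thesis using Gn_le_psi_iff[OF _ p] adm by blast
qed

text \<open>Take an edge of weight \<open>v\<close>. If coordinate \<open>v - 1\<close> of
  \<open>x\<close> orders its ends correctly, so does each mixture with the positions, which are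
  ordered in the same way. Otherwise an earlier coordinate \<open>j\<close> of \<open>x\<close>
  separates the ends: either it has not yet moved, or coordinate \<open>v - 1\<close> has already
  arrived at the positions.\<close>

lemma straighten_region:
  assumes A: "finite A" and p: "p \<in> Gn n A" and x: "x \<in> topspace (Conf n A)" and le: "Gn_le (psi A x) p"
  shows "straighten n A p s x \<in> topspace (Conf n A) \<and> Gn_le (psi A (straighten n A p s x)) p"
proof -
  let ?z = "straighten n A p s x"
  have z: "?z a i = (1 - clock n i s) * x a i + clock n i s * pos A p a" if "a \<in> A" "i < n" for a i
    using that by (simp add: straighten_def)
  have x_adm: "admissible p x" using Gn_le_psi_iff[OF x p] le by blast
  have adm: "admissible p ?z"
    unfolding admissible_def
  proof clarify
    fix a b v assume e: "(a, b, v) \<in> p" and nlt: "\<not> ?z a (v - 1) < ?z b (v - 1)"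
    note ab = Gn_edge[OF p e]
    have i: "v - 1 < n" using ab by auto
    have pl: "pos A p a < pos A p b" using pos_less[OF A p e] .
    have "\<not> x a (v - 1) < x b (v - 1)"
    proof
      assume lt: "x a (v - 1) < x b (v - 1)"
      have "?z a (v - 1) < ?z b (v - 1)"
      proof (cases "clock n (v - 1) s = 0")
        case True then show ?thesis using lt z ab i by simp
      next
        case False
        then have "clock n (v - 1) s * pos A p a < clock n (v - 1) s * pos A p b"
          using clock_range[of n "v - 1" s] pl by (intro mult_strict_left_mono) auto
        moreover have "(1 - clock n (v - 1) s) * x a (v - 1) \<le> (1 - clock n (v - 1) s) * x b (v - 1)"
          using clock_range[of n "v - 1" s] lt by (intro mult_left_mono) auto
        ultimately show ?thesis using z ab i by simp
      qed
      then show False using nlt by simp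
    qed
    then obtain j where j: "Suc j < v" "x a j \<noteq> x b j" using x_adm e by (auto simp: admissible_def)
    have "clock n j s = 0"
    proof (rule ccontr)
      assume "clock n j s \<noteq> 0"
      then have "clock n (v - 1) s = 1" using j(1) by (intro clock_order) auto
      then show False using nlt z[OF ab(1) i] z[OF ab(2) i] pl by simp
    qed
    then have "?z a j = x a j" "?z b j = x b j" using z ab j(1) by simp_all
    then show "\<exists>j. Suc j < v \<and> ?z a j \<noteq> ?z b j" using j by auto
  qed
  have "0 < ?z a i \<and> ?z a i < 1" if "a \<in> A" "i < n" for a i
  proof -
    have xr: "0 < x a i" "x a i < 1" using x that by (auto simp: topspace_Conf)
    have pr: "0 < pos A p a" "pos A p a < 1" using pos_range[OF A] by auto
    have "?z a i \<in> {0<..<1}"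
      unfolding z[OF that]
      using convexD_alt[OF convex_real_interval(8)[of 0 1], of "x a i" "pos A p a" "clock n i s"] xr pr clock_range
      by simp
    then show ?thesis by simp
  qed
  then have "?z \<in> topspace (Conf n A)" by (intro admissible_in_Conf[OF p in_ambient(1) _ adm])
  then show ?thesis using Gn_le_psi_iff[OF _ p] adm by blast
qed

section \<open>The action of the symmetric group\<close>

lemma conf_act_in_Conf:
  assumes \<sigma>: "bij_betw \<sigma> A A" and x: "x \<in> topspace (Conf n A)" shows "conf_act A \<sigma> x \<in> topspace (Conf n A)"
proof -
  have inv: "bij_betw (inv_into A \<sigma>) A A" using bij_betw_inv_into[OF \<sigma>] .
  then have invA: "inv_into A \<sigma> a \<in> A" if "a \<in> A" for a using that bij_betwE by blast
  have "inj_on (x \<circ> inv_into A \<sigma>) A"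
    using x inv by (intro comp_inj_on) (auto simp: topspace_Conf bij_betw_def)
  then have "inj_on (conf_act A \<sigma> x) A" by (simp add: conf_act_def inj_on_def)
  then show ?thesis
    using x invA by (auto simp: topspace_Conf topspace_Conf_ambient conf_act_def PiE_iff)
qed

lemma psi_conf_act:
  assumes \<sigma>: "bij_betw \<sigma> A A" shows "psi A (conf_act A \<sigma> x) = graph_act \<sigma> (psi A x)"
proof -
  have inv: "inv_into A \<sigma> (\<sigma> a) = a" if "a \<in> A" for a using bij_betw_inv_into_left[OF \<sigma> that] .
  have inA: "\<sigma> a \<in> A" if "a \<in> A" for a using \<sigma> that bij_betwE by blast
  have eq: "conf_act A \<sigma> x (\<sigma> a) = x a" if "a \<in> A" for a using inv inA that by (simp add: conf_act_def)
  have inj: "\<sigma> a \<noteq> \<sigma> b" if "a \<in> A" "b \<in> A" "a \<noteq> b" for a b using \<sigma> that by (auto simp: bij_betw_def inj_on_def)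
  show ?thesis
  proof (intro equalityI subsetI)
    fix e assume "e \<in> psi A (conf_act A \<sigma> x)"
    moreover obtain a' b' v where e: "e = (a', b', v)" by (cases e)
    ultimately have e': "(a', b', v) \<in> psi A (conf_act A \<sigma> x)" by simp
    then have "a' \<in> A" "b' \<in> A" by (auto simp: psi_iff)
    then have "a' \<in> \<sigma> ` A" "b' \<in> \<sigma> ` A" using \<sigma> by (simp_all add: bij_betw_def)
    then obtain a b where ab: "a \<in> A" "b \<in> A" "a' = \<sigma> a" "b' = \<sigma> b" by blast
    then have "(a, b, v) \<in> psi A x" using e' eq by (auto simp: psi_iff)
    then show "e \<in> graph_act \<sigma> (psi A x)" using ab e by (auto simp: graph_act_def)
  next
    fix e assume "e \<in> graph_act \<sigma> (psi A x)"
    then obtain a b v where e: "e = (\<sigma> a, \<sigma> b, v)" "(a, b, v) \<in> psi A x" by (auto simp: graph_act_def)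
    then show "e \<in> psi A (conf_act A \<sigma> x)" using eq inA inj unfolding e(1) psi_iff by auto
  qed
qed

lemma graph_act_in_Gn:
  assumes \<sigma>: "bij_betw \<sigma> A A" and g: "g \<in> Gn n A" shows "graph_act \<sigma> g \<in> Gn n A"
proof -
  have inA: "\<sigma> a \<in> A" if "a \<in> A" for a using \<sigma> that bij_betwE by blast
  have inj: "\<sigma> a = \<sigma> b \<longleftrightarrow> a = b" if "a \<in> A" "b \<in> A" for a b using \<sigma> that by (auto simp: bij_betw_def inj_on_def)
  have sur: "\<exists>a\<in>A. a' = \<sigma> a" if "a' \<in> A" for a' using \<sigma> that by (auto simp: bij_betw_def)
  have mem: "(\<sigma> a, \<sigma> b, v) \<in> graph_act \<sigma> g \<longleftrightarrow> (a, b, v) \<in> g" if "a \<in> A" "b \<in> A" for a b v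
  proof
    assume "(\<sigma> a, \<sigma> b, v) \<in> graph_act \<sigma> g"
    then obtain c d where "\<sigma> a = \<sigma> c" "\<sigma> b = \<sigma> d" "(c, d, v) \<in> g" by (auto simp: graph_act_def)
    then show "(a, b, v) \<in> g" using inj[OF that(1), of c] inj[OF that(2), of d] Gn_edge[OF g, of c d v] by simp
  qed (auto simp: graph_act_def)
  have sub: "graph_act \<sigma> g \<subseteq> {(a, b, v). a \<in> A \<and> b \<in> A \<and> a \<noteq> b \<and> v \<in> {1..n}}"
  proof clarify
    fix a' b' v assume "(a', b', v) \<in> graph_act \<sigma> g"
    then obtain a b where "a' = \<sigma> a" "b' = \<sigma> b" "(a, b, v) \<in> g" by (auto simp: graph_act_def)
    then show "a' \<in> A \<and> b' \<in> A \<and> a' \<noteq> b' \<and> v \<in> {1..n}" using Gn_edge[OF g, of a b v] inA inj by auto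
  qed
  have ex1: "\<exists>!e. e \<in> graph_act \<sigma> g \<and> (\<exists>v. e = (a', b', v) \<or> e = (b', a', v))"
    if ab': "a' \<in> A" "b' \<in> A" "a' \<noteq> b'" for a' b'
  proof -
    obtain a b where ab: "a \<in> A" "b \<in> A" "a' = \<sigma> a" "b' = \<sigma> b" by (metis sur ab'(1,2))
    then have "a \<noteq> b" using ab'(3) by auto
    from Gn_total[OF g ab(1,2) this] obtain v where "(a, b, v) \<in> g \<or> (b, a, v) \<in> g" by blast
    then show ?thesis
    proof
      assume e: "(a, b, v) \<in> g"
      show ?thesis
      proof (rule ex1I[of _ "(a', b', v)"])
        show "(a', b', v) \<in> graph_act \<sigma> g \<and> (\<exists>w. (a', b', v) = (a', b', w) \<or> (a', b', v) = (b', a', w))"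
          using mem e ab by auto
        fix d assume "d \<in> graph_act \<sigma> g \<and> (\<exists>v. d = (a', b', v) \<or> d = (b', a', v))"
        then show "d = (a', b', v)" using mem ab Gn_unique[OF g e] by auto
      qed
    next
      assume e: "(b, a, v) \<in> g"
      show ?thesis
      proof (rule ex1I[of _ "(b', a', v)"])
        show "(b', a', v) \<in> graph_act \<sigma> g \<and> (\<exists>w. (b', a', v) = (a', b', w) \<or> (b', a', v) = (b', a', w))"
          using mem e ab by auto
        fix d assume "d \<in> graph_act \<sigma> g \<and> (\<exists>v. d = (a', b', v) \<or> d = (b', a', v))"
        then show "d = (b', a', v)" using mem ab Gn_unique[OF g e] by auto
      qed
    qed
  qed
  have tr: "trans {(a, b). \<exists>v. (a, b, v) \<in> graph_act \<sigma> g}"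
  proof (rule transI, clarify)
    fix a' b' c' v w assume e: "(a', b', v) \<in> graph_act \<sigma> g" "(b', c', w) \<in> graph_act \<sigma> g"
    then have A': "a' \<in> A" "b' \<in> A" "c' \<in> A" using sub by auto
    obtain a where a: "a \<in> A" "a' = \<sigma> a" using sur[OF A'(1)] by blast
    obtain b where b: "b \<in> A" "b' = \<sigma> b" using sur[OF A'(2)] by blast
    obtain c where c: "c \<in> A" "c' = \<sigma> c" using sur[OF A'(3)] by blast
    note abc = a(1) b(1) c(1) a(2) b(2) c(2)
    then have "(a, b, v) \<in> g" "(b, c, w) \<in> g" using e mem by auto
    from Gn_trans[OF g this] show "\<exists>v. (a', c', v) \<in> graph_act \<sigma> g" using mem abc by auto
  qed
  have irr: "irrefl {(a, b). \<exists>v. (a, b, v) \<in> graph_act \<sigma> g}" using sub by (auto simp: irrefl_def)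
  have tot: "total_on A {(a, b). \<exists>v. (a, b, v) \<in> graph_act \<sigma> g}"
  proof (unfold total_on_def, intro ballI impI)
    fix a b assume ab: "a \<in> A" "b \<in> A" "a \<noteq> b"
    from ex1[OF this] show "(a, b) \<in> {(a, b). \<exists>v. (a, b, v) \<in> graph_act \<sigma> g} \<or>
        (b, a) \<in> {(a, b). \<exists>v. (a, b, v) \<in> graph_act \<sigma> g}" by blast
  qed
  show ?thesis
    unfolding Gn_def strict_linear_order_on_def
  proof (intro CollectI conjI ballI impI)
    show "graph_act \<sigma> g \<subseteq> {(a, b, v). a \<in> A \<and> b \<in> A \<and> a \<noteq> b \<and> v \<in> {1..n}}" by (fact sub)
    show "\<exists>!e. e \<in> graph_act \<sigma> g \<and> (\<exists>v. e = (a, b, v) \<or> e = (b, a, v))" if "a \<in> A" "b \<in> A" "a \<noteq> b" for a b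
      by (rule ex1[OF that])
  qed (fact tr irr tot)+
qed

lemma graph_act_mono: "Gn_le g h \<Longrightarrow> Gn_le (graph_act \<sigma> g) (graph_act \<sigma> h)"
  unfolding Gn_le_def graph_act_def by fastforce

section \<open>The two projections\<close>

text \<open>For \<open>XP_pi\<close>, which chooses a representative: its expression in coordinates
  is proved at points of the realisation.\<close>

lemma relative_lifting_cong:
  assumes "relative_lifting E B f" and fg: "\<And>x. x \<in> topspace E \<Longrightarrow> f x = g x"
  shows "relative_lifting E B g"
  unfolding relative_lifting_def
proof (intro allI impI, elim conjE)
  fix S :: "((nat \<Rightarrow> real) \<times> real) set" and v \<zeta> u
  assume S: "compact S" "continuous_map (top_of_set S) B v" "continuous_on S \<zeta>" "\<zeta> ` S \<subseteq> {0..1::real}"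
    and u: "continuous_map (top_of_set {k\<in>S. \<zeta> k < 1}) E u" and uv: "\<forall>k\<in>S. \<zeta> k < 1 \<longrightarrow> g (u k) = v k"
  have "u k \<in> topspace E" if "k \<in> S" "\<zeta> k < 1" for k using u that by (auto simp: continuous_map_def)
  then have "\<forall>k\<in>S. \<zeta> k < 1 \<longrightarrow> f (u k) = v k" using uv fg by simp
  then obtain h H where h: "continuous_map (top_of_set S) E h" "\<forall>k\<in>S. \<zeta> k = 0 \<longrightarrow> h k = u k"
    and H: "continuous_map (top_of_set ({0..1::real} \<times> S)) B H"
      "\<forall>k\<in>S. H (0, k) = f (h k) \<and> H (1, k) = v k" "\<forall>k\<in>S. \<forall>t\<in>{0..1}. \<zeta> k = 0 \<longrightarrow> H (t, k) = v k"
    using assms(1)[unfolded relative_lifting_def, rule_format, of S v \<zeta> u] S u by blast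
  have "h k \<in> topspace E" if "k \<in> S" for k using h(1) that by (auto simp: continuous_map_def)
  then have "\<forall>k\<in>S. H (0, k) = g (h k) \<and> H (1, k) = v k" using H(2) fg by simp
  then show "\<exists>h H. continuous_map (top_of_set S) E h \<and> (\<forall>k\<in>S. \<zeta> k = 0 \<longrightarrow> h k = u k) \<and>
      continuous_map (top_of_set ({0..1::real} \<times> S)) B H \<and>
      (\<forall>k\<in>S. H (0, k) = g (h k) \<and> H (1, k) = v k) \<and>
      (\<forall>k\<in>S. \<forall>t\<in>{0..1}. \<zeta> k = 0 \<longrightarrow> H (t, k) = v k)"
    using h H by blast
qed

text \<open>Applied to the projection onto \<open>P\<close> and to the group actions on both
  realisations: \<open>F\<close> acts by \<open>f\<close> on base points and by
  \<open>\<gamma>\<close> on labels.\<close>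

locale realization_morphism =
  src: topological_poset_over X P le R T lq \<xi> \<rho> mk +
  tgt: topological_poset_over X' P' le' R' T' lq' \<xi>' \<rho>' mk'
  for X :: "'x topology" and P :: "'p set" and le R and T :: "'c topology" and lq \<xi> \<rho> mk
    and X' :: "'y topology" and P' :: "'q set" and le' R' and T' :: "'d topology" and lq' \<xi>' \<rho>' mk' +
  fixes F :: "'c \<Rightarrow> 'd" and f :: "'x \<Rightarrow> 'y" and \<gamma> :: "'p \<Rightarrow> 'q"
  assumes F_in: "c \<in> topspace T \<Longrightarrow> F c \<in> topspace T'"
    and F_coords: "c \<in> topspace T \<Longrightarrow> \<xi>' (F c) = f (\<xi> c) \<and> \<rho>' (F c) = \<gamma> (\<rho> c)"
    and \<gamma>_mono: "\<lbrakk>p \<in> P; q \<in> P; le p q\<rbrakk> \<Longrightarrow> le' (\<gamma> p) (\<gamma> q)"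
begin

definition pushforward :: "('p \<Rightarrow> real) \<Rightarrow> 'q \<Rightarrow> real" where
  "pushforward w q = sum w {p\<in>P. \<gamma> p = q}"

lemma map_simplex:
  assumes e: "(m, t, c) \<in> topspace (simplex_sum T lq)"
  defines "e' \<equiv> (m, t, restrict (F \<circ> c) {..m})"
  shows "e' \<in> topspace (simplex_sum T' lq')" "tgt.pcoord e' = f (src.pcoord (m, t, c))"
    "tgt.wcoord e' = pushforward (src.wcoord (m, t, c))"
proof -
  have cN: "c \<in> topspace (nerve T lq m)" and t: "t \<in> standard_simplex m"
    and cT: "\<And>i. i \<le> m \<Longrightarrow> c i \<in> topspace T"
    using e by (auto simp: src.topspace_simplex_sum_iff src.topspace_nerve_iff PiE_iff)
  have "restrict (F \<circ> c) {..m} \<in> topspace (nerve T' lq' m)"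
  proof (rule tgt.nerveI)
    show "restrict (F \<circ> c) {..m} \<in> {..m} \<rightarrow>\<^sub>E topspace T'" using cT F_in by auto
    fix i j :: nat assume ij: "i \<le> j" "j \<le> m"
    then have "i \<le> m" by simp
    have "\<rho> (c i) \<in> P" "\<rho> (c j) \<in> P" using src.T_coords cT ij \<open>i \<le> m\<close> by blast+
    then show "\<xi>' (restrict (F \<circ> c) {..m} i) = \<xi>' (restrict (F \<circ> c) {..m} j) \<and>
        le' (\<rho>' (restrict (F \<circ> c) {..m} i)) (\<rho>' (restrict (F \<circ> c) {..m} j))"
      using src.nerve_mono[OF cN ij] F_coords[OF cT] \<gamma>_mono ij \<open>i \<le> m\<close> by simp
  qed
  then show "e' \<in> topspace (simplex_sum T' lq')"
    using t unfolding e'_def tgt.topspace_simplex_sum_iff tgt.topspace_nerve_iff by blast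
  show "tgt.pcoord e' = f (src.pcoord (m, t, c))"
    using F_coords[OF cT[of 0]] by (simp add: e'_def tgt.pcoord_def src.pcoord_def)
  show "tgt.wcoord e' = pushforward (src.wcoord (m, t, c))"
  proof
    fix q
    let ?S = "{i. i \<le> m \<and> \<gamma> (\<rho> (c i)) = q}"
    have "{i. i \<le> m \<and> \<rho>' (restrict (F \<circ> c) {..m} i) = q} = ?S"
      using F_coords cT by auto
    then have "tgt.wcoord e' q = sum t ?S" by (simp add: e'_def tgt.wcoord_def)
    also have "\<dots> = (\<Sum>p\<in>{p\<in>P. \<gamma> p = q}. sum t {i \<in> ?S. \<rho> (c i) = p})"
      using src.finite_P src.T_coords cT by (intro sum.group[symmetric]) auto
    also have "\<dots> = pushforward (src.wcoord (m, t, c)) q"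
      unfolding pushforward_def src.wcoord_def fst_conv snd_conv
      by (intro sum.cong refl) auto
    finally show "tgt.wcoord e' q = pushforward (src.wcoord (m, t, c)) q" .
  qed
qed

text \<open>The representative chosen by \<open>realization_map\<close> is irrelevant, since the
  coordinates of its image depend only on its own coordinates.\<close>

lemma realization_map_coords:
  assumes U: "U \<in> topspace (realization T lq)"
  shows "realization_map F T' lq' U = tgt.pt (f (src.px U)) (pushforward (src.wx U))"
    "realization_map F T' lq' U \<in> topspace (realization T' lq')"
    "tgt.px (realization_map F T' lq' U) = f (src.px U)"
    "tgt.wx (realization_map F T' lq' U) = pushforward (src.wx U)"
proof -
  obtain m t c where e: "(SOME e. e \<in> U) = (m, t, c)" by (cases "SOME e. e \<in> U")
  have "U = src.pt (src.px U) (src.wx U)" "src.valid (src.px U) (src.wx U)" using src.E_coords[OF U] by auto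
  then have "\<exists>e. e \<in> U" using src.valid_imp_ex unfolding src.pt_def by blast
  then have "(m, t, c) \<in> U" using someI_ex[of "\<lambda>e. e \<in> U"] e by simp
  then have eS: "(m, t, c) \<in> topspace (simplex_sum T lq)"
    using src.E_coords(2)[OF U] unfolding src.pt_def by blast
  have co: "src.pcoord (m, t, c) = src.px U" "src.wcoord (m, t, c) = src.wx U"
    by (simp_all add: src.px_def src.wx_def e)
  note m = map_simplex[OF eS, unfolded co]
  have eq: "realization_map F T' lq' U = real_class T' lq' (m, t, restrict (F \<circ> c) {..m})"
    by (simp add: realization_map_def e)
  show pt: "realization_map F T' lq' U = tgt.pt (f (src.px U)) (pushforward (src.wx U))"
    unfolding eq tgt.real_class_eq_pt[OF m(1)] m(2,3) ..
  have "tgt.valid (f (src.px U)) (pushforward (src.wx U))"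
    using tgt.valid_coords[OF m(1)] by (simp add: m(2,3))
  from tgt.pt_coords[OF this] show "realization_map F T' lq' U \<in> topspace (realization T' lq')"
    "tgt.px (realization_map F T' lq' U) = f (src.px U)"
    "tgt.wx (realization_map F T' lq' U) = pushforward (src.wx U)" unfolding pt by auto
qed

lemma continuous_map_realization_map:
  assumes F: "continuous_map T T' F"
  shows "continuous_map (realization T lq) (realization T' lq') (realization_map F T' lq')"
proof (rule continuous_compose_quotient_map[OF src.quotient_map_real_class])
  define M where "M = (\<lambda>(m, t, c). (m :: nat, t :: nat \<Rightarrow> real, restrict (F \<circ> c) {..m}))"
  have M_in: "M e \<in> topspace (simplex_sum T' lq')" if "e \<in> topspace (simplex_sum T lq)" for e
    using map_simplex(1) that by (cases e) (simp add: M_def)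
  have "continuous_map (simplex_sum T lq) (simplex_sum T' lq') M"
    unfolding simplex_sum_def[of T]
  proof (rule continuous_map_from_sum_topology)
    fix m :: nat
    let ?Z = "prod_topology (simplex_top m) (nerve T lq m)"
    have "continuous_map ?Z T' (\<lambda>z. F (snd z i))" if "i \<le> m" for i
      using continuous_map_compose[OF src.continuous_map_slice_vertex[OF that] F] by (simp add: o_def)
    then have "continuous_map ?Z (product_topology (\<lambda>_. T') {..m}) (\<lambda>z. restrict (F \<circ> snd z) {..m})"
      unfolding continuous_map_componentwise by auto
    moreover have "restrict (F \<circ> snd z) {..m} \<in> topspace (nerve T' lq' m)" if "z \<in> topspace ?Z" for z
    proof -
      obtain t c where z: "z = (t, c)" by (cases z)
      have "(m, t, c) \<in> topspace (simplex_sum T lq)" using that by (simp add: z simplex_sum_def)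
      from M_in[OF this] show ?thesis
        unfolding M_def prod.case tgt.topspace_simplex_sum_iff tgt.topspace_nerve_iff z snd_conv by blast
    qed
    ultimately have "continuous_map ?Z (nerve T' lq' m) (\<lambda>z. restrict (F \<circ> snd z) {..m})"
      unfolding nerve_def[of T'] continuous_map_in_subtopology by (auto simp: nerve_def)
    then have "continuous_map ?Z (prod_topology (simplex_top m) (nerve T' lq' m)) (\<lambda>z. (fst z, restrict (F \<circ> snd z) {..m}))"
      by (intro continuous_map_paired[THEN iffD2, OF conjI] continuous_map_fst)
    from continuous_map_compose[OF this continuous_map_component_injection[of m UNIV "\<lambda>m. prod_topology (simplex_top m) (nerve T' lq' m)"]]
    show "continuous_map ?Z (simplex_sum T' lq') (\<lambda>z. M (m, z))"
      by (simp add: M_def simplex_sum_def o_def case_prod_unfold)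
  qed
  from continuous_map_compose[OF this quotient_imp_continuous_map[OF tgt.quotient_map_real_class]]
  show "continuous_map (simplex_sum T lq) (realization T' lq') (realization_map F T' lq' \<circ> real_class T lq)"
  proof (rule continuous_map_eq)
    fix e assume e: "e \<in> topspace (simplex_sum T lq)"
    have U: "real_class T lq e \<in> topspace (realization T lq)"
      using quotient_imp_surjective_map[OF src.quotient_map_real_class] e by blast
    obtain m t c where mtc: "e = (m, t, c)" by (cases e)
    have "real_class T' lq' (M e) = tgt.pt (f (src.pcoord e)) (pushforward (src.wcoord e))"
      using tgt.real_class_eq_pt[OF M_in[OF e]] map_simplex(2,3)[OF e[unfolded mtc]] by (simp add: M_def mtc)
    then show "(real_class T' lq' \<circ> M) e = (realization_map F T' lq' \<circ> real_class T lq) e"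
      using realization_map_coords(1)[OF U] by (simp add: src.px_real_class[OF e] src.wx_real_class[OF e])
  qed
qed

end

section \<open>The two instances and the theorem\<close>

lemma topspace_XP_top:
  "topspace (XP_top X P lq \<phi>) = {(x, p). x \<in> topspace X \<and> p \<in> P \<and> lq (\<phi> x) p}"
  by (auto simp: XP_top_def)

lemma topological_poset_over_XP:
  assumes "finite P" "Hausdorff_space X"
    and "\<And>p. p \<in> P \<Longrightarrow> lq p p"
    and "\<And>p q. \<lbrakk>p \<in> P; q \<in> P; lq p q; lq q p\<rbrakk> \<Longrightarrow> p = q"
    and trans: "\<And>p q r. \<lbrakk>lq p q; lq q r\<rbrakk> \<Longrightarrow> lq p r"
    and "\<And>p. p \<in> P \<Longrightarrow> openin X {x \<in> topspace X. lq (\<phi> x) p}"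
  shows "topological_poset_over X P lq (\<lambda>x. lq (\<phi> x)) (XP_top X P lq \<phi>) (XP_le lq) fst snd Pair"
proof
  show "continuous_map (XP_top X P lq \<phi>) X fst"
    unfolding XP_top_def by (intro continuous_map_from_subtopology continuous_map_fst)
  show "continuous_map (XP_top X P lq \<phi>) (discrete_topology P) snd"
    unfolding XP_top_def by (intro continuous_map_from_subtopology continuous_map_snd)
  show "continuous_map (subtopology X {x. lq (\<phi> x) p}) (XP_top X P lq \<phi>) (\<lambda>x. (x, p))" if "p \<in> P" for p
    unfolding XP_top_def continuous_map_in_subtopology
    using that by (auto simp: continuous_map_pairwise o_def)
  show "lq (\<phi> x) q" if "lq (\<phi> x) p" "lq p q" for x p q using trans that .
  show "lq p r" if "lq p q" "lq q r" for p q r using trans that .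
qed (use assms(1-4,6) in \<open>auto simp: topspace_XP_top XP_le_def\<close>)

lemma topological_poset_over_discrete:
  assumes "finite P"
    and "\<And>p. p \<in> P \<Longrightarrow> lq p p"
    and "\<And>p q. \<lbrakk>p \<in> P; q \<in> P; lq p q; lq q p\<rbrakk> \<Longrightarrow> p = q"
    and trans: "\<And>p q r. \<lbrakk>lq p q; lq q r\<rbrakk> \<Longrightarrow> lq p r"
  shows "topological_poset_over (discrete_topology {()}) P lq (\<lambda>_ _. True)
    (discrete_topology P) lq (\<lambda>_. ()) (\<lambda>p. p) (\<lambda>_ p. p)"
proof
  show "lq p r" if "lq p q" "lq q r" for p q r using trans that .
qed (use assms(1-3) in \<open>auto simp: Hausdorff_space_discrete_topology\<close>)

theorem theorem5:
  fixes n :: nat and A :: "'a set"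
  assumes "n \<ge> 1" and "finite A"
  defines "X \<equiv> Conf n A" and "P \<equiv> Gn n A"
  defines "XP \<equiv> realization (XP_top X P Gn_le (psi A)) (XP_le Gn_le)"
  defines "BP \<equiv> poset_realization P Gn_le"
  shows "weak_homotopy_equivalence XP X XP_mu
       \<and> weak_homotopy_equivalence XP BP (XP_pi P Gn_le)
       \<and> (\<forall>\<sigma>. bij_betw \<sigma> A A \<longrightarrow>
            (\<forall>U\<in>topspace XP.
               XP_mu (realization_map (\<lambda>(x, p). (conf_act A \<sigma> x, graph_act \<sigma> p))
                        (XP_top X P Gn_le (psi A)) (XP_le Gn_le) U)
                 = conf_act A \<sigma> (XP_mu U)
             \<and> XP_pi P Gn_le (realization_map (\<lambda>(x, p). (conf_act A \<sigma> x, graph_act \<sigma> p))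
                        (XP_top X P Gn_le (psi A)) (XP_le Gn_le) U)
                 = realization_map (graph_act \<sigma>) (discrete_topology P) Gn_le (XP_pi P Gn_le U)))"
proof -
  let ?T = "XP_top X P Gn_le (psi A)"
  have fin: "finite P" and anti: "\<And>g h. \<lbrakk>g \<in> P; h \<in> P; Gn_le g h; Gn_le h g\<rbrakk> \<Longrightarrow> g = h"
    unfolding P_def using finite_Gn[OF \<open>finite A\<close>] Gn_le_antisym by blast+
  interpret E: topological_poset_over X P Gn_le "\<lambda>x. Gn_le (psi A x)" ?T "XP_le Gn_le" fst snd Pair
    by (rule topological_poset_over_XP)
      (use fin anti Gn_le_refl Gn_le_trans Hausdorff_Conf openin_Conf_region[OF \<open>finite A\<close>] in \<open>auto simp: X_def P_def\<close>)
  interpret B: topological_poset_over "discrete_topology {()}" P Gn_le "\<lambda>_ _. True"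
      "discrete_topology P" Gn_le "\<lambda>_. ()" "\<lambda>p. p" "\<lambda>_ p. p"
    by (rule topological_poset_over_discrete) (use fin anti Gn_le_refl Gn_le_trans in auto)
  interpret C: contractible_regions X P Gn_le "\<lambda>x. Gn_le (psi A x)" ?T "XP_le Gn_le" fst snd Pair
      "Conf_ambient n A" "{x. inj_on x A \<and> (\<forall>a\<in>A. \<forall>i<n. 0 < x a i \<and> x a i < 1)}" "straighten n A" "straight n A"
  proof
    show "X = subtopology (Conf_ambient n A) {x. inj_on x A \<and> (\<forall>a\<in>A. \<forall>i<n. 0 < x a i \<and> x a i < 1)}"
      unfolding X_def by (rule Conf_eq_subtopology)
    show "straighten n A p s x \<in> topspace X \<and> Gn_le (psi A (straighten n A p s x)) p"
      if "p \<in> P" "x \<in> topspace X" "Gn_le (psi A x) p" for p x s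
      using straighten_region[OF \<open>finite A\<close>] that unfolding X_def P_def by blast
    show "straight n A p \<in> topspace X \<and> Gn_le (psi A (straight n A p)) p" if "p \<in> P" for p
      using straight_region[OF \<open>finite A\<close>] that unfolding X_def P_def by blast
  qed (rule continuous_map_straighten straighten_0 straighten_1; assumption)+
  interpret pi: realization_morphism X P Gn_le "\<lambda>x. Gn_le (psi A x)" ?T "XP_le Gn_le" fst snd Pair
      "discrete_topology {()}" P Gn_le "\<lambda>_ _. True" "discrete_topology P" Gn_le "\<lambda>_. ()" "\<lambda>p. p" "\<lambda>_ p. p"
      snd "\<lambda>_. ()" "\<lambda>p. p"
    by unfold_locales (auto simp: topspace_XP_top)
  have XP: "XP = E.E" and BP: "BP = B.E" by (simp_all add: XP_def BP_def poset_realization_def)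
  have mu: "XP_mu = E.px"
    by (simp add: XP_mu_def E.px_def E.pcoord_def fun_eq_iff case_prod_unfold)
  have push_id: "pi.pushforward w = w" if "E.weights w" for w
  proof
    fix q
    have "{p\<in>P. p = q} = (if q \<in> P then {q} else {})" by auto
    then show "pi.pushforward w q = w q" using that by (simp add: pi.pushforward_def E.weights_def)
  qed
  have pi: "XP_pi P Gn_le U = B.pt () (E.wx U)" if U: "U \<in> topspace E.E" for U
  proof -
    have "E.weights (E.wx U)" using E.E_coords(1)[OF U] by (simp add: E.valid_iff_weights)
    then show ?thesis using pi.realization_map_coords(1)[OF U] by (simp only: XP_pi_def push_id)
  qed
  have valid_B: "B.valid () w \<longleftrightarrow> E.weights w" for w
    by (simp add: B.valid_iff_weights)

  have mu_we: "weak_homotopy_equivalence XP X XP_mu"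
    unfolding XP mu
  proof (rule weak_homotopy_equivalence_relative_lifting[OF E.continuous_map_px])
    show "relative_lifting E.E X E.px"
      by (rule E.relative_lifting_px[where \<psi> = "psi A"]) (auto simp: X_def P_def psi_in_Gn)
  qed

  have lift: "relative_lifting E.E B.E (\<lambda>U. B.pt () (E.wx U))"
  proof (rule C.relative_lifting_weights[where wx' = B.wx])
    show "E.weights (B.wx e) \<and> B.pt () (B.wx e) = e" if "e \<in> topspace B.E" for e
      using B.E_coords[OF that] valid_B by (simp add: unit_eq)
    show "B.wx (B.pt () w) = w" if "E.weights w" for w
      using B.pt_coords(3)[of "()" w] that valid_B by simp
    show "continuous_map B.E euclideanreal (\<lambda>e. B.wx e p)" for p by (rule B.continuous_map_wx)
    \<comment> \<open>Over a point every region is the whole space, so the support condition holds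
      trivially and continuous weights suffice.\<close>
    show "continuous_map (top_of_set S) B.E (\<lambda>k. B.pt () (w k))"
      if "\<And>k. k \<in> S \<Longrightarrow> E.weights (w k)" "\<And>p. p \<in> P \<Longrightarrow> continuous_on S (\<lambda>k. w k p)"
      for S :: "(real \<times> (nat \<Rightarrow> real) \<times> real) set" and w
      using that by (intro B.continuous_map_of_good) (simp add: B.good_def B.supports_def valid_B)
  qed
  have "continuous_map E.E B.E (XP_pi P Gn_le)"
    unfolding XP_pi_def by (rule pi.continuous_map_realization_map[OF E.cont_\<rho>])
  moreover have "relative_lifting E.E B.E (XP_pi P Gn_le)"
    by (rule relative_lifting_cong[OF lift]) (simp add: pi)
  ultimately have pi_we: "weak_homotopy_equivalence XP BP (XP_pi P Gn_le)"
    unfolding XP BP by (rule weak_homotopy_equivalence_relative_lifting)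

  have "XP_mu (realization_map (\<lambda>(x, p). (conf_act A \<sigma> x, graph_act \<sigma> p)) ?T (XP_le Gn_le) U) = conf_act A \<sigma> (XP_mu U)
      \<and> XP_pi P Gn_le (realization_map (\<lambda>(x, p). (conf_act A \<sigma> x, graph_act \<sigma> p)) ?T (XP_le Gn_le) U)
        = realization_map (graph_act \<sigma>) (discrete_topology P) Gn_le (XP_pi P Gn_le U)"
    if \<sigma>: "bij_betw \<sigma> A A" and U: "U \<in> topspace E.E" for \<sigma> U
  proof -
    let ?F = "\<lambda>(x, p). (conf_act A \<sigma> x, graph_act \<sigma> p)"
    interpret F: realization_morphism X P Gn_le "\<lambda>x. Gn_le (psi A x)" ?T "XP_le Gn_le" fst snd Pair
        X P Gn_le "\<lambda>x. Gn_le (psi A x)" ?T "XP_le Gn_le" fst snd Pair ?F "conf_act A \<sigma>" "graph_act \<sigma>"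
      by unfold_locales
        (use conf_act_in_Conf[OF \<sigma>] graph_act_in_Gn[OF \<sigma>] graph_act_mono psi_conf_act[OF \<sigma>] in
          \<open>auto simp: topspace_XP_top X_def P_def\<close>)
    interpret G: realization_morphism "discrete_topology {()}" P Gn_le "\<lambda>_ _. True"
        "discrete_topology P" Gn_le "\<lambda>_. ()" "\<lambda>p. p" "\<lambda>_ p. p"
        "discrete_topology {()}" P Gn_le "\<lambda>_ _. True" "discrete_topology P" Gn_le "\<lambda>_. ()" "\<lambda>p. p" "\<lambda>_ p. p"
        "graph_act \<sigma>" "\<lambda>_. ()" "graph_act \<sigma>"
      by unfold_locales (use graph_act_in_Gn[OF \<sigma>] graph_act_mono in \<open>auto simp: P_def\<close>)
    let ?W = "realization_map ?F ?T (XP_le Gn_le) U"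
    note W = F.realization_map_coords[OF U]
    have B: "B.pt () (E.wx U) \<in> topspace B.E" "B.wx (B.pt () (E.wx U)) = E.wx U"
      using B.pt_coords[of "()" "E.wx U"] valid_B E.E_coords(1)[OF U] by (auto simp: E.valid_iff_weights)
    have "realization_map (graph_act \<sigma>) (discrete_topology P) Gn_le (B.pt () (E.wx U)) = B.pt () (G.pushforward (E.wx U))"
      using G.realization_map_coords(1)[OF B(1)] B(2) by simp
    \<comment> \<open>Both actions push weights forward along \<open>graph_act \<sigma>\<close>, so
      the two sides have the same weights.\<close>
    moreover have "G.pushforward = F.pushforward" by (simp add: G.pushforward_def F.pushforward_def fun_eq_iff)
    ultimately show ?thesis using W pi[OF W(2)] pi[OF U] by (simp add: mu)
  qed
  then show ?thesis using mu_we pi_we by (simp add: XP)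
qed

end
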